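(* Let $(G_n)_{n\ge1}$ be a projective sequence of random graphs with labels in $[n]=\{1,\dots,n\}$ such that $G_n$ is invariant under permutations of $[n]$ for every $n\geq 1$. Then the projective limit $G_\infty$ of $(G_n)_{n\ge1}$ is a random graph with labels in $\mathbb{N}$ that is invariant under infinite permutations, i.e. under all permutations of $\mathbb{N}$. Therefore, $G_\infty$ is a $W$-random graph, where $W$ is a (possibly random) graphon.
   Context: $\mathbb{N}=\{1,2,\dots\}$. A random graph with labels in a countable discrete set $\mathbb{L}$ is a random symmetric simple counting measure on $\mathbb{L}\times\mathbb{L}$, equivalently a random symmetric $\{0,1\}$-valued array $(X_{ij})_{i,j\in\mathbb{L}}$, where $X_{ij}=1$ means that $\{i,j\}$ is an edge; self-loops $X_{ii}=1$ are allowed (the paper uses them to represent isolated vertices). It is identified with its distribution. A sequence $(G_n)$ of random graphs with labels in $[n]$ is projective if for all $n\le m$ the restriction of (the array of) $G_m$ to $[n]\times[n]$ has the same distribution as $G_n$. The projective limit $G_\infty$ is the random graph with labels in $\mathbb{N}$ (unique in distribution) whose restriction to $[n]\times[n]$ has the distribution of $G_n$ for every $n$. A random graph with labels in $\mathbb{L}$ is invariant under a permutation $\varphi$ of $\mathbb{L}$ if $(X_{\varphi(i)\varphi(j)})_{i,j}$ has the same distribution as $(X_{ij})_{i,j}$. A graphon is a symmetric measurable function $W:[0,1]\times[0,1]\to[0,1]$. The $W$-random graph is constructed by sampling i.i.d. $x_1,x_2,\dots$ uniformly on $[0,1]$ and, given these, connecting $i$ and $j$ (i.e. setting $X_{ij}=X_{ji}=1$,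 otherwise $0$) independently over pairs $i\le j$ with probability $W(x_i,x_j)$. "$W$-random with a possibly random graphon" means that the distribution is a probabilistic mixture of distributions of $W$-random graphs: there is a measurable function $W:[0,1]^3\to[0,1]$, $(\alpha,x,y)\mapsto W_\alpha(x,y)$, symmetric in $(x,y)$, such that, with $\alpha$ uniform on $[0,1]$ and independent of all else, the graph is conditionally on $\alpha$ a $W_\alpha$-random graph. *)

theory Defs
  imports "HOL-Probability.Probability"
begin

text \<open>
  A random graph with labels in \<open>L\<close> is identified with its distribution, a probability measure on
  the arrays \<open>X : L \<times> L \<rightarrow> {0,1}\<close>; \<open>X (i, j) = True\<close> encodes \<open>X_ij = 1\<close>. Self-loops \<open>X (i, i)\<close> are
  allowed. For countable \<open>L\<close> the product \<open>\<sigma>\<close>-algebra makes the set of symmetric arrays measurable.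
\<close>

definition graph_space :: "nat set \<Rightarrow> (nat \<times> nat \<Rightarrow> bool) measure" where
  "graph_space L = PiM (L \<times> L) (\<lambda>_. count_space UNIV)"

definition random_graph :: "nat set \<Rightarrow> (nat \<times> nat \<Rightarrow> bool) measure \<Rightarrow> bool" where
  "random_graph L M \<longleftrightarrow> prob_space M \<and> sets M = sets (graph_space L) \<and>
     (AE X in M. \<forall>i\<in>L. \<forall>j\<in>L. X (i, j) = X (j, i))"

definition restrict_graph ::
    "nat set \<Rightarrow> (nat \<times> nat \<Rightarrow> bool) measure \<Rightarrow> (nat \<times> nat \<Rightarrow> bool) measure" where
  "restrict_graph K M = distr M (graph_space K) (\<lambda>X. restrict X (K \<times> K))"

definition relabel_graph ::
    "nat set \<Rightarrow> (nat \<Rightarrow> nat) \<Rightarrow> (nat \<times> nat \<Rightarrow> bool) measure \<Rightarrow> (nat \<times> nat \<Rightarrow> bool) measure" where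
  "relabel_graph L \<phi> M = distr M (graph_space L) (\<lambda>X. \<lambda>(i, j)\<in>L \<times> L. X (\<phi> i, \<phi> j))"

definition permutation_invariant :: "nat set \<Rightarrow> (nat \<times> nat \<Rightarrow> bool) measure \<Rightarrow> bool" where
  "permutation_invariant L M \<longleftrightarrow> (\<forall>\<phi>. \<phi> permutes L \<longrightarrow> relabel_graph L \<phi> M = M)"

text \<open>The label sets are \<open>[n] = {1..n}\<close> and \<open>{1..} = {1, 2, \<dots>}\<close>; the value \<open>G 0\<close> is irrelevant.\<close>

definition projective_sequence :: "(nat \<Rightarrow> (nat \<times> nat \<Rightarrow> bool) measure) \<Rightarrow> bool" where
  "projective_sequence G \<longleftrightarrow> (\<forall>n\<ge>1. random_graph {1..n} (G n)) \<and>
     (\<forall>n m. 1 \<le> n \<and> n \<le> m \<longrightarrow> restrict_graph {1..n} (G m) = G n)"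

definition is_projective_limit ::
    "(nat \<Rightarrow> (nat \<times> nat \<Rightarrow> bool) measure) \<Rightarrow> (nat \<times> nat \<Rightarrow> bool) measure \<Rightarrow> bool" where
  "is_projective_limit G P \<longleftrightarrow> random_graph {1..} P \<and>
     (\<forall>n\<ge>1. restrict_graph {1..n} P = G n)"

text \<open>
  The uniform distribution on \<open>[0,1]\<close>, with \<open>[0,1]\<close> itself as underlying space, so that graphons
  are only ever evaluated (and only need to be measurable) on the unit interval.
\<close>

definition unif01 :: "real measure" where
  "unif01 = restrict_space lborel {0..1}"

text \<open>
  Measurability of graphons is Borel measurability: the loop probabilities \<open>W x x\<close> live on a null
  set, where Lebesgue measurability would carry no information.
\<close>

definition graphon :: "(real \<Rightarrow> real \<Rightarrow> real) \<Rightarrow> bool" where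
  "graphon W \<longleftrightarrow>
     (\<lambda>(x, y). W x y) \<in> borel_measurable (restrict_space borel ({0..1} \<times> {0..1})) \<and>
     (\<forall>x\<in>{0..1}. \<forall>y\<in>{0..1}. W x y \<in> {0..1} \<and> W x y = W y x)"

definition random_graphon :: "(real \<Rightarrow> real \<Rightarrow> real \<Rightarrow> real) \<Rightarrow> bool" where
  "random_graphon W \<longleftrightarrow>
     (\<lambda>(\<alpha>, x, y). W \<alpha> x y)
       \<in> borel_measurable (restrict_space borel ({0..1} \<times> {0..1} \<times> {0..1})) \<and>
     (\<forall>\<alpha>\<in>{0..1}. graphon (W \<alpha>))"

text \<open>
  The conditional law of the graph given the vertex labels \<open>x\<close>: independent Bernoulli variables
  \<open>Y (i, j)\<close> over the pairs \<open>i \<le> j\<close> (loops included), extended symmetrically.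
\<close>

definition edge_law :: "(real \<Rightarrow> real \<Rightarrow> real) \<Rightarrow> (nat \<Rightarrow> real) \<Rightarrow> (nat \<times> nat \<Rightarrow> bool) measure" where
  "edge_law W x =
     distr (PiM {(i, j). 1 \<le> i \<and> i \<le> j} (\<lambda>(i, j). measure_pmf (bernoulli_pmf (W (x i) (x j)))))
       (graph_space {1..}) (\<lambda>Y. \<lambda>(i, j)\<in>{1..} \<times> {1..}. Y (min i j, max i j))"

definition W_random_graph :: "(real \<Rightarrow> real \<Rightarrow> real) \<Rightarrow> (nat \<times> nat \<Rightarrow> bool) measure" where
  "W_random_graph W = PiM {1..} (\<lambda>_. unif01) \<bind> edge_law W"

definition mixed_W_random_graph ::
    "(real \<Rightarrow> real \<Rightarrow> real \<Rightarrow> real) \<Rightarrow> (nat \<times> nat \<Rightarrow> bool) measure" where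
  "mixed_W_random_graph W = unif01 \<bind> (\<lambda>\<alpha>. W_random_graph (W \<alpha>))"

end

theory Submission
  imports Defs
begin

text \<open>
  The projective limit is obtained by coding: bit strings with consistent probabilities are turned
  into a measurable map from \<open>[0,1]\<close> by successive subdivision of the interval.

  For the representation, the vertices of the limit graph are split into two infinite halves, the past
  (odd labels) and the future (even labels). Let \<open>F\<close> be the graph on the past and let the star \<open>Y\<^sub>i\<close> of
  a future vertex \<open>i\<close> consist of its loop and its edges to the past. A conditional probability given
  the graph on a label set \<open>A\<close> has the same distribution, hence the same \<open>L\<^sup>2\<close> norm, for every
  infinite \<open>A\<close>; as enlarging \<open>A\<close> refines the conditioning, the conditional probability does not change.
  Therefore the stars \<open>Y\<^sub>i\<close> are conditionally i.i.d. given \<open>F\<close>, and the edges between future vertices are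
  conditionally independent given \<open>F\<close> and all the stars, the edge \<open>{i, j}\<close> having a probability
  \<open>w(F, Y\<^sub>i, Y\<^sub>j)\<close>. Coding \<open>F\<close> by a uniform \<open>\<alpha>\<close> and, given \<open>F\<close>, each \<open>Y\<^sub>i\<close> by a uniform \<open>x\<^sub>i\<close> yields the
  random graphon. By exchangeability the future graph has the law of the whole graph.
\<close>

section \<open>Measures on bit arrays and conditional probabilities\<close>

text \<open>Conditional independence is obtained without tail fields or de Finetti's theorem. If b
  is the conditional probability of an event given some information and a the one given part of it,
  then a is the projection of b, so E (a - b)^2 = E b^2 - E a^2, which vanishes once a and b have
  the same law. Discarding vertices is a relabelling by an injection that is not onto; hence the law
  has to be invariant under injections, not only under permutations. The projective limit has this
  invariance because a cylinder sees finitely many labels, on which an injection extends to a finite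
  permutation. Infinitely many vertices are set aside as the past so that they are available in
  every conditioning; the vertices shown to be irrelevant are the other future ones. Null sets are
  the remaining obstacle: conditional probabilities of bit strings are consistent only almost
  surely, so decoding is defined for every family of string probabilities and analysed only for the
  consistent ones.\<close>

lemma emeasure_prod_emb_cylinders:
  fixes I J K :: "'i set" and A :: "'i \<Rightarrow> bool set"
  assumes K: "finite K" "J \<subseteq> K" "K \<subseteq> I"
  obtains B where "finite B"
    "\<And>P. sets P = sets (PiM I (\<lambda>_. count_space UNIV)) \<Longrightarrow>
      emeasure P (prod_emb I (\<lambda>_. count_space UNIV) J (PiE J A)) =
      (\<Sum>e\<in>B. emeasure P {x \<in> space P. \<forall>k\<in>K. x k = e k})"
proof
  let ?M = "\<lambda>_::'i. count_space (UNIV :: bool set)"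
  \<comment> \<open>\<open>B\<close> is determined by \<open>J\<close>, \<open>K\<close> and
    \<open>A\<close> alone, so one finite decomposition into fully specified patterns on
    \<open>K\<close> serves two measures at once in \<open>measure_eqI_cylinders\<close> and a whole
    family of measures in \<open>measurable_graph_kernel\<close>.\<close>
  define B where "B = {e \<in> PiE K (\<lambda>_. UNIV :: bool set). \<forall>j\<in>J. e j \<in> A j}"
  show finB: "finite B" unfolding B_def by (rule finite_subset[OF _ finite_PiE[OF K(1)]]) auto
  have set_eq: "prod_emb I ?M J (PiE J A) = (\<Union>e\<in>B. {x \<in> space (PiM I ?M). \<forall>k\<in>K. x k = e k})" (is "?L = ?R")
  proof (intro set_eqI iffI)
    fix x assume x: "x \<in> ?L"
    then have "restrict x K \<in> B" "x \<in> space (PiM I ?M)" using K(2)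
      by (auto simp: prod_emb_def B_def space_PiM PiE_iff subset_eq)
    then show "x \<in> ?R" by (intro UN_I[of "restrict x K"]) auto
  next
    fix x assume "x \<in> ?R"
    then show "x \<in> ?L" using K(2)
      by (auto simp: prod_emb_def B_def space_PiM PiE_iff subset_eq extensional_def)
  qed
  have disj: "disjoint_family_on (\<lambda>e. {x \<in> space (PiM I ?M). \<forall>k\<in>K. x k = e k}) B"
    unfolding disjoint_family_on_def B_def
    by (auto simp: PiE_iff intro!: extensionalityI)
  have meas: "{x \<in> space (PiM I ?M). \<forall>k\<in>K. x k = e k} \<in> sets (PiM I ?M)" for e
  proof (rule sets.sets_Collect_finite_All[OF _ K(1)])
    fix k assume k: "k \<in> K"
    have "(\<lambda>x. x k) -` {e k} \<inter> space (PiM I ?M) \<in> sets (PiM I ?M)"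
      using K(3) k by (intro measurable_sets[OF measurable_component_singleton]) auto
    then show "{x \<in> space (PiM I ?M). x k = e k} \<in> sets (PiM I ?M)"
      by (simp add: vimage_def Int_def conj_commute)
  qed
  fix P :: "('i \<Rightarrow> bool) measure" assume P: "sets P = sets (PiM I ?M)"
  show "emeasure P (prod_emb I ?M J (PiE J A)) = (\<Sum>e\<in>B. emeasure P {x \<in> space P. \<forall>k\<in>K. x k = e k})"
    unfolding set_eq sets_eq_imp_space_eq[OF P]
    by (rule sum_emeasure[symmetric]) (use finB disj meas P in auto)
qed

text \<open>The choice of \<open>K\<close> is left open so that the measures can be compared on
  whichever cofinal family is convenient: initial segments, squares or rectangles.\<close>

lemma measure_eqI_cylinders:
  fixes P Q :: "('i \<Rightarrow> bool) measure"
  assumes sP: "sets P = sets (PiM I (\<lambda>_. count_space UNIV))"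
    and sQ: "sets Q = sets (PiM I (\<lambda>_. count_space UNIV))"
    and fin: "finite_measure P"
    and cyl: "\<And>J. finite J \<Longrightarrow> J \<subseteq> I \<Longrightarrow> \<exists>K. finite K \<and> J \<subseteq> K \<and> K \<subseteq> I \<and>
      (\<forall>e. emeasure P {x \<in> space P. \<forall>k\<in>K. x k = e k} = emeasure Q {x \<in> space Q. \<forall>k\<in>K. x k = e k})"
  shows "P = Q"
proof (rule measure_eqI_PiM_infinite[OF sP sQ _ fin])
  fix A :: "'i \<Rightarrow> bool set" and J
  assume J: "finite J" "J \<subseteq> I"
  obtain K where K: "finite K" "J \<subseteq> K" "K \<subseteq> I"
    and eq: "\<And>e. emeasure P {x \<in> space P. \<forall>k\<in>K. x k = e k} = emeasure Q {x \<in> space Q. \<forall>k\<in>K. x k = e k}"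
    using cyl[OF J] by blast
  show "emeasure P (prod_emb I (\<lambda>_. count_space UNIV) J (PiE J A)) =
      emeasure Q (prod_emb I (\<lambda>_. count_space UNIV) J (PiE J A))"
    by (rule emeasure_prod_emb_cylinders[OF K, of A]) (simp only: sP sQ eq)
qed

text \<open>\<open>h\<close> is the Radon-Nikodym density of the law of \<open>f\<close> on the
  event \<open>E\<close> with respect to the whole law of \<open>f\<close>. It is a function on the
  target of \<open>f\<close>, not on \<open>M\<close>, so that it can be evaluated at other maps
  into the same target; this makes a conditional probability transportable under
  relabelling.\<close>

lemma cond_prob_exists:
  assumes "prob_space M" and [measurable]: "f \<in> M \<rightarrow>\<^sub>M N" "E \<in> sets M"
  obtains h :: "'b \<Rightarrow> real" where "h \<in> borel_measurable N" "\<And>x. 0 \<le> h x \<and> h x \<le> 1"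
    "\<And>g. g \<in> borel_measurable N \<Longrightarrow>
      (\<integral>\<^sup>+x. indicator E x * g (f x) \<partial>M) = (\<integral>\<^sup>+x. ennreal (h (f x)) * g (f x) \<partial>M)"
proof -
  interpret prob_space M by fact
  define D where "D = distr M N f"
  define D' where "D' = distr (density M (indicator E)) N f"
  interpret D: prob_space D unfolding D_def by (rule prob_space_distr) simp
  have [measurable_cong]: "sets D = sets N" "sets D' = sets N" by (auto simp: D_def D'_def)
  have D'_le: "emeasure D' A \<le> emeasure D A" if "A \<in> sets N" for A
  proof -
    have [measurable]: "A \<in> sets N" by fact
    have "emeasure D' A = (\<integral>\<^sup>+x. indicator E x * indicator (f -` A \<inter> space M) x \<partial>M)"
      unfolding D'_def by (simp add: emeasure_distr emeasure_density)
    also have "\<dots> \<le> (\<integral>\<^sup>+x. indicator (f -` A \<inter> space M) x \<partial>M)"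
      by (intro nn_integral_mono) (auto split: split_indicator)
    also have "\<dots> = emeasure D A" unfolding D_def by (simp add: emeasure_distr)
    finally show ?thesis .
  qed
  have "absolutely_continuous D D'"
    unfolding absolutely_continuous_def
  proof
    fix A assume "A \<in> null_sets D"
    then show "A \<in> null_sets D'" using D'_le[of A] by (auto simp: null_sets_def D_def D'_def)
  qed
  then obtain k where k[measurable]: "k \<in> borel_measurable D" and dens: "density D k = D'"
    using D.Radon_Nikodym[of D'] by (auto simp: D_def D'_def)
  \<comment> \<open>Where \<open>k\<close> exceeds 1 the difference \<open>k - 1\<close> is
    positive, yet its integral over that set is not, because \<open>D'\<close> lies below
    \<open>D\<close>.\<close>
  have le1: "AE x in D. k x \<le> 1"
  proof -
    define A where "A = {x \<in> space D. 1 < k x}"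
    have [measurable]: "A \<in> sets D" unfolding A_def by measurable
    have "(\<integral>\<^sup>+x. k x * indicator A x \<partial>D) = emeasure D' A"
      unfolding dens[symmetric] by (subst emeasure_density) auto
    also have "\<dots> \<le> emeasure D A" using \<open>A \<in> sets D\<close> by (intro D'_le) (simp add: D_def)
    finally have le: "(\<integral>\<^sup>+x. k x * indicator A x \<partial>D) \<le> emeasure D A" .
    have "(\<integral>\<^sup>+x. k x * indicator A x - indicator A x \<partial>D) = (\<integral>\<^sup>+x. k x * indicator A x \<partial>D) - emeasure D A"
      by (subst nn_integral_diff) (auto simp: A_def split: split_indicator)
    also have "\<dots> = 0" using diff_eq_0_ennreal[OF le_less_trans[OF le] le] by (simp add: less_top[symmetric])
    finally have "AE x in D. k x * indicator A x - indicator A x = 0"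
      by (subst (asm) nn_integral_0_iff_AE) auto
    then show ?thesis
    proof (rule AE_mp, intro AE_I2 impI)
      fix x assume "x \<in> space D" "k x * indicator A x - indicator A x = 0"
      then show "k x \<le> 1" unfolding A_def
        by (auto split: split_indicator_asm simp: not_less[symmetric] diff_eq_0_iff_ennreal)
    qed
  qed
  \<comment> \<open>The density is bounded by 1 only almost everywhere. Truncation gives the bounds
    at every point, as the values of a graphon require.\<close>
  define h where "h x = enn2real (min 1 (k x))" for x
  have fin: "min 1 (k x) < top" for x by (simp add: min_less_iff_disj)
  have hk: "ennreal (h x) = min 1 (k x)" for x using fin[of x] by (simp add: h_def)
  show thesis
  proof
    show [measurable]: "h \<in> borel_measurable N" unfolding h_def by measurable
    show "0 \<le> h x \<and> h x \<le> 1" for x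
      using enn2real_mono[of "min 1 (k x)" 1] by (auto simp: h_def)
    fix g :: "'b \<Rightarrow> ennreal" assume [measurable]: "g \<in> borel_measurable N"
    have "(\<integral>\<^sup>+x. indicator E x * g (f x) \<partial>M) = (\<integral>\<^sup>+x. g x \<partial>D')"
      unfolding D'_def by (simp add: nn_integral_distr nn_integral_density)
    also have "\<dots> = (\<integral>\<^sup>+x. k x * g x \<partial>D)"
      unfolding dens[symmetric] by (simp add: nn_integral_density)
    also have "\<dots> = (\<integral>\<^sup>+x. ennreal (h x) * g x \<partial>D)"
      by (rule nn_integral_cong_AE, rule AE_mp[OF le1]) (auto simp: hk min_absorb2)
    also have "\<dots> = (\<integral>\<^sup>+x. ennreal (h (f x)) * g (f x) \<partial>M)"
      unfolding D_def by (simp add: nn_integral_distr)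
    finally show "(\<integral>\<^sup>+x. indicator E x * g (f x) \<partial>M) = (\<integral>\<^sup>+x. ennreal (h (f x)) * g (f x) \<partial>M)" .
  qed
qed

text \<open>\<open>f\<close> is a coarsening of \<open>f'\<close> through \<open>g\<close>. With a =
  \<open>h (f x)\<close> and b = \<open>h (f' x)\<close>, both conditional probabilities of
  \<open>E\<close>, testing against a gives E a^2 = E ab, and equality of the laws gives E a^2 = E
  b^2; hence E (a - b)^2 = 0.\<close>

lemma cond_prob_L2:
  fixes h :: "'b \<Rightarrow> real"
  assumes "prob_space M" and [measurable]: "f \<in> M \<rightarrow>\<^sub>M N" "f' \<in> M \<rightarrow>\<^sub>M N" "g \<in> N \<rightarrow>\<^sub>M N" "h \<in> borel_measurable N"
    and fg: "\<And>x. x \<in> space M \<Longrightarrow> f x = g (f' x)"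
    and h01: "\<And>x. 0 \<le> h x \<and> h x \<le> 1"
    and law: "distr M N f = distr M N f'"
    and hf: "\<And>\<phi>. \<phi> \<in> borel_measurable N \<Longrightarrow>
      (\<integral>\<^sup>+x. indicator E x * \<phi> (f x) \<partial>M) = (\<integral>\<^sup>+x. ennreal (h (f x)) * \<phi> (f x) \<partial>M)"
    and hf': "\<And>\<phi>. \<phi> \<in> borel_measurable N \<Longrightarrow>
      (\<integral>\<^sup>+x. indicator E x * \<phi> (f' x) \<partial>M) = (\<integral>\<^sup>+x. ennreal (h (f' x)) * \<phi> (f' x) \<partial>M)"
  shows "AE x in M. h (f x) = h (f' x)"
proof -
  interpret prob_space M by fact
  define a where "a x = h (f x)" for x
  define b where "b x = h (f' x)" for x
  have [measurable]: "a \<in> borel_measurable M" "b \<in> borel_measurable M" unfolding a_def b_def by measurable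
  have a: "0 \<le> a x" "a x \<le> 1" and b: "0 \<le> b x" "b x \<le> 1" for x using h01 by (auto simp: a_def b_def)
  have m1: "0 \<le> a x * b x" "a x * b x \<le> 1" "0 \<le> a x * a x" "a x * a x \<le> 1" "0 \<le> b x * b x" "b x * b x \<le> 1" for x
    using a[of x] b[of x] by (auto intro: mult_le_one)
  have I: "integrable M (\<lambda>x. a x * a x)" "integrable M (\<lambda>x. a x * b x)" "integrable M (\<lambda>x. b x * b x)"
    using m1 by (auto intro!: integrable_const_bound[where B=1])
  have nn: "ennreal (expectation (\<lambda>x. u x)) = (\<integral>\<^sup>+x. ennreal (u x) \<partial>M)" if "\<And>x. 0 \<le> u x" "integrable M u" for u
    using nn_integral_eq_integral[OF that(2)] that(1) by auto
  \<comment> \<open>The test function is \<open>h\<close> in \<open>hf\<close> and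
    \<open>h \<circ> g\<close> in \<open>hf'\<close>: being a function of \<open>f\<close>, a is
    also a function of \<open>f'\<close>.\<close>
  have aa_ab: "(\<integral>\<^sup>+x. ennreal (a x * a x) \<partial>M) = (\<integral>\<^sup>+x. ennreal (a x * b x) \<partial>M)"
  proof -
    have "(\<integral>\<^sup>+x. ennreal (a x * a x) \<partial>M) = (\<integral>\<^sup>+x. ennreal (h (f x)) * ennreal (h (f x)) \<partial>M)"
      using h01 by (simp add: a_def ennreal_mult)
    also have "\<dots> = (\<integral>\<^sup>+x. indicator E x * ennreal (h (f x)) \<partial>M)"
      by (rule hf[symmetric]) simp
    also have "\<dots> = (\<integral>\<^sup>+x. indicator E x * ennreal (h (g (f' x))) \<partial>M)"
      by (rule nn_integral_cong) (simp add: fg)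
    also have "\<dots> = (\<integral>\<^sup>+x. ennreal (h (f' x)) * ennreal (h (g (f' x))) \<partial>M)"
      by (rule hf') simp
    also have "\<dots> = (\<integral>\<^sup>+x. ennreal (a x * b x) \<partial>M)"
      using h01 by (intro nn_integral_cong) (simp add: a_def b_def fg ennreal_mult mult.commute)
    finally show ?thesis .
  qed
  have aa_bb: "(\<integral>\<^sup>+x. ennreal (a x * a x) \<partial>M) = (\<integral>\<^sup>+x. ennreal (b x * b x) \<partial>M)"
  proof -
    have "(\<integral>\<^sup>+x. ennreal (h x * h x) \<partial>distr M N f) = (\<integral>\<^sup>+x. ennreal (h x * h x) \<partial>distr M N f')"
      by (simp add: law)
    then show ?thesis by (simp add: nn_integral_distr a_def b_def)
  qed
  have e: "expectation (\<lambda>x. a x * a x) = expectation (\<lambda>x. a x * b x)"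
    "expectation (\<lambda>x. a x * a x) = expectation (\<lambda>x. b x * b x)"
    using aa_ab aa_bb
    unfolding nn[OF m1(1) I(2), symmetric] nn[OF m1(3) I(1), symmetric] nn[OF m1(5) I(3), symmetric]
    using m1 by (simp_all add: integral_nonneg)
  have sq: "(\<lambda>x. (a x - b x)^2) = (\<lambda>x. a x * a x - 2 * (a x * b x) + b x * b x)"
    by (auto simp: power2_eq_square algebra_simps)
  have "expectation (\<lambda>x. (a x - b x)^2) = 0"
    unfolding sq using I e by simp
  moreover have "integrable M (\<lambda>x. (a x - b x)^2)" unfolding sq using I by simp
  ultimately have "AE x in M. (a x - b x)^2 = 0"
    by (subst (asm) integral_nonneg_eq_0_iff_AE) auto
  then show ?thesis by (simp add: a_def b_def)
qed

section \<open>Coding bit sequences by the unit interval\<close>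

abbreviation bits :: "(nat \<Rightarrow> bool) measure" where
  "bits \<equiv> PiM UNIV (\<lambda>_. count_space UNIV)"

lemma space_unif01 [simp]: "space unif01 = {0..1}"
  by (simp add: unif01_def)

lemma prob_space_unif01: "prob_space unif01"
  by (rule prob_spaceI) (simp add: unif01_def emeasure_restrict_space)

lemma AE_unif01_neq: "AE u in unif01. u \<noteq> c"
  unfolding unif01_def by (subst AE_restrict_space_iff) (use AE_lborel_singleton[of c] in auto)

section \<open>Prefixes of bit sequences\<close>

primrec pre :: "(nat \<Rightarrow> 'a) \<Rightarrow> nat \<Rightarrow> 'a list" where
  "pre x 0 = []"
| "pre x (Suc n) = x n # pre x n"

lemma length_pre [simp]: "length (pre x n) = n"
  by (induction n) auto

lemma pre_eq_iff: "pre x n = pre y n \<longleftrightarrow> (\<forall>k<n. x k = y k)"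
  by (induction n) (auto simp: less_Suc_eq)

lemma pre_exhaust: "\<exists>x. pre x (length t) = t"
proof (induction t)
  case (Cons b t)
  then obtain x where x: "pre x (length t) = t" by blast
  have "pre (x(length t := b)) (length t) = pre x (length t)" by (subst pre_eq_iff) auto
  with x have "pre (x(length t := b)) (length (b # t)) = b # t" by (simp del: fun_upd_apply add: fun_upd_same)
  then show ?case by blast
qed simp

lemma measurable_pre:
  assumes f: "\<And>n. (\<lambda>z. f z n) \<in> M \<rightarrow>\<^sub>M count_space (UNIV :: bool set)"
  shows "(\<lambda>z. pre (f z) n) \<in> M \<rightarrow>\<^sub>M count_space UNIV"
proof (induction n)
  case (Suc n)
  have "(\<lambda>z. f z n # t) \<in> M \<rightarrow>\<^sub>M count_space UNIV" for t
    by (rule measurable_compose[OF f]) simp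
  from measurable_compose_countable[OF this Suc] show ?case by simp
qed simp

text \<open>
  Bit strings are stored with the newest bit first, and \<open>p t\<close> is the probability of the string
  \<open>t\<close>. The unit interval is subdivided successively: \<open>t\<close> owns the interval of length \<open>p t\<close>
  starting at \<open>lower_end p t\<close>.
\<close>

definition consistent :: "(bool list \<Rightarrow> real) \<Rightarrow> bool" where
  "consistent p \<longleftrightarrow> p [] = 1 \<and> (\<forall>t. 0 \<le> p t \<and> p t = p (True # t) + p (False # t))"

lemma consistentD:
  assumes "consistent p"
  shows "p [] = 1" "0 \<le> p t" "p t = p (True # t) + p (False # t)"
  using assms unfolding consistent_def by blast+

primrec lower_end :: "(bool list \<Rightarrow> real) \<Rightarrow> bool list \<Rightarrow> real" where
  "lower_end p [] = 0"
| "lower_end p (b # t) = lower_end p t + (if b then 0 else p (True # t))"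

text \<open>A search by nested intervals in which \<open>True\<close> takes the left part of the
  current one. The rule makes sense for every \<open>p\<close>, so it stays jointly measurable for
  kernels that are consistent only almost surely.\<close>

primrec decode_string :: "(bool list \<Rightarrow> real) \<Rightarrow> real \<Rightarrow> nat \<Rightarrow> bool list" where
  "decode_string p u 0 = []"
| "decode_string p u (Suc n) =
     (u < lower_end p (decode_string p u n) + p (True # decode_string p u n)) # decode_string p u n"

definition decode :: "(bool list \<Rightarrow> real) \<Rightarrow> real \<Rightarrow> nat \<Rightarrow> bool" where
  "decode p u n = hd (decode_string p u (Suc n))"

lemma pre_decode [simp]: "pre (decode p u) n = decode_string p u n"
  by (induction n) (auto simp: decode_def)

text \<open>The intervals are half open, so the right end \<open>u = 1\<close> belongs to none of
  them and must be excluded; for \<open>unif01\<close> it is a null point.\<close>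

lemma decode_string_iff:
  assumes "consistent p" "0 \<le> u" "u < 1"
  shows "decode_string p u (length t) = t \<longleftrightarrow> lower_end p t \<le> u \<and> u < lower_end p t + p t"
proof (induction t)
  case Nil
  then show ?case using assms by (simp add: consistentD(1))
next
  case (Cons b t)
  have p: "0 \<le> p (True # t)" "0 \<le> p (False # t)" "p t = p (True # t) + p (False # t)"
    using consistentD[OF assms(1)] by blast+
  have "decode_string p u (length (b # t)) = b # t \<longleftrightarrow>
    decode_string p u (length t) = t \<and> (u < lower_end p t + p (True # t)) = b" by auto
  also have "\<dots> \<longleftrightarrow> lower_end p (b # t) \<le> u \<and> u < lower_end p (b # t) + p (b # t)"
    unfolding Cons.IH using p by (cases b) auto
  finally show ?case .
qed

lemma lower_end_bounds:
  assumes "consistent p"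
  shows "0 \<le> lower_end p t \<and> lower_end p t + p t \<le> 1"
proof (induction t)
  case (Cons b t)
  have "0 \<le> p (True # t)" "0 \<le> p (False # t)" "p t = p (True # t) + p (False # t)"
    using consistentD[OF assms(1)] by blast+
  with Cons show ?case by (cases b) auto
qed (use consistentD(1)[OF assms] in simp)

text \<open>The parameter \<open>c\<close> may move both the subdivision and the point, which yields
  the joint measurability needed for kernels. Strings are countable, so each step of the recursion
  is a case split over the previous string.\<close>

lemma measurable_decode_string:
  fixes p :: "'c \<Rightarrow> bool list \<Rightarrow> real"
  assumes p[measurable]: "\<And>t. (\<lambda>c. p c t) \<in> borel_measurable N"
    and u[measurable]: "u \<in> borel_measurable N"
  shows "(\<lambda>c. decode_string (p c) (u c) n) \<in> N \<rightarrow>\<^sub>M count_space UNIV"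
proof (induction n)
  case (Suc n)
  have l[measurable]: "(\<lambda>c. lower_end (p c) t) \<in> borel_measurable N" for t
    by (induction t) auto
  have "(\<lambda>c. (u c < lower_end (p c) t + p c (True # t)) # t) \<in> N \<rightarrow>\<^sub>M count_space UNIV" for t
    by measurable
  from measurable_compose_countable[OF this Suc] show ?case by simp
qed simp

lemma measurable_decode:
  fixes p :: "'c \<Rightarrow> bool list \<Rightarrow> real"
  assumes "\<And>t. (\<lambda>c. p c t) \<in> borel_measurable N" and "u \<in> borel_measurable N"
  shows "(\<lambda>c. decode (p c) (u c)) \<in> N \<rightarrow>\<^sub>M bits"
proof (rule measurable_PiM_single')
  fix n
  show "(\<lambda>c. decode (p c) (u c) n) \<in> N \<rightarrow>\<^sub>M count_space UNIV"
    unfolding decode_def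
    by (rule measurable_compose[OF measurable_decode_string[OF assms] measurable_count_space])
qed auto

lemma borel_measurable_unif01 [measurable]: "(\<lambda>u. u) \<in> borel_measurable unif01"
  unfolding unif01_def by (rule measurable_restrict_space1) simp

lemma emeasure_decode_string:
  assumes "consistent p"
  shows "emeasure unif01 {u \<in> {0..1}. decode_string p u (length t) = t} = ennreal (p t)"
proof -
  interpret prob_space unif01 by (rule prob_space_unif01)
  note [measurable] = measurable_decode_string[where p="\<lambda>_. p" and N=unif01 and u="\<lambda>u. u"]
  have bd: "0 \<le> lower_end p t" "lower_end p t + p t \<le> 1" "0 \<le> p t"
    using lower_end_bounds[OF assms, of t] consistentD(2)[OF assms] by auto
  have "{u \<in> space unif01. decode_string p u (length t) = t} \<in> sets unif01" by measurable
  moreover have "{lower_end p t..<lower_end p t + p t} \<in> sets unif01"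
    unfolding unif01_def using bd by (subst sets_restrict_space_iff) auto
  moreover have "AE u in unif01. u \<in> {u \<in> {0..1}. decode_string p u (length t) = t} \<longleftrightarrow>
      u \<in> {lower_end p t..<lower_end p t + p t}"
  proof (rule AE_mp[OF AE_unif01_neq[of 1]], intro AE_I2 impI)
    fix u :: real assume "u \<in> space unif01" "u \<noteq> 1"
    then have u: "0 \<le> u" "u < 1" by auto
    show "u \<in> {u \<in> {0..1}. decode_string p u (length t) = t} \<longleftrightarrow>
      u \<in> {lower_end p t..<lower_end p t + p t}"
      unfolding mem_Collect_eq atLeastLessThan_iff decode_string_iff[OF assms u] using u by simp
  qed
  ultimately have "emeasure unif01 {u \<in> {0..1}. decode_string p u (length t) = t}
      = emeasure unif01 {lower_end p t..<lower_end p t + p t}"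
    by (intro emeasure_eq_AE) simp_all
  also have "\<dots> = ennreal (p t)"
    unfolding unif01_def using bd by (subst emeasure_restrict_space) auto
  finally show ?thesis .
qed

lemma measurable_Collect_pre:
  assumes "\<And>n. (\<lambda>z. f z n) \<in> M \<rightarrow>\<^sub>M count_space (UNIV :: bool set)"
  shows "{z \<in> space M. pre (f z) n = t} \<in> sets M"
  using measurable_pre[OF assms] by measurable

lemma consistent_prefix_prob:
  assumes "prob_space M" and [measurable]: "\<And>n. (\<lambda>z. f z n) \<in> M \<rightarrow>\<^sub>M count_space (UNIV :: bool set)"
  shows "consistent (\<lambda>t. measure M {z \<in> space M. pre (f z) (length t) = t})"
proof -
  interpret prob_space M by fact
  let ?E = "\<lambda>t. {z \<in> space M. pre (f z) (length t) = t}"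
  have meas: "?E t \<in> sets M" for t by (rule measurable_Collect_pre) simp
  have "measure M (?E t) = measure M (?E (True # t)) + measure M (?E (False # t))" for t
  proof -
    have "?E t = ?E (True # t) \<union> ?E (False # t)" "?E (True # t) \<inter> ?E (False # t) = {}" by auto
    with finite_measure_Union[OF meas meas, of "True # t" "False # t"] show ?thesis by simp
  qed
  moreover have "measure M (?E []) = 1" by (simp add: prob_space)
  ultimately show ?thesis unfolding consistent_def using measure_nonneg by blast
qed

text \<open>Prefix events of length \<open>m\<close> are exactly the cylinders on
  \<open>{..<m}\<close>, and these are cofinal; so prefix probabilities determine the law.\<close>

lemma distr_decode_eqI:
  assumes "prob_space R" and sR: "sets R = sets bits" and cons: "consistent p"
    and p: "\<And>t. emeasure R {x \<in> space R. pre x (length t) = t} = ennreal (p t)"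
  shows "distr unif01 bits (decode p) = R"
proof (rule measure_eqI_cylinders)
  interpret U: prob_space unif01 by (rule prob_space_unif01)
  have dec[measurable]: "decode p \<in> unif01 \<rightarrow>\<^sub>M bits"
    by (rule measurable_decode) auto
  show "finite_measure (distr unif01 bits (decode p))" by (intro U.finite_measure_distr dec)
  fix J :: "nat set" assume "finite J"
  then obtain m where m: "J \<subseteq> {..<m}" using finite_nat_iff_bounded by blast
  have "emeasure (distr unif01 bits (decode p)) {x \<in> space (distr unif01 bits (decode p)). \<forall>k\<in>{..<m}. x k = e k} =
      emeasure R {x \<in> space R. \<forall>k\<in>{..<m}. x k = e k}" for e
  proof -
    have eq: "(\<forall>k\<in>{..<m}. x k = e k) \<longleftrightarrow> pre x m = pre e m" for x by (auto simp: pre_eq_iff)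
    have "emeasure (distr unif01 bits (decode p)) {x \<in> space bits. pre x m = pre e m} =
       emeasure unif01 {u \<in> {0..1}. decode_string p u (length (pre e m)) = pre e m}"
      using measurable_Collect_pre[where f="\<lambda>x. x" and M=bits and n=m and t="pre e m"]
      by (subst emeasure_distr[OF dec])
        (auto intro!: arg_cong[where f="emeasure unif01"] simp: space_PiM)
    then show ?thesis
      using p[of "pre e m"] emeasure_decode_string[OF cons, of "pre e m"] by (simp add: eq)
  qed
  then show "\<exists>K. finite K \<and> J \<subseteq> K \<and> K \<subseteq> UNIV \<and> (\<forall>e. emeasure (distr unif01 bits (decode p)) {x \<in> space (distr unif01 bits (decode p)). \<forall>k\<in>K. x k = e k} =
      emeasure R {x \<in> space R. \<forall>k\<in>K. x k = e k})"
    using m by (intro exI[of _ "{..<m}"]) auto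
qed (use sR in auto)

lemma prob_measure_bits_eq_distr_unif01:
  assumes "prob_space R" and sR: "sets R = sets bits"
  obtains d where "d \<in> unif01 \<rightarrow>\<^sub>M bits" "distr unif01 bits d = R"
proof
  interpret prob_space R by fact
  let ?p = "\<lambda>t. measure R {x \<in> space R. pre x (length t) = t}"
  show "decode ?p \<in> unif01 \<rightarrow>\<^sub>M bits" by (rule measurable_decode) auto
  have [measurable_cong]: "sets R = sets bits" by fact
  have c: "consistent ?p" by (rule consistent_prefix_prob) (auto simp: prob_space_axioms)
  show "distr unif01 bits (decode ?p) = R"
    by (rule distr_decode_eqI[OF assms c]) (simp add: emeasure_eq_measure)
qed

text \<open>The prefix law is asserted only at parameters where \<open>p c\<close> is consistent,
  since a family of conditional probabilities has this property only almost surely. Measurability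
  holds without exceptions.\<close>

lemma kernel_bits_eq_distr_unif01:
  fixes p :: "'c \<Rightarrow> bool list \<Rightarrow> real"
  assumes p[measurable]: "\<And>t. (\<lambda>c. p c t) \<in> borel_measurable N"
  obtains d where "(\<lambda>(c, u). d c u) \<in> N \<Otimes>\<^sub>M unif01 \<rightarrow>\<^sub>M bits"
    "\<And>c t. consistent (p c) \<Longrightarrow> emeasure unif01 {u \<in> {0..1}. pre (d c u) (length t) = t} = ennreal (p c t)"
proof
  have "(\<lambda>x. decode (p (fst x)) (snd x)) \<in> N \<Otimes>\<^sub>M unif01 \<rightarrow>\<^sub>M bits"
    by (rule measurable_decode) measurable
  then show "(\<lambda>(c, u). decode (p c) u) \<in> N \<Otimes>\<^sub>M unif01 \<rightarrow>\<^sub>M bits" by (simp add: case_prod_beta)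
  fix c t assume "consistent (p c)"
  then show "emeasure unif01 {u \<in> {0..1}. pre (decode (p c) u) (length t) = t} = ennreal (p c t)"
    using emeasure_decode_string[of "p c" t] by simp
qed

section \<open>The projective limit\<close>

text \<open>A finite set and its injective image have equally large complements in their union, and
  any bijection between these complements completes \<open>f\<close>. As far as finitely many labels
  are concerned, an injection is thus a finite permutation.\<close>

lemma inj_on_extend_permutes:
  assumes "finite A" "inj_on f A"
  obtains \<pi> where "\<pi> permutes (A \<union> f ` A)" "\<And>x. x \<in> A \<Longrightarrow> \<pi> x = f x"
proof -
  let ?B = "A \<union> f ` A"
  have "card (?B - A) = card (?B - f ` A)"
    using assms by (subst (1 2) card_Diff_subset) (auto simp: card_image)
  then obtain g where g: "bij_betw g (?B - A) (?B - f ` A)"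
    using assms(1) by (metis finite_Diff finite_UnI finite_imageI finite_same_card_bij)
  let ?\<pi> = "\<lambda>x. if x \<in> A then f x else if x \<in> ?B then g x else x"
  have "bij_betw ?\<pi> A (f ` A)"
    using assms(2) by (subst bij_betw_cong[where g=f]) (auto simp: bij_betw_def)
  moreover have "bij_betw ?\<pi> (?B - A) (?B - f ` A)"
    using g by (subst bij_betw_cong[where g=g]) auto
  ultimately have "bij_betw ?\<pi> (A \<union> (?B - A)) (f ` A \<union> (?B - f ` A))"
    by (rule bij_betw_combine) auto
  then have "bij_betw ?\<pi> ?B ?B" by (simp add: Un_absorb1 Un_Diff_cancel Un_commute Un_assoc)
  then have "?\<pi> permutes ?B" by (rule bij_imp_permutes) auto
  then show thesis by (rule that) auto
qed

section \<open>Measurability and cylinder events in graph spaces\<close>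

lemma graph_space_component: "k \<in> L \<times> L \<Longrightarrow> (\<lambda>X. X k) \<in> graph_space L \<rightarrow>\<^sub>M count_space UNIV"
  unfolding graph_space_def by (rule measurable_component_singleton)

lemma measurable_graph_spaceI:
  assumes "\<And>k. k \<in> L \<times> L \<Longrightarrow> (\<lambda>x. f x k) \<in> M \<rightarrow>\<^sub>M count_space UNIV"
    and "\<And>x. x \<in> space M \<Longrightarrow> f x \<in> extensional (L \<times> L)"
  shows "f \<in> M \<rightarrow>\<^sub>M graph_space L"
  unfolding graph_space_def
  by (rule measurable_PiM_single') (use assms in \<open>auto simp: PiE_def\<close>)

lemma measurable_graph_measure:
  "sets M = sets (graph_space L) \<Longrightarrow> f \<in> graph_space L \<rightarrow>\<^sub>M N \<Longrightarrow> f \<in> M \<rightarrow>\<^sub>M N"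
  by (simp cong: measurable_cong_sets)

lemma space_graph_space: "space (graph_space L) = extensional (L \<times> L)"
  by (auto simp: graph_space_def space_PiM PiE_def)

lemma measurable_restrict_graph:
  "K \<subseteq> L \<Longrightarrow> (\<lambda>X. restrict X (K \<times> K)) \<in> graph_space L \<rightarrow>\<^sub>M graph_space K"
  by (rule measurable_graph_spaceI) (auto intro!: graph_space_component)

lemma measurable_relabel_graph:
  assumes "\<And>i. i \<in> K \<Longrightarrow> \<phi> i \<in> L"
  shows "(\<lambda>X. \<lambda>(i, j)\<in>K \<times> K. X (\<phi> i, \<phi> j)) \<in> graph_space L \<rightarrow>\<^sub>M graph_space K"
  by (rule measurable_graph_spaceI) (use assms in \<open>auto intro!: graph_space_component\<close>)

lemma sets_cylinder:
  assumes "finite K" "h ` K \<subseteq> L \<times> L"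
  shows "{X \<in> space (graph_space L). \<forall>k\<in>K. X (h k) = e k} \<in> sets (graph_space L)"
proof (rule sets.sets_Collect_finite_All[OF _ assms(1)])
  fix k assume "k \<in> K"
  then have "(\<lambda>X. X (h k)) -` {e k} \<inter> space (graph_space L) \<in> sets (graph_space L)"
    using assms(2) by (intro measurable_sets[OF graph_space_component]) auto
  then show "{X \<in> space (graph_space L). X (h k) = e k} \<in> sets (graph_space L)"
    by (simp add: vimage_def Int_def conj_commute)
qed

lemma random_graphD:
  assumes "random_graph L M"
  shows "prob_space M" "sets M = sets (graph_space L)" "space M = extensional (L \<times> L)"
    "AE X in M. \<forall>i\<in>L. \<forall>j\<in>L. X (i, j) = X (j, i)"
  using assms sets_eq_imp_space_eq[of M "graph_space L"] by (auto simp: random_graph_def space_graph_space)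

text \<open>Restriction does not touch the constrained entries, which lie in
  \<open>K \<times> K\<close>. The index map \<open>h\<close> admits constraints at relabelled
  entries, as along \<open>map_prod \<phi> \<phi>\<close>, or along an enumeration of pairs.\<close>

lemma emeasure_restrict_graph_cylinder:
  assumes M: "sets M = sets (graph_space L)" and "K \<subseteq> L" "finite J" "h ` J \<subseteq> K \<times> K"
  shows "emeasure (restrict_graph K M) {X \<in> space (restrict_graph K M). \<forall>k\<in>J. X (h k) = e k} =
    emeasure M {X \<in> space M. \<forall>k\<in>J. X (h k) = e k}"
proof -
  have r: "(\<lambda>X. restrict X (K \<times> K)) \<in> M \<rightarrow>\<^sub>M graph_space K"
    by (rule measurable_graph_measure[OF M measurable_restrict_graph]) fact
  have "emeasure (restrict_graph K M) {X \<in> space (restrict_graph K M). \<forall>k\<in>J. X (h k) = e k} =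
    emeasure M ((\<lambda>X. restrict X (K \<times> K)) -` {X \<in> space (graph_space K). \<forall>k\<in>J. X (h k) = e k} \<inter> space M)"
    unfolding restrict_graph_def space_distr by (rule emeasure_distr[OF r sets_cylinder]) fact+
  also have "(\<lambda>X. restrict X (K \<times> K)) -` {X \<in> space (graph_space K). \<forall>k\<in>J. X (h k) = e k} \<inter> space M =
      {X \<in> space M. \<forall>k\<in>J. X (h k) = e k}"
    using assms(4) by (fastforce simp: space_graph_space)
  finally show ?thesis .
qed

lemma projective_limit_cylinder:
  assumes "is_projective_limit G P" "1 \<le> n" "finite J" "h ` J \<subseteq> {1..n} \<times> {1..n}"
  shows "emeasure P {X \<in> space P. \<forall>k\<in>J. X (h k) = e k} =
    emeasure (G n) {X \<in> space (G n). \<forall>k\<in>J. X (h k) = e k}"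
proof -
  have "sets P = sets (graph_space {1..})" "restrict_graph {1..n} P = G n"
    using assms(1,2) random_graphD(2) by (auto simp: is_projective_limit_def)
  with emeasure_restrict_graph_cylinder[of P "{1..}" "{1..n}" J h e] assms(3,4)
  show ?thesis by auto
qed

lemma finite_subset_square:
  assumes J: "finite J" "J \<subseteq> {1..} \<times> {1..}"
  obtains n :: nat where "1 \<le> n" "J \<subseteq> {1..n} \<times> {1..n}"
proof -
  have "finite (fst ` J \<union> snd ` J)" using J by auto
  then obtain n where n: "fst ` J \<union> snd ` J \<subseteq> {..n}" using finite_nat_iff_bounded_le by blast
  have "J \<subseteq> {1..Suc n} \<times> {1..Suc n}"
  proof
    fix x assume x: "x \<in> J"
    then have "fst x \<in> {..n}" "snd x \<in> {..n}" "x \<in> {1..} \<times> {1..}" using n J(2) by blast+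
    then show "x \<in> {1..Suc n} \<times> {1..Suc n}" by (cases x) auto
  qed
  then show thesis by (intro that[of "Suc n"]) simp
qed

lemma graph_measure_eqI:
  assumes P: "sets P = sets (graph_space {1..})" "finite_measure P"
    and Q: "sets Q = sets (graph_space {1..})"
    and eq: "\<And>n e. 1 \<le> n \<Longrightarrow> emeasure P {X \<in> space P. \<forall>k\<in>{1..n} \<times> {1..n}. X k = e k} =
      emeasure Q {X \<in> space Q. \<forall>k\<in>{1..n} \<times> {1..n}. X k = e k}"
  shows "P = Q"
proof (rule measure_eqI_cylinders[OF P(1)[unfolded graph_space_def] Q[unfolded graph_space_def] P(2)])
  fix J :: "(nat \<times> nat) set" assume J: "finite J" "J \<subseteq> {1..} \<times> {1..}"
  then obtain n where n: "1 \<le> n" "J \<subseteq> {1..n} \<times> {1..n}" by (rule finite_subset_square)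
  with eq[of n] show "\<exists>K. finite K \<and> J \<subseteq> K \<and> K \<subseteq> {1..} \<times> {1..} \<and>
    (\<forall>e. emeasure P {x \<in> space P. \<forall>k\<in>K. x k = e k} = emeasure Q {x \<in> space Q. \<forall>k\<in>K. x k = e k})"
    by (intro exI[of _ "{1..n} \<times> {1..n}"]) auto
qed

section \<open>Uniqueness and invariance of the projective limit\<close>

lemma projective_limit_unique:
  assumes "is_projective_limit G P" "is_projective_limit G Q"
  shows "P = Q"
proof (rule graph_measure_eqI)
  show "sets P = sets (graph_space {1..})" "sets Q = sets (graph_space {1..})" "finite_measure P"
    using assms random_graphD[of "{1..}"] by (auto simp: is_projective_limit_def prob_space.finite_measure)
  fix n :: nat and e :: "nat \<times> nat \<Rightarrow> bool" assume "1 \<le> n"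
  then show "emeasure P {X \<in> space P. \<forall>k\<in>{1..n} \<times> {1..n}. X k = e k} =
      emeasure Q {X \<in> space Q. \<forall>k\<in>{1..n} \<times> {1..n}. X k = e k}"
    using projective_limit_cylinder[OF assms(1), of n "{1..n} \<times> {1..n}" "\<lambda>k. k" e]
      projective_limit_cylinder[OF assms(2), of n "{1..n} \<times> {1..n}" "\<lambda>k. k" e] by simp
qed

text \<open>A cylinder on \<open>{1..n}\<close> sees only the values of \<open>\<phi>\<close> on
  \<open>{1..n}\<close>. These extend to a permutation of some larger \<open>{1..m}\<close>, under
  which \<open>G m\<close> is invariant.\<close>

lemma projective_limit_injection_invariant:
  assumes G: "projective_sequence G" and inv: "\<And>n. n \<ge> 1 \<Longrightarrow> permutation_invariant {1..n} (G n)"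
    and P: "is_projective_limit G P"
    and \<phi>: "inj_on \<phi> {1..}" "\<And>i. 1 \<le> i \<Longrightarrow> 1 \<le> \<phi> i"
  shows "distr P (graph_space {1..}) (\<lambda>X. \<lambda>(i, j)\<in>{1..} \<times> {1..}. X (\<phi> i, \<phi> j)) = P" (is "distr P _ ?r = P")
proof (rule graph_measure_eqI)
  have sP: "sets P = sets (graph_space {1..})" and pP: "prob_space P"
    using P random_graphD[of "{1..}"] by (auto simp: is_projective_limit_def)
  interpret P: prob_space P by fact
  have r: "?r \<in> P \<rightarrow>\<^sub>M graph_space {1..}"
    using \<phi>(2) by (intro measurable_graph_measure[OF sP measurable_relabel_graph]) auto
  show "finite_measure (distr P (graph_space {1..}) ?r)" by (rule P.finite_measure_distr[OF r])
  fix n :: nat and e :: "nat \<times> nat \<Rightarrow> bool" assume n: "1 \<le> n"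
  let ?K = "{1..n} \<times> {1..n}"
  have "inj_on \<phi> {1..n}" by (rule inj_on_subset[OF \<phi>(1)]) auto
  from inj_on_extend_permutes[OF finite_atLeastAtMost this] obtain \<pi>
    where \<pi>: "\<pi> permutes ({1..n} \<union> \<phi> ` {1..n})" "\<And>i. i \<in> {1..n} \<Longrightarrow> \<pi> i = \<phi> i"
    by blast
  \<comment> \<open>\<open>m\<close> bounds the labels of the cylinder and their images, so that
    \<open>\<pi>\<close> permutes \<open>{1..m}\<close>.\<close>
  obtain m where m: "{1..n} \<union> \<phi> ` {1..n} \<subseteq> {..m}"
    using finite_nat_iff_bounded_le[of "{1..n} \<union> \<phi> ` {1..n}"] by auto
  have m': "{1..n} \<union> \<phi> ` {1..n} \<subseteq> {1..m}" using m \<phi>(2) by fastforce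
  then have nm: "n \<le> m" using n by auto
  have \<pi>m: "\<pi> permutes {1..m}" by (rule permutes_subset[OF \<pi>(1) m'])
  have sG: "sets (G m) = sets (graph_space {1..m})"
    using G n nm random_graphD(2) by (auto simp: projective_sequence_def)
  have rel: "relabel_graph {1..m} \<pi> (G m) = G m"
    using inv[of m] \<pi>m n nm by (auto simp: permutation_invariant_def)
  have r': "(\<lambda>X. \<lambda>(i, j)\<in>{1..m} \<times> {1..m}. X (\<pi> i, \<pi> j)) \<in> G m \<rightarrow>\<^sub>M graph_space {1..m}"
    using permutes_in_image[OF \<pi>m] by (intro measurable_graph_measure[OF sG measurable_relabel_graph]) blast
  have spG: "space (G m) = extensional ({1..m} \<times> {1..m})" and spP: "space P = extensional ({1..} \<times> {1..})"
    using sets_eq_imp_space_eq[OF sG] sets_eq_imp_space_eq[OF sP] by (auto simp: space_graph_space)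
  have "emeasure (distr P (graph_space {1..}) ?r) {X \<in> space (distr P (graph_space {1..}) ?r). \<forall>k\<in>?K. X k = e k} =
      emeasure P (?r -` {X \<in> space (graph_space {1..}). \<forall>k\<in>?K. X k = e k} \<inter> space P)"
    unfolding space_distr
    by (rule emeasure_distr[OF r sets_cylinder[where h="\<lambda>k. k"]]) auto
  also have "?r -` {X \<in> space (graph_space {1..}). \<forall>k\<in>?K. X k = e k} \<inter> space P =
      {X \<in> space P. \<forall>k\<in>?K. X (map_prod \<phi> \<phi> k) = e k}"
    by (auto simp: space_graph_space)
  also have "emeasure P \<dots> = emeasure (G m) {X \<in> space (G m). \<forall>k\<in>?K. X (map_prod \<phi> \<phi> k) = e k}"
    using m' n nm by (intro projective_limit_cylinder[OF P]) auto
  also have "{X \<in> space (G m). \<forall>k\<in>?K. X (map_prod \<phi> \<phi> k) = e k} =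
      (\<lambda>X. \<lambda>(i, j)\<in>{1..m} \<times> {1..m}. X (\<pi> i, \<pi> j)) -` {X \<in> space (graph_space {1..m}). \<forall>k\<in>?K. X k = e k} \<inter> space (G m)"
    using \<pi>(2) nm by (auto simp: space_graph_space spG)
  also have "emeasure (G m) \<dots> = emeasure (relabel_graph {1..m} \<pi> (G m)) {X \<in> space (graph_space {1..m}). \<forall>k\<in>?K. X k = e k}"
    unfolding relabel_graph_def
    by (rule emeasure_distr[OF r' sets_cylinder[where h="\<lambda>k. k"], symmetric]) (use nm in auto)
  also have "\<dots> = emeasure (G m) {X \<in> space (G m). \<forall>k\<in>?K. X k = e k}"
    unfolding rel using spG by (simp add: space_graph_space)
  also have "\<dots> = emeasure P {X \<in> space P. \<forall>k\<in>?K. X k = e k}"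
    by (rule projective_limit_cylinder[OF P, where h="\<lambda>k. k", symmetric]) (use n nm in auto)
  finally show "emeasure (distr P (graph_space {1..}) ?r) {X \<in> space (distr P (graph_space {1..}) ?r). \<forall>k\<in>?K. X k = e k} =
      emeasure P {X \<in> space P. \<forall>k\<in>?K. X k = e k}" .
qed (use P random_graphD(2)[of "{1..}"] in \<open>auto simp: is_projective_limit_def\<close>)

section \<open>Existence of the projective limit\<close>

lemma nth_pre: "k < n \<Longrightarrow> pre x n ! (n - Suc k) = x k"
proof (induction n)
  case (Suc n)
  then show ?case by (cases "k = n") (auto simp: nth_Cons' Suc_diff_Suc)
qed simp

lemma projective_limit_exists:
  assumes G: "projective_sequence G"
  shows "\<exists>P. is_projective_limit G P"
proof -
  have rG: "random_graph {1..n} (G n)" if "1 \<le> n" for n using G that by (auto simp: projective_sequence_def)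
  note spG = random_graphD(3)[OF rG] and sG = random_graphD(2)[OF rG]
  \<comment> \<open>\<open>lab\<close> enumerates the pairs of positive labels. The first
    \<open>m\<close> of them stay in \<open>{1..m} \<times> {1..m}\<close> because a pairing code is
    at least as large as its components.\<close>
  define lab :: "nat \<Rightarrow> nat \<times> nat" where "lab k = map_prod Suc Suc (prod_decode k)" for k
  have lab_le: "lab k \<in> {1..m} \<times> {1..m}" if "k < m" for k m
  proof -
    obtain a b where ab: "prod_decode k = (a, b)" by (cases "prod_decode k")
    then have "k = prod_encode (a, b)" by (metis prod_decode_inverse)
    then have "a \<le> k" "b \<le> k" using le_prod_encode_1 le_prod_encode_2 by auto
    with that ab show ?thesis by (auto simp: lab_def)
  qed
  \<comment> \<open>Beyond \<open>m\<close> the bits are padded with \<open>False\<close>, because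
    \<open>lab k\<close> may then leave the square on which \<open>G m\<close> lives.\<close>
  define f where "f m X k = (k < m \<and> X (lab k))" for m and X :: "nat \<times> nat \<Rightarrow> bool" and k
  have f_meas: "(\<lambda>X. f m X k) \<in> G m \<rightarrow>\<^sub>M count_space UNIV" if m: "1 \<le> m" for m k
  proof (cases "k < m")
    case True
    then have "(\<lambda>X. f m X k) = (\<lambda>X. X (lab k))" by (simp add: f_def)
    then show ?thesis
      using measurable_graph_measure[OF sG[OF m] graph_space_component[OF lab_le[OF True]]] by simp
  qed (simp add: f_def)
  \<comment> \<open>\<open>Suc\<close> keeps the index positive for the empty string, since
    \<open>G 0\<close> is arbitrary. By \<open>p_eq\<close> other sufficiently large graphs give the
    same value, so all strings in a consistency equation can be compared within one measure.\<close>
  define p where "p t = measure (G (Suc (length t))) {X \<in> space (G (Suc (length t))). pre (f (Suc (length t)) X) (length t) = t}" for t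
  have p_eq: "p t = measure (G m) {X \<in> space (G m). pre (f m X) (length t) = t}" if "length t \<le> m" "1 \<le> m" for t m
  proof -
    obtain x where x: "pre x (length t) = t" using pre_exhaust by blast
    have ev: "{X \<in> space (G n). pre (f n X) (length t) = t} = {X \<in> space (G n). \<forall>k\<in>{..<length t}. X (lab k) = x k}"
      if "length t \<le> n" for n
    proof -
      have "pre (f n X) (length t) = t \<longleftrightarrow> (\<forall>k\<in>{..<length t}. X (lab k) = x k)" for X
        using pre_eq_iff[of "f n X" "length t" x] that unfolding x by (auto simp: f_def)
      then show ?thesis by simp
    qed
    have *: "emeasure (G n) {X \<in> space (G n). \<forall>k\<in>{..<length t}. X (lab k) = x k} =
       emeasure (G n') {X \<in> space (G n'). \<forall>k\<in>{..<length t}. X (lab k) = x k}"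
      if "length t \<le> n" "1 \<le> n" "n \<le> n'" for n n'
    proof -
      have "restrict_graph {1..n} (G n') = G n" using G that by (auto simp: projective_sequence_def)
      moreover have "lab ` {..<length t} \<subseteq> {1..n} \<times> {1..n}" using that lab_le[of _ n] by (intro image_subsetI) auto
      ultimately show ?thesis
        using emeasure_restrict_graph_cylinder[OF sG, of n' "{1..n}" "{..<length t}" lab x] that by auto
    qed
    have "emeasure (G (Suc (length t))) {X \<in> space (G (Suc (length t))). \<forall>k\<in>{..<length t}. X (lab k) = x k} =
      emeasure (G m) {X \<in> space (G m). \<forall>k\<in>{..<length t}. X (lab k) = x k}"
    proof (cases "m \<le> Suc (length t)")
      case True
      show ?thesis by (rule *[symmetric]) (use that True in auto)
    next
      case False
      show ?thesis by (rule *) (use that False in auto)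
    qed
    then show ?thesis
      unfolding p_def measure_def ev[OF that(1)] ev[OF le_SucI[OF le_refl]] by (rule arg_cong[where f=enn2real])
  qed
  have cons: "consistent p"
  proof -
    have *: "p [] = 1 \<and> 0 \<le> p t \<and> p t = p (True # t) + p (False # t)" for t
    proof -
      let ?m = "Suc (length t)"
      have c: "consistent (\<lambda>t. measure (G ?m) {X \<in> space (G ?m). pre (f ?m X) (length t) = t})"
        by (rule consistent_prefix_prob[OF random_graphD(1)[OF rG]]) (use f_meas in auto)
      show ?thesis
        using consistentD(1)[OF c] consistentD(2,3)[OF c, of t] p_eq[of "[]" ?m] p_eq[of t ?m] p_eq[of "True # t" ?m] p_eq[of "False # t" ?m]
        by simp
    qed
    then show ?thesis unfolding consistent_def by blast
  qed
  define d where "d = decode p"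
  have d[measurable]: "d \<in> unif01 \<rightarrow>\<^sub>M bits" unfolding d_def by (rule measurable_decode) auto
  \<comment> \<open>The inverse of the enumeration \<open>lab\<close>, including its shift of the
    labels by one.\<close>
  define r where "r u = (\<lambda>(i, j)\<in>{1..} \<times> {1..}. d u (prod_encode (i - 1, j - 1)))" for u
  have r: "r \<in> unif01 \<rightarrow>\<^sub>M graph_space {1..}"
    unfolding r_def by (rule measurable_graph_spaceI) auto
  interpret U: prob_space unif01 by (rule prob_space_unif01)
  define P where "P = distr unif01 (graph_space {1..}) r"
  interpret P: prob_space P unfolding P_def by (rule U.prob_space_distr[OF r])
  have sP: "sets P = sets (graph_space {1..})" by (simp add: P_def)
  have restr: "restrict_graph {1..n} P = G n" if n: "1 \<le> n" for n
  proof -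
    have "finite (prod_encode ` ({..n} \<times> {..n}))" by simp
    then obtain m0 where m0: "prod_encode ` ({..n} \<times> {..n}) \<subseteq> {..<m0}" using finite_nat_iff_bounded by blast
    \<comment> \<open>The first \<open>m\<close> bits cover all pairs of labels in
      \<open>{1..n}\<close>, and n \<le> m lets \<open>G m\<close> project to
      \<open>G n\<close>.\<close>
    define m where "m = max m0 n"
    have m: "prod_encode (i, j) < m" if "i \<le> n" "j \<le> n" for i j
      using m0 that by (force simp: m_def)
    have nm: "n \<le> m" "1 \<le> m" using n by (auto simp: m_def)
    \<comment> \<open>Reads the graph on \<open>{1..n}\<close> off a prefix of length
      \<open>m\<close>. The newest bit comes first, so bit \<open>k\<close> is at position
      \<open>m - Suc k\<close>.\<close>
    define \<Phi> :: "bool list \<Rightarrow> nat \<times> nat \<Rightarrow> bool"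
      where "\<Phi> s = (\<lambda>(i, j)\<in>{1..n} \<times> {1..n}. s ! (m - Suc (prod_encode (i - 1, j - 1))))" for s
    have \<Phi>: "\<Phi> \<in> count_space UNIV \<rightarrow>\<^sub>M graph_space {1..n}" by (auto simp: \<Phi>_def space_graph_space)
    have \<Phi>_pre: "\<Phi> (pre x m) = (\<lambda>(i, j)\<in>{1..n} \<times> {1..n}. x (prod_encode (i - 1, j - 1)))" for x
      using m by (auto simp: \<Phi>_def fun_eq_iff restrict_def intro!: nth_pre)
    have pre_d: "(\<lambda>u. pre (d u) m) \<in> unif01 \<rightarrow>\<^sub>M count_space UNIV" by (rule measurable_pre) measurable
    have pre_f: "(\<lambda>X. pre (f m X) m) \<in> G m \<rightarrow>\<^sub>M count_space UNIV"
      by (rule measurable_pre) (rule f_meas[OF nm(2)])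
    have law: "distr unif01 (count_space UNIV) (\<lambda>u. pre (d u) m) = distr (G m) (count_space UNIV) (\<lambda>X. pre (f m X) m)"
    proof (rule measure_eqI_countable[where A=UNIV])
      fix t :: "bool list"
      have "emeasure unif01 {u \<in> {0..1}. pre (d u) m = t} = emeasure (G m) {X \<in> space (G m). pre (f m X) m = t}"
      proof (cases "length t = m")
        case True
        interpret Gm: prob_space "G m" by (rule random_graphD(1)[OF rG[OF nm(2)]])
        show ?thesis
          using emeasure_decode_string[OF cons, of t] p_eq[of t m] True nm
          by (simp add: d_def Gm.emeasure_eq_measure)
      next
        case False
        then have "pre x m \<noteq> t" for x :: "nat \<Rightarrow> bool" by auto
        then show ?thesis by simp
      qed
      then show "emeasure (distr unif01 (count_space UNIV) (\<lambda>u. pre (d u) m)) {t} =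
        emeasure (distr (G m) (count_space UNIV) (\<lambda>X. pre (f m X) m)) {t}"
        by (simp add: emeasure_distr[OF pre_d] emeasure_distr[OF pre_f] vimage_def Int_def conj_commute)
    qed auto
    have "restrict_graph {1..n} P = distr unif01 (graph_space {1..n}) (\<lambda>u. restrict (r u) ({1..n} \<times> {1..n}))"
      unfolding restrict_graph_def P_def
      by (subst distr_distr[OF measurable_restrict_graph r]) (auto simp: comp_def)
    also have "(\<lambda>u. restrict (r u) ({1..n} \<times> {1..n})) = \<Phi> \<circ> (\<lambda>u. pre (d u) m)"
      by (auto simp: r_def fun_eq_iff \<Phi>_pre restrict_def)
    also have "distr unif01 (graph_space {1..n}) \<dots> = distr (distr (G m) (count_space UNIV) (\<lambda>X. pre (f m X) m)) (graph_space {1..n}) \<Phi>"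
      unfolding law[symmetric] by (rule distr_distr[OF \<Phi> pre_d, symmetric])
    also have "\<dots> = distr (G m) (graph_space {1..n}) (\<Phi> \<circ> (\<lambda>X. pre (f m X) m))"
      by (rule distr_distr[OF \<Phi> pre_f])
    also have "\<Phi> \<circ> (\<lambda>X. pre (f m X) m) = (\<lambda>X. restrict X ({1..n} \<times> {1..n}))"
      using m by (auto simp: \<Phi>_pre fun_eq_iff restrict_def f_def lab_def)
    also have "distr (G m) (graph_space {1..n}) \<dots> = G n"
      using G n nm unfolding projective_sequence_def restrict_graph_def by blast
    finally show ?thesis .
  qed
  \<comment> \<open>Symmetry at one pair is already an event of the finite graph on
    \<open>{1..max i j}\<close>; the countably many pairs are combined afterwards.\<close>
  have "AE X in P. X (i, j) = X (j, i)" if ij: "1 \<le> i" "1 \<le> j" for i j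
  proof -
    let ?n = "max i j"
    have n: "1 \<le> ?n" using ij by simp
    from random_graphD(4)[OF rG[OF n]] have "AE X in G ?n. X (i, j) = X (j, i)"
      by (rule AE_mp) (use ij in auto)
    then have "AE X in distr P (graph_space {1..?n}) (\<lambda>X. restrict X ({1..?n} \<times> {1..?n})). X (i, j) = X (j, i)"
      unfolding restr[OF n, unfolded restrict_graph_def] .
    moreover have "(\<lambda>X. restrict X ({1..?n} \<times> {1..?n})) \<in> P \<rightarrow>\<^sub>M graph_space {1..?n}"
      by (intro measurable_graph_measure[OF sP measurable_restrict_graph]) auto
    ultimately have "AE X in P. restrict X ({1..?n} \<times> {1..?n}) (i, j) = restrict X ({1..?n} \<times> {1..?n}) (j, i)"
      by (rule AE_distrD[rotated])
    then show ?thesis by (rule AE_mp) (use ij in auto)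
  qed
  then have "AE X in P. \<forall>i\<in>{1..}. \<forall>j\<in>{1..}. X (i, j) = X (j, i)"
    by (subst AE_ball_countable, simp, intro ballI, subst AE_ball_countable) auto
  then have "is_projective_limit G P"
    using restr sP P.prob_space_axioms by (auto simp: is_projective_limit_def random_graph_def)
  then show ?thesis by blast
qed

section \<open>Conditional independence in exchangeable arrays\<close>

abbreviation arr :: "(nat \<times> nat \<Rightarrow> bool) measure" where
  "arr \<equiv> PiM UNIV (\<lambda>_. count_space UNIV)"

text \<open>Pullback of an array along a map of labels, hence a right action: \<open>act_act\<close>
  reverses the order. Labels start at 0 here. Maps that are not injective also occur, as measurable
  readouts; the law is invariant under injective ones.\<close>

definition act :: "(nat \<Rightarrow> nat) \<Rightarrow> (nat \<times> nat \<Rightarrow> bool) \<Rightarrow> nat \<times> nat \<Rightarrow> bool" where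
  "act \<sigma> z = (\<lambda>(i, j). z (\<sigma> i, \<sigma> j))"

lemma act_apply [simp]: "act \<sigma> z (i, j) = z (\<sigma> i, \<sigma> j)"
  by (simp add: act_def)

lemma act_act: "act \<rho> (act \<sigma> z) = act (\<sigma> \<circ> \<rho>) z"
  by (auto simp: act_def fun_eq_iff)

lemma act_cong: "(\<And>i j. z (\<sigma> i, \<sigma> j) = z' (\<tau> i, \<tau> j)) \<Longrightarrow> act \<sigma> z = act \<tau> z'"
  by (auto simp: act_def fun_eq_iff)

lemma measurable_PiM_countI:
  "(\<And>k. (\<lambda>x. f x k) \<in> M \<rightarrow>\<^sub>M count_space UNIV) \<Longrightarrow> f \<in> M \<rightarrow>\<^sub>M PiM UNIV (\<lambda>_. count_space UNIV)"
  by (rule measurable_PiM_single') auto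

lemma measurable_act [measurable]: "act \<sigma> \<in> arr \<rightarrow>\<^sub>M arr"
  by (rule measurable_PiM_countI) (simp add: act_def case_prod_beta)

locale exchangeable_array = prob_space Q for Q :: "(nat \<times> nat \<Rightarrow> bool) measure" +
  assumes sets_Q [measurable_cong]: "sets Q = sets arr"
    and inv: "inj \<sigma> \<Longrightarrow> distr Q arr (act \<sigma>) = Q"
    and sym: "AE z in Q. \<forall>i j. z (i, j) = z (j, i)"
begin

lemma space_Q [simp]: "space Q = UNIV"
  using sets_eq_imp_space_eq[OF sets_Q] by (simp add: space_PiM)

lemma nn_integral_act:
  assumes "inj \<sigma>" and [measurable]: "g \<in> borel_measurable arr"
  shows "(\<integral>\<^sup>+z. g (act \<sigma> z) \<partial>Q) = (\<integral>\<^sup>+z. g z \<partial>Q)"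
proof -
  have "(\<integral>\<^sup>+z. g z \<partial>distr Q arr (act \<sigma>)) = (\<integral>\<^sup>+z. g (act \<sigma> z) \<partial>Q)"
    by (rule nn_integral_distr) measurable
  then show ?thesis by (simp add: inv[OF assms(1)])
qed

text \<open>
  The \<open>L\<^sup>2\<close> argument: relabelling by \<open>\<rho>\<close> preserves the joint law of \<open>E\<close> and \<open>T\<close>, but may discard
  information from \<open>T\<close>; hence the discarded part is irrelevant for the conditional probability.
\<close>

lemma cond_prob_relabel:
  fixes h :: "(nat \<times> nat \<Rightarrow> bool) \<Rightarrow> real"
  assumes [measurable]: "E \<in> sets arr" "T \<in> arr \<rightarrow>\<^sub>M arr" "h \<in> borel_measurable arr"
    and h01: "\<And>z. 0 \<le> h z \<and> h z \<le> 1"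
    and h: "\<And>\<phi>. \<phi> \<in> borel_measurable arr \<Longrightarrow>
      (\<integral>\<^sup>+z. indicator E z * \<phi> (T z) \<partial>Q) = (\<integral>\<^sup>+z. ennreal (h (T z)) * \<phi> (T z) \<partial>Q)"
    and stable: "\<And>\<rho>. inj \<rho> \<Longrightarrow> (\<And>n. n < k \<Longrightarrow> \<rho> n = n) \<Longrightarrow>
      (\<exists>r \<in> arr \<rightarrow>\<^sub>M arr. \<forall>z. T (act \<rho> z) = r (T z)) \<and> (\<forall>z. act \<rho> z \<in> E \<longleftrightarrow> z \<in> E)"
    and [measurable]: "G \<in> borel_measurable arr"
    and \<sigma>: "inj \<sigma>" and \<pi>: "bij \<pi>" "\<And>n. n < k \<Longrightarrow> \<pi> n = \<sigma> n"
  shows "(\<integral>\<^sup>+z. indicator E (act \<sigma> z) * G (T (act \<pi> z)) \<partial>Q) =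
    (\<integral>\<^sup>+z. ennreal (h (T (act \<sigma> z))) * G (T (act \<pi> z)) \<partial>Q)"
proof -
  \<comment> \<open>\<open>\<pi>\<close> is a bijection with the same first \<open>k\<close> values
    as \<open>\<sigma>\<close>; so \<open>\<rho>\<close> fixes the labels below \<open>k\<close>,
    and \<open>\<sigma>\<close> is \<open>\<pi> \<circ> \<rho>\<close>. After the change of
    variables by \<open>\<pi>\<close>, \<open>T z\<close> is the full conditioning information,
    while \<open>T (act \<rho> z)\<close> keeps only what is visible along
    \<open>\<sigma>\<close>.\<close>
  define \<rho> where "\<rho> = inv_into UNIV \<pi> \<circ> \<sigma>"
  have \<rho>: "inj \<rho>" "\<And>n. n < k \<Longrightarrow> \<rho> n = n"
    using \<sigma> \<pi> by (auto simp: \<rho>_def bij_imp_bij_inv bij_is_inj inj_compose inv_f_f simp flip: \<pi>(2))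
  have \<pi>\<rho>: "\<pi> \<circ> \<rho> = \<sigma>" using \<pi>(1) by (auto simp: \<rho>_def fun_eq_iff bij_is_surj surj_f_inv_f)
  obtain r where r[measurable]: "r \<in> arr \<rightarrow>\<^sub>M arr" and Tr: "\<And>z. T (act \<rho> z) = r (T z)"
    and E: "\<And>z. act \<rho> z \<in> E \<longleftrightarrow> z \<in> E"
    using stable[OF \<rho>] by blast
  have ind: "indicator E (act \<rho> z) = (indicator E z :: ennreal)" for z
    using E by (simp add: indicator_def)
  \<comment> \<open>Since \<open>act \<rho>\<close> preserves both the law and \<open>E\<close>, the
    same \<open>h\<close> computes the conditional probability of \<open>E\<close> given
    \<open>T z\<close> and given the coarser \<open>T (act \<rho> z)\<close>.\<close>
  have eq: "AE z in Q. h (T (act \<rho> z)) = h (T z)"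
  proof (rule cond_prob_L2[where N=arr and g=r and E=E])
    show "prob_space Q" by (rule prob_space_axioms)
    show "distr Q arr (\<lambda>z. T (act \<rho> z)) = distr Q arr T"
    proof -
      have "distr (distr Q arr (act \<rho>)) arr T = distr Q arr (T \<circ> act \<rho>)"
        by (rule distr_distr) measurable
      then show ?thesis by (simp add: inv[OF \<rho>(1)] comp_def)
    qed
    fix \<phi> :: "_ \<Rightarrow> ennreal" assume [measurable]: "\<phi> \<in> borel_measurable arr"
    have "(\<integral>\<^sup>+z. indicator E z * \<phi> (T (act \<rho> z)) \<partial>Q) = (\<integral>\<^sup>+z. indicator E (act \<rho> z) * \<phi> (T (act \<rho> z)) \<partial>Q)"
      by (simp add: ind)
    also have "\<dots> = (\<integral>\<^sup>+z. indicator E z * \<phi> (T z) \<partial>Q)"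
      by (rule nn_integral_act[OF \<rho>(1), where g="\<lambda>z. indicator E z * \<phi> (T z)"]) measurable
    also have "\<dots> = (\<integral>\<^sup>+z. ennreal (h (T z)) * \<phi> (T z) \<partial>Q)" by (rule h) fact
    also have "\<dots> = (\<integral>\<^sup>+z. ennreal (h (T (act \<rho> z))) * \<phi> (T (act \<rho> z)) \<partial>Q)"
      by (rule nn_integral_act[OF \<rho>(1), where g="\<lambda>z. ennreal (h (T z)) * \<phi> (T z)", symmetric]) measurable
    finally show "(\<integral>\<^sup>+z. indicator E z * \<phi> (T (act \<rho> z)) \<partial>Q) = (\<integral>\<^sup>+z. ennreal (h (T (act \<rho> z))) * \<phi> (T (act \<rho> z)) \<partial>Q)" .
  qed (use h01 h Tr in auto)
  have \<pi>i: "inj \<pi>" using \<pi>(1) by (rule bij_is_inj)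
  have "(\<integral>\<^sup>+z. indicator E (act \<sigma> z) * G (T (act \<pi> z)) \<partial>Q) =
      (\<integral>\<^sup>+z. indicator E (act \<rho> (act \<pi> z)) * G (T (act \<pi> z)) \<partial>Q)"
    by (simp add: act_act \<pi>\<rho>)
  also have "\<dots> = (\<integral>\<^sup>+z. indicator E (act \<rho> z) * G (T z) \<partial>Q)"
    by (rule nn_integral_act[OF \<pi>i, where g="\<lambda>z. indicator E (act \<rho> z) * G (T z)"]) measurable
  also have "\<dots> = (\<integral>\<^sup>+z. ennreal (h (T z)) * G (T z) \<partial>Q)" unfolding ind by (rule h) fact
  also have "\<dots> = (\<integral>\<^sup>+z. ennreal (h (T (act \<rho> z))) * G (T z) \<partial>Q)"
    by (rule nn_integral_cong_AE, rule AE_mp[OF eq]) auto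
  also have "\<dots> = (\<integral>\<^sup>+z. ennreal (h (T (act \<rho> (act \<pi> z)))) * G (T (act \<pi> z)) \<partial>Q)"
    by (rule nn_integral_act[OF \<pi>i, where g="\<lambda>z. ennreal (h (T (act \<rho> z))) * G (T z)", symmetric]) measurable
  also have "\<dots> = (\<integral>\<^sup>+z. ennreal (h (T (act \<sigma> z))) * G (T (act \<pi> z)) \<partial>Q)"
    by (simp add: act_act \<pi>\<rho>)
  finally show ?thesis .
qed

end

section \<open>Conditional probabilities of single edges and of stars\<close>

lemma inj_extend_bij:
  fixes \<sigma> :: "nat \<Rightarrow> nat"
  assumes "inj \<sigma>"
  obtains \<pi> where "bij \<pi>" "\<And>n. n < k \<Longrightarrow> \<pi> n = \<sigma> n"
proof -
  have "inj_on \<sigma> {..<k}" using assms by (rule inj_on_subset) simp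
  from inj_on_extend_permutes[OF finite_lessThan this] obtain \<pi>
    where "\<pi> permutes ({..<k} \<union> \<sigma> ` {..<k})" "\<And>n. n \<in> {..<k} \<Longrightarrow> \<pi> n = \<sigma> n" by blast
  then show thesis by (intro that[of \<pi>]) (auto intro: permutes_bij)
qed

text \<open>Everything known about an array apart from the edge between 0 and 1. The erased entries
  become \<open>False\<close> instead of disappearing, so that conditioning data are again
  arrays.\<close>

definition cut :: "(nat \<times> nat \<Rightarrow> bool) \<Rightarrow> nat \<times> nat \<Rightarrow> bool" where
  "cut z = (\<lambda>k. k \<noteq> (0, 1) \<and> k \<noteq> (1, 0) \<and> z k)"

lemma measurable_cut [measurable]: "cut \<in> arr \<rightarrow>\<^sub>M arr"
  unfolding cut_def by (rule measurable_PiM_countI) measurable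

definition swap01 :: "nat \<Rightarrow> nat" where
  "swap01 n = (if n = 0 then 1 else if n = 1 then 0 else n)"

lemma swap01_simps [simp]: "swap01 0 = 1" "swap01 (Suc 0) = 0" "swap01 (Suc (Suc n)) = Suc (Suc n)"
  by (auto simp: swap01_def)

lemma swap01_invol: "swap01 \<circ> swap01 = id"
  by (auto simp: swap01_def fun_eq_iff)

lemma swap01_swap01 [simp]: "swap01 (swap01 n) = n"
  by (auto simp: swap01_def)

lemma inj_swap01: "inj swap01"
  by (rule injI) (metis swap01_swap01)

lemma cut_act_swap01: "cut (act swap01 z) = act swap01 (cut z)"
  by (auto simp: cut_def act_def fun_eq_iff swap01_def)

lemma ennreal_average:
  assumes "0 \<le> a" "0 \<le> b"
  shows "ennreal ((a + b) / 2) = ennreal (1/2) * ennreal a + ennreal (1/2) * ennreal b"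
proof -
  have "ennreal ((a + b) / 2) = ennreal (1/2 * a + 1/2 * b)" by (simp add: add_divide_distrib)
  also have "\<dots> = ennreal (1/2 * a) + ennreal (1/2 * b)" using assms by (intro ennreal_plus) auto
  also have "\<dots> = ennreal (1/2) * ennreal a + ennreal (1/2) * ennreal b"
    using assms by (intro arg_cong2[where f="(+)"] ennreal_mult) auto
  finally show ?thesis .
qed

context exchangeable_array
begin

text \<open>\<open>h\<close> is the conditional probability of the edge between 0 and 1 given all
  other entries. For a \<open>\<sigma>\<close> that omits labels the equation is a locality
  statement: given all entries but those of the edge between \<open>\<sigma> 0\<close> and
  \<open>\<sigma> 1\<close>, its probability depends only on the subarray along
  \<open>\<sigma>\<close>.\<close>

lemma edge_kernel_nonsym:
  obtains h :: "(nat \<times> nat \<Rightarrow> bool) \<Rightarrow> real" where "h \<in> borel_measurable arr" "\<And>z. 0 \<le> h z \<and> h z \<le> 1"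
    "\<And>\<sigma> g. inj \<sigma> \<Longrightarrow> g \<in> borel_measurable arr \<Longrightarrow>
      (\<And>z z'. (\<And>k. k \<noteq> (\<sigma> 0, \<sigma> 1) \<Longrightarrow> k \<noteq> (\<sigma> 1, \<sigma> 0) \<Longrightarrow> z k = z' k) \<Longrightarrow> g z = g z') \<Longrightarrow>
      (\<integral>\<^sup>+z. of_bool (z (\<sigma> 0, \<sigma> 1)) * g z \<partial>Q) = (\<integral>\<^sup>+z. ennreal (h (cut (act \<sigma> z))) * g z \<partial>Q)"
proof -
  define E where "E = {z :: nat \<times> nat \<Rightarrow> bool. z (0, 1)}"
  have "{z \<in> space arr. z (0, 1)} \<in> sets arr" by measurable
  then have E[measurable]: "E \<in> sets arr" by (simp add: E_def space_PiM)
  obtain h :: "(nat \<times> nat \<Rightarrow> bool) \<Rightarrow> real" where h[measurable]: "h \<in> borel_measurable arr" and h01: "\<And>z. 0 \<le> h z \<and> h z \<le> 1"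
    and hE: "\<And>g. g \<in> borel_measurable arr \<Longrightarrow>
      (\<integral>\<^sup>+z. indicator E z * g (cut z) \<partial>Q) = (\<integral>\<^sup>+z. ennreal (h (cut z)) * g (cut z) \<partial>Q)"
    by (rule cond_prob_exists[OF prob_space_axioms, of cut arr E]) (auto simp: sets_Q)
  show thesis
  proof (rule that[OF h h01])
    fix \<sigma> :: "nat \<Rightarrow> nat" and g :: "_ \<Rightarrow> ennreal"
    assume \<sigma>: "inj \<sigma>" and g[measurable]: "g \<in> borel_measurable arr"
      and indep: "\<And>z z'. (\<And>k. k \<noteq> (\<sigma> 0, \<sigma> 1) \<Longrightarrow> k \<noteq> (\<sigma> 1, \<sigma> 0) \<Longrightarrow> z k = z' k) \<Longrightarrow> g z = g z'"
    obtain \<pi> where \<pi>: "bij \<pi>" "\<And>n. n < 2 \<Longrightarrow> \<pi> n = \<sigma> n" using inj_extend_bij[OF \<sigma>, of 2] by blast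
    define \<tau> where "\<tau> = inv_into UNIV \<pi>"
    have \<pi>\<tau>: "\<pi> (\<tau> l) = l" for l using \<pi>(1) by (simp add: \<tau>_def bij_is_surj surj_f_inv_f)
    have \<pi>01: "\<pi> 0 = \<sigma> 0" "\<pi> (Suc 0) = \<sigma> (Suc 0)" using \<pi>(2)[of 0] \<pi>(2)[of 1] by simp_all
    \<comment> \<open>The inverse \<open>\<tau>\<close> puts every entry back in place. Only the two
      erased entries are lost, and \<open>g\<close> ignores them.\<close>
    have g_eq: "g (act \<tau> (cut (act \<pi> z))) = g z" for z
    proof (rule indep)
      fix k :: "nat \<times> nat" assume k: "k \<noteq> (\<sigma> 0, \<sigma> 1)" "k \<noteq> (\<sigma> 1, \<sigma> 0)"
      obtain i j where ij: "k = (i, j)" by (cases k)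
      have "(\<tau> i, \<tau> j) \<noteq> (0, 1)" "(\<tau> i, \<tau> j) \<noteq> (1, 0)"
        using k \<pi>\<tau>[of i] \<pi>\<tau>[of j] \<pi>01 unfolding ij One_nat_def by (metis prod.inject)+
      then show "act \<tau> (cut (act \<pi> z)) k = z k" using \<pi>\<tau> ij by (auto simp: cut_def)
    qed
    have stable: "(\<exists>r \<in> arr \<rightarrow>\<^sub>M arr. \<forall>z. cut (act \<rho> z) = r (cut z)) \<and> (\<forall>z. act \<rho> z \<in> E \<longleftrightarrow> z \<in> E)"
      if \<rho>: "inj \<rho>" "\<And>n. n < 2 \<Longrightarrow> \<rho> n = n" for \<rho>
    proof
      have \<rho>01: "\<rho> 0 = 0" "\<rho> (Suc 0) = Suc 0" using \<rho>(2) by auto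
      have "\<rho> i = 0 \<longleftrightarrow> i = 0" "\<rho> i = Suc 0 \<longleftrightarrow> i = Suc 0" for i
        using injD[OF \<rho>(1), of i] \<rho>01 by metis+
      then have "cut (act \<rho> z) = act \<rho> (cut z)" for z
        by (auto simp: cut_def fun_eq_iff act_def)
      then show "\<exists>r \<in> arr \<rightarrow>\<^sub>M arr. \<forall>z. cut (act \<rho> z) = r (cut z)"
        by (intro bexI[of _ "act \<rho>"]) auto
      show "\<forall>z. act \<rho> z \<in> E \<longleftrightarrow> z \<in> E" using \<rho>01 by (auto simp: E_def)
    qed
    have "(\<integral>\<^sup>+z. indicator E (act \<sigma> z) * g (act \<tau> (cut (act \<pi> z))) \<partial>Q) =
        (\<integral>\<^sup>+z. ennreal (h (cut (act \<sigma> z))) * g (act \<tau> (cut (act \<pi> z))) \<partial>Q)"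
      by (rule cond_prob_relabel[where G="\<lambda>w. g (act \<tau> w)" and k=2 and h=h, OF E measurable_cut h h01 hE stable
          measurable_compose[OF measurable_act g] \<sigma> \<pi>])
    then show "(\<integral>\<^sup>+z. of_bool (z (\<sigma> 0, \<sigma> 1)) * g z \<partial>Q) = (\<integral>\<^sup>+z. ennreal (h (cut (act \<sigma> z))) * g z \<partial>Q)"
      unfolding g_eq by (simp add: E_def indicator_def of_bool_def)
  qed
qed

text \<open>A graphon has to be symmetric at every point. As the array is almost surely symmetric,
  interchanging the end vertices in the kernel gives another solution of the same equation, and the
  average of the two is a solution with exact symmetry.\<close>

lemma edge_kernel:
  obtains h :: "(nat \<times> nat \<Rightarrow> bool) \<Rightarrow> real" where "h \<in> borel_measurable arr" "\<And>z. 0 \<le> h z \<and> h z \<le> 1"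
    "\<And>z. h (act swap01 z) = h z"
    "\<And>\<sigma> g. inj \<sigma> \<Longrightarrow> g \<in> borel_measurable arr \<Longrightarrow>
      (\<And>z z'. (\<And>k. k \<noteq> (\<sigma> 0, \<sigma> 1) \<Longrightarrow> k \<noteq> (\<sigma> 1, \<sigma> 0) \<Longrightarrow> z k = z' k) \<Longrightarrow> g z = g z') \<Longrightarrow>
      (\<integral>\<^sup>+z. of_bool (z (\<sigma> 0, \<sigma> 1)) * g z \<partial>Q) = (\<integral>\<^sup>+z. ennreal (h (cut (act \<sigma> z))) * g z \<partial>Q)"
proof -
  obtain h :: "(nat \<times> nat \<Rightarrow> bool) \<Rightarrow> real" where h[measurable]: "h \<in> borel_measurable arr" and h01: "\<And>z. 0 \<le> h z \<and> h z \<le> 1"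
    and hE: "\<And>\<sigma> g. inj \<sigma> \<Longrightarrow> g \<in> borel_measurable arr \<Longrightarrow>
      (\<And>z z'. (\<And>k. k \<noteq> (\<sigma> 0, \<sigma> 1) \<Longrightarrow> k \<noteq> (\<sigma> 1, \<sigma> 0) \<Longrightarrow> z k = z' k) \<Longrightarrow> g z = g z') \<Longrightarrow>
      (\<integral>\<^sup>+z. of_bool (z (\<sigma> 0, \<sigma> 1)) * g z \<partial>Q) = (\<integral>\<^sup>+z. ennreal (h (cut (act \<sigma> z))) * g z \<partial>Q)"
    using edge_kernel_nonsym by blast
  define h' where "h' z = (h z + h (act swap01 z)) / 2" for z
  show thesis
  proof (rule that[of h'])
    show "h' \<in> borel_measurable arr" unfolding h'_def by measurable
    show "0 \<le> h' z \<and> h' z \<le> 1" for z using h01[of z] h01[of "act swap01 z"] by (auto simp: h'_def)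
    show "h' (act swap01 z) = h' z" for z by (simp add: h'_def act_act swap01_invol act_def)
    fix \<sigma> :: "nat \<Rightarrow> nat" and g :: "_ \<Rightarrow> ennreal"
    assume \<sigma>: "inj \<sigma>" and g[measurable]: "g \<in> borel_measurable arr"
      and indep: "\<And>z z'. (\<And>k. k \<noteq> (\<sigma> 0, \<sigma> 1) \<Longrightarrow> k \<noteq> (\<sigma> 1, \<sigma> 0) \<Longrightarrow> z k = z' k) \<Longrightarrow> g z = g z'"
    let ?I = "\<integral>\<^sup>+z. of_bool (z (\<sigma> 0, \<sigma> 1)) * g z \<partial>Q"
    have 1: "?I = (\<integral>\<^sup>+z. ennreal (h (cut (act \<sigma> z))) * g z \<partial>Q)"
      by (rule hE[OF \<sigma> g indep])
    have "?I = (\<integral>\<^sup>+z. of_bool (z (\<sigma> 1, \<sigma> 0)) * g z \<partial>Q)"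
      by (rule nn_integral_cong_AE, rule AE_mp[OF sym]) auto
    also have "\<dots> = (\<integral>\<^sup>+z. ennreal (h (cut (act (\<sigma> \<circ> swap01) z))) * g z \<partial>Q)"
    proof -
      have "(\<integral>\<^sup>+z. of_bool (z ((\<sigma> \<circ> swap01) 0, (\<sigma> \<circ> swap01) 1)) * g z \<partial>Q) =
          (\<integral>\<^sup>+z. ennreal (h (cut (act (\<sigma> \<circ> swap01) z))) * g z \<partial>Q)"
        by (rule hE[OF inj_compose[OF \<sigma> inj_swap01] g indep]) auto
      then show ?thesis by simp
    qed
    also have "\<dots> = (\<integral>\<^sup>+z. ennreal (h (act swap01 (cut (act \<sigma> z)))) * g z \<partial>Q)"
      by (simp add: act_act[symmetric] cut_act_swap01)
    finally have 2: "?I = \<dots>" .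
    have "(\<integral>\<^sup>+z. ennreal (h' (cut (act \<sigma> z))) * g z \<partial>Q) =
      (\<integral>\<^sup>+z. ennreal (1/2) * (ennreal (h (cut (act \<sigma> z))) * g z) + ennreal (1/2) * (ennreal (h (act swap01 (cut (act \<sigma> z)))) * g z) \<partial>Q)"
      unfolding h'_def using h01 by (subst ennreal_average) (simp_all only: distrib_right mult.assoc)
    also have "\<dots> = ennreal (1/2) * ?I + ennreal (1/2) * ?I"
      using 1 2 by (subst nn_integral_add) (simp_all add: nn_integral_cmult)
    also have "\<dots> = (ennreal (1/2) + ennreal (1/2)) * ?I" by (simp only: distrib_right)
    also have "ennreal (1/2) + ennreal (1/2) = 1" by (subst ennreal_plus[symmetric]) auto
    finally have "(\<integral>\<^sup>+z. ennreal (h' (cut (act \<sigma> z))) * g z \<partial>Q) = 1 * ?I" .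
    then show "?I = (\<integral>\<^sup>+z. ennreal (h' (cut (act \<sigma> z))) * g z \<partial>Q)" by simp
  qed
qed

text \<open>\<open>h z t\<close> is the conditional probability that row 0 begins with
  \<open>t\<close> when \<open>z\<close> is the subarray on the positive labels. If
  \<open>\<sigma>\<close> runs through one vertex and then the past, \<open>g\<close> may still
  involve all other vertices: the star is conditionally independent, given the past, of whatever
  does not touch its centre.\<close>

lemma vertex_kernel:
  obtains h :: "(nat \<times> nat \<Rightarrow> bool) \<Rightarrow> bool list \<Rightarrow> real"
  where "\<And>t. (\<lambda>z. h z t) \<in> borel_measurable arr"
    "AE z in Q. consistent (h z)"
    "\<And>\<sigma> g t. inj \<sigma> \<Longrightarrow> g \<in> borel_measurable arr \<Longrightarrow>
      (\<And>z z'. (\<And>i j. i \<noteq> \<sigma> 0 \<Longrightarrow> j \<noteq> \<sigma> 0 \<Longrightarrow> z (i, j) = z' (i, j)) \<Longrightarrow> g z = g z') \<Longrightarrow>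
      (\<integral>\<^sup>+z. of_bool (pre (\<lambda>n. z (\<sigma> 0, \<sigma> n)) (length t) = t) * g z \<partial>Q) =
      (\<integral>\<^sup>+z. ennreal (h (act (\<sigma> \<circ> Suc) z) t) * g z \<partial>Q)"
proof -
  define E where "E t = {z :: nat \<times> nat \<Rightarrow> bool. pre (\<lambda>n. z (0, n)) (length t) = t}" for t
  have E[measurable]: "E t \<in> sets arr" for t
    using measurable_Collect_pre[where f="\<lambda>z n. z (0, n)" and M=arr and n="length t" and t=t]
    by (simp add: E_def space_PiM)
  define kern where "kern t h \<longleftrightarrow> h \<in> borel_measurable arr \<and> (\<forall>z. 0 \<le> h z \<and> h z \<le> 1) \<and>
     (\<forall>g\<in>borel_measurable arr. (\<integral>\<^sup>+z. indicator (E t) z * g (act Suc z) \<partial>Q) = (\<integral>\<^sup>+z. ennreal (h (act Suc z)) * g (act Suc z) \<partial>Q))"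
    for t and h :: "(nat \<times> nat \<Rightarrow> bool) \<Rightarrow> real"
  have "\<exists>h. kern t h" for t
    unfolding kern_def
    by (rule cond_prob_exists[OF prob_space_axioms, of "act Suc" arr "E t"]) (auto simp: sets_Q)
  then have someI: "kern t (SOME h. kern t h)" for t by (rule someI_ex)
  \<comment> \<open>The kernels of different strings are chosen separately, so additivity over the
    newest bit has to be recovered string by string, up to null sets.\<close>
  define h where "h t = (SOME h. kern t h)" for t
  have "kern t (h t)" for t unfolding h_def by (rule someI)
  then have h[measurable]: "\<And>t. h t \<in> borel_measurable arr"
    and h01: "\<And>t z. 0 \<le> h t z \<and> h t z \<le> 1"
    and hE: "\<And>t g. g \<in> borel_measurable arr \<Longrightarrow>
      (\<integral>\<^sup>+z. indicator (E t) z * g (act Suc z) \<partial>Q) = (\<integral>\<^sup>+z. ennreal (h t (act Suc z)) * g (act Suc z) \<partial>Q)"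
    by (simp_all add: kern_def)
  \<comment> \<open>\<open>act Suc z\<close> has the law \<open>Q\<close>, so the kernel can be
    integrated against \<open>Q\<close> itself.\<close>
  have hE': "(\<integral>\<^sup>+z. ennreal (h t z) * g z \<partial>Q) = (\<integral>\<^sup>+z. indicator (E t) z * g (act Suc z) \<partial>Q)"
    if [measurable]: "g \<in> borel_measurable arr" for t g
    unfolding hE[OF that] by (rule nn_integral_act[where g="\<lambda>z. ennreal (h t z) * g z", symmetric]) auto
  have AE_eqI: "AE z in Q. u z = v z" if [measurable]: "u \<in> borel_measurable Q" "v \<in> borel_measurable Q"
    and eq: "\<And>A. A \<in> sets arr \<Longrightarrow> (\<integral>\<^sup>+z. u z * indicator A z \<partial>Q) = (\<integral>\<^sup>+z. v z * indicator A z \<partial>Q)" for u v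
  proof -
    have "density Q u = density Q v"
      by (rule measure_eqI) (auto simp: emeasure_density eq sets_Q)
    then show ?thesis by (subst (asm) density_unique_iff) auto
  qed
  have add: "AE z in Q. h t z = h (True # t) z + h (False # t) z" for t
  proof -
    have "AE z in Q. ennreal (h t z) = ennreal (h (True # t) z) + ennreal (h (False # t) z)"
    proof (rule AE_eqI)
      fix A assume [measurable]: "A \<in> sets arr"
      have "(\<integral>\<^sup>+z. ennreal (h t z) * indicator A z \<partial>Q) = (\<integral>\<^sup>+z. indicator (E t) z * indicator A (act Suc z) \<partial>Q)"
        by (rule hE') measurable
      also have "\<dots> = (\<integral>\<^sup>+z. indicator (E (True # t)) z * indicator A (act Suc z) + indicator (E (False # t)) z * indicator A (act Suc z) \<partial>Q)"
        by (intro nn_integral_cong) (auto simp: E_def split: split_indicator)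
      also have "\<dots> = (\<integral>\<^sup>+z. indicator (E (True # t)) z * indicator A (act Suc z) \<partial>Q) + (\<integral>\<^sup>+z. indicator (E (False # t)) z * indicator A (act Suc z) \<partial>Q)"
        by (rule nn_integral_add) measurable
      also have "\<dots> = (\<integral>\<^sup>+z. ennreal (h (True # t) z) * indicator A z \<partial>Q) + (\<integral>\<^sup>+z. ennreal (h (False # t) z) * indicator A z \<partial>Q)"
        by (intro arg_cong2[where f="(+)"] hE'[symmetric]) measurable
      also have "\<dots> = (\<integral>\<^sup>+z. (ennreal (h (True # t) z) + ennreal (h (False # t) z)) * indicator A z \<partial>Q)"
        by (subst nn_integral_add[symmetric]) (auto simp: distrib_right)
      finally show "(\<integral>\<^sup>+z. ennreal (h t z) * indicator A z \<partial>Q) = (\<integral>\<^sup>+z. (ennreal (h (True # t) z) + ennreal (h (False # t) z)) * indicator A z \<partial>Q)" .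
    qed measurable
    then show ?thesis using h01 by (simp flip: ennreal_plus)
  qed
  have nil: "AE z in Q. h [] z = 1"
  proof -
    have "AE z in Q. ennreal (h [] z) = 1"
    proof (rule AE_eqI)
      fix A assume [measurable]: "A \<in> sets arr"
      have "(\<integral>\<^sup>+z. ennreal (h [] z) * indicator A z \<partial>Q) = (\<integral>\<^sup>+z. indicator (E []) z * indicator A (act Suc z) \<partial>Q)"
        by (rule hE') measurable
      also have "\<dots> = (\<integral>\<^sup>+z. indicator A (act Suc z) \<partial>Q)" by (simp add: E_def)
      also have "\<dots> = (\<integral>\<^sup>+z. indicator A z \<partial>Q)" by (rule nn_integral_act) auto
      finally show "(\<integral>\<^sup>+z. ennreal (h [] z) * indicator A z \<partial>Q) = (\<integral>\<^sup>+z. 1 * indicator A z \<partial>Q)" by simp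
    qed measurable
    then show ?thesis by simp
  qed
  show thesis
  proof (rule that[of "\<lambda>z t. h t z"])
    show "(\<lambda>z. h t z) \<in> borel_measurable arr" for t using h by auto
    have "AE z in Q. \<forall>t. h t z = h (True # t) z + h (False # t) z"
      using add by (subst AE_all_countable) blast
    with nil show "AE z in Q. consistent (\<lambda>t. h t z)"
    proof eventually_elim
      case (elim z)
      then show ?case using h01 unfolding consistent_def by blast
    qed
    fix \<sigma> :: "nat \<Rightarrow> nat" and g :: "_ \<Rightarrow> ennreal" and t :: "bool list"
    assume \<sigma>: "inj \<sigma>" and g[measurable]: "g \<in> borel_measurable arr"
      and indep: "\<And>z z'. (\<And>i j. i \<noteq> \<sigma> 0 \<Longrightarrow> j \<noteq> \<sigma> 0 \<Longrightarrow> z (i, j) = z' (i, j)) \<Longrightarrow> g z = g z'"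
    \<comment> \<open>The prefix involves the labels below \<open>length t\<close>;
      \<open>Suc\<close> ensures that label 0, the centre of the star, is fixed even for the empty
      string.\<close>
    let ?k = "Suc (length t)"
    obtain \<pi> where \<pi>: "bij \<pi>" "\<And>n. n < ?k \<Longrightarrow> \<pi> n = \<sigma> n" using inj_extend_bij[OF \<sigma>, of ?k] by blast
    define \<tau> where "\<tau> = inv_into UNIV \<pi>"
    have \<pi>\<tau>: "\<pi> (\<tau> l) = l" for l using \<pi>(1) by (simp add: \<tau>_def bij_is_surj surj_f_inv_f)
    have \<pi>0: "\<pi> 0 = \<sigma> 0" using \<pi>(2) by simp
    \<comment> \<open>\<open>act Suc\<close> drops label 0 and lowers the others by one, which
      \<open>\<tau> l - 1\<close> compensates. Truncated subtraction misreads only entries at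
      \<open>\<sigma> 0\<close>, to which \<open>g\<close> is insensitive.\<close>
    have g_eq: "g (act (\<lambda>l. \<tau> l - 1) (act Suc (act \<pi> z))) = g z" for z
    proof (rule indep)
      fix i j assume "i \<noteq> \<sigma> 0" "j \<noteq> \<sigma> 0"
      then have "\<tau> i \<noteq> 0" "\<tau> j \<noteq> 0" using \<pi>\<tau>[of i] \<pi>\<tau>[of j] \<pi>0 by metis+
      then show "act (\<lambda>l. \<tau> l - 1) (act Suc (act \<pi> z)) (i, j) = z (i, j)" by (simp add: \<pi>\<tau>)
    qed
    have stable: "(\<exists>r \<in> arr \<rightarrow>\<^sub>M arr. \<forall>z. act Suc (act \<rho> z) = r (act Suc z)) \<and> (\<forall>z. act \<rho> z \<in> E t \<longleftrightarrow> z \<in> E t)"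
      if \<rho>: "inj \<rho>" "\<And>n. n < ?k \<Longrightarrow> \<rho> n = n" for \<rho>
    proof
      have "\<rho> (Suc n) \<noteq> 0" for n using injD[OF \<rho>(1), of "Suc n" 0] \<rho>(2)[of 0] by auto
      then have "act Suc (act \<rho> z) = act (\<lambda>n. \<rho> (Suc n) - 1) (act Suc z)" for z
        unfolding act_act by (intro act_cong) simp
      then show "\<exists>r \<in> arr \<rightarrow>\<^sub>M arr. \<forall>z. act Suc (act \<rho> z) = r (act Suc z)"
        by (intro bexI[of _ "act (\<lambda>n. \<rho> (Suc n) - 1)"]) auto
      have "pre (\<lambda>n. act \<rho> z (0, n)) (length t) = pre (\<lambda>n. z (0, n)) (length t)" for z
        using \<rho>(2) by (simp add: pre_eq_iff)
      then show "\<forall>z. act \<rho> z \<in> E t \<longleftrightarrow> z \<in> E t" by (simp add: E_def)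
    qed
    have "(\<integral>\<^sup>+z. indicator (E t) (act \<sigma> z) * g (act (\<lambda>l. \<tau> l - 1) (act Suc (act \<pi> z))) \<partial>Q) =
        (\<integral>\<^sup>+z. ennreal (h t (act Suc (act \<sigma> z))) * g (act (\<lambda>l. \<tau> l - 1) (act Suc (act \<pi> z))) \<partial>Q)"
      by (rule cond_prob_relabel[where G="\<lambda>w. g (act (\<lambda>l. \<tau> l - 1) w)" and k="?k" and h="h t",
            OF E measurable_act h h01 hE stable measurable_compose[OF measurable_act g] \<sigma> \<pi>])
    then show "(\<integral>\<^sup>+z. of_bool (pre (\<lambda>n. z (\<sigma> 0, \<sigma> n)) (length t) = t) * g z \<partial>Q) =
      (\<integral>\<^sup>+z. ennreal (h t (act (\<sigma> \<circ> Suc) z)) * g z \<partial>Q)"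
      unfolding g_eq by (simp add: E_def indicator_def of_bool_def act_act)
  qed
qed

end

section \<open>Past, stars and edges\<close>

definition past :: "nat \<Rightarrow> nat" where
  "past n = 2 * n + 1"

text \<open>\<open>vertex_map i\<close> and \<open>edge_map i j\<close> are the injections at which
  the kernels are evaluated: the distinguished vertices take the first labels and the past fills the
  rest, so that all other future vertices are out of sight.\<close>

definition vertex_map :: "nat \<Rightarrow> nat \<Rightarrow> nat" where
  "vertex_map i = case_nat (2 * i) past"

definition edge_map :: "nat \<Rightarrow> nat \<Rightarrow> nat \<Rightarrow> nat" where
  "edge_map i j = case_nat (2 * i) (case_nat (2 * j) past)"

text \<open>Bit 0 is the loop and bit \<open>Suc n\<close> the edge to the past vertex
  \<open>past n\<close>; the star is thus row 0 of the array seen through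
  \<open>vertex_map i\<close>.\<close>

definition star :: "nat \<Rightarrow> (nat \<times> nat \<Rightarrow> bool) \<Rightarrow> nat \<Rightarrow> bool" where
  "star i z n = z (2 * i, vertex_map i n)"

lemma past_neq [simp]: "past n \<noteq> 2 * i" "2 * i \<noteq> past n"
  unfolding past_def by presburger+

lemma past_eq_iff [simp]: "past m = past n \<longleftrightarrow> m = n"
  by (simp add: past_def)

lemma inj_past: "inj past"
  by (simp add: inj_def)

lemma inj_vertex_map: "inj (vertex_map i)"
  by (auto simp: inj_def vertex_map_def split: nat.splits)

lemma inj_edge_map: "i \<noteq> j \<Longrightarrow> inj (edge_map i j)"
  by (auto simp: inj_def edge_map_def split: nat.splits)

lemma vertex_map_simps [simp]:
  "vertex_map i 0 = 2 * i" "vertex_map i (Suc n) = past n" "vertex_map i \<circ> Suc = past"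
  by (auto simp: vertex_map_def fun_eq_iff)

lemma edge_map_simps [simp]:
  "edge_map i j 0 = 2 * i" "edge_map i j (Suc 0) = 2 * j" "edge_map i j (Suc (Suc n)) = past n"
  by (auto simp: edge_map_def)

lemma measurable_star [measurable]: "star i \<in> arr \<rightarrow>\<^sub>M bits"
  by (rule measurable_PiM_countI) (simp add: star_def)

text \<open>The array seen by an edge, reassembled from the past \<open>c\<close> and the stars \<open>y\<close>, \<open>y'\<close> of its ends.\<close>

definition join :: "(nat \<times> nat \<Rightarrow> bool) \<Rightarrow> (nat \<Rightarrow> bool) \<Rightarrow> (nat \<Rightarrow> bool) \<Rightarrow> nat \<times> nat \<Rightarrow> bool" where
  "join c y y' = (\<lambda>(m, n).
     if 2 \<le> m \<and> 2 \<le> n then c (m - 2, n - 2)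
     else if m < 2 \<and> n < 2 then m = n \<and> (if m = 0 then y 0 else y' 0)
     else if min m n = 0 then y (max m n - 1) else y' (max m n - 1))"

lemma nat_two_cases:
  obtains "n = 0" | "n = Suc 0" | k where "n = Suc (Suc k)"
  using that by (cases n rule: nat.exhaust; cases "n - 1" rule: nat.exhaust) auto

text \<open>With the edge itself erased, what remains visible is the past and the two stars. A star
  stores each edge to the past in one orientation only, which is where symmetry enters; the erased
  entries are \<open>False\<close> on both sides.\<close>

lemma cut_act_edge_map:
  assumes sym: "\<forall>i j. z (i, j) = z (j, i)"
  shows "cut (act (edge_map i j) z) = join (act past z) (star i z) (star j z)"
proof
  fix k :: "nat \<times> nat"
  obtain m n where k: "k = (m, n)" by (cases k)
  show "cut (act (edge_map i j) z) k = join (act past z) (star i z) (star j z) k"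
    unfolding k
    by (cases m rule: nat_two_cases; cases n rule: nat_two_cases)
      (simp_all add: cut_def join_def star_def sym[rule_format, of "past _" "2 * _"])
qed

lemma act_swap01_join: "act swap01 (join c y y') = join c y' y"
proof
  fix k :: "nat \<times> nat"
  obtain m n where k: "k = (m, n)" by (cases k)
  show "act swap01 (join c y y') k = join c y' y k"
    unfolding k
    by (cases m rule: nat_two_cases; cases n rule: nat_two_cases) (auto simp: join_def)
qed

lemma measurable_join:
  assumes c: "c \<in> M \<rightarrow>\<^sub>M arr" and y: "y \<in> M \<rightarrow>\<^sub>M bits" and y': "y' \<in> M \<rightarrow>\<^sub>M bits"
  shows "(\<lambda>x. join (c x) (y x) (y' x)) \<in> M \<rightarrow>\<^sub>M arr"
proof (rule measurable_PiM_countI)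
  fix k :: "nat \<times> nat"
  obtain m n where k: "k = (m, n)" by (cases k)
  have [measurable]: "(\<lambda>x. c x k) \<in> M \<rightarrow>\<^sub>M count_space UNIV" "(\<lambda>x. y x l) \<in> M \<rightarrow>\<^sub>M count_space UNIV"
    "(\<lambda>x. y' x l) \<in> M \<rightarrow>\<^sub>M count_space UNIV" for k l
    by (rule measurable_compose[OF _ measurable_component_singleton], fact, simp)+
  show "(\<lambda>x. join (c x) (y x) (y' x) k) \<in> M \<rightarrow>\<^sub>M count_space UNIV"
    unfolding k join_def by simp
qed

definition bernoulli_weight :: "bool \<Rightarrow> real \<Rightarrow> ennreal" where
  "bernoulli_weight b p = ennreal (if b then p else 1 - p)"

lemma measurable_bernoulli_weight [measurable (raw)]:
  assumes [measurable]: "f \<in> borel_measurable M"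
  shows "(\<lambda>x. bernoulli_weight b (f x)) \<in> borel_measurable M"
  unfolding bernoulli_weight_def by (cases b) simp_all

lemma bernoulli_weight_le_1: "0 \<le> p \<Longrightarrow> p \<le> 1 \<Longrightarrow> bernoulli_weight b p \<le> 1"
  by (simp add: bernoulli_weight_def)

lemma ennreal_add_right_cancelD: "a + c = b + c \<Longrightarrow> c \<noteq> \<top> \<Longrightarrow> a = (b :: ennreal)"
  using ennreal_add_left_cancel[of c a b] by (simp add: add.commute)

lemma prod_of_bool:
  "finite A \<Longrightarrow> (\<Prod>x\<in>A. of_bool (P x)) = (of_bool (\<forall>x\<in>A. P x) :: 'a :: comm_semiring_1)"
  by (induction A rule: finite_induct) auto

lemma ennreal_mult_le_1: "a \<le> 1 \<Longrightarrow> b \<le> 1 \<Longrightarrow> a * b \<le> (1 :: ennreal)"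
  using mult_mono[of a 1 b 1] by simp

lemma finite_edges: "finite {(i, j). 1 \<le> i \<and> i < j \<and> j \<le> (n :: nat)}"
  by (rule finite_subset[of _ "{..n} \<times> {..n}"]) auto

text \<open>\<open>v\<close> and \<open>w\<close> stand for kernels as provided by
  \<open>vertex_kernel\<close> and \<open>edge_kernel\<close>, fixed once so that all later
  formulas, including the graphon, refer to the same versions.\<close>

locale exchangeable_kernels = exchangeable_array Q for Q +
  fixes v :: "(nat \<times> nat \<Rightarrow> bool) \<Rightarrow> bool list \<Rightarrow> real" and w :: "(nat \<times> nat \<Rightarrow> bool) \<Rightarrow> real"
  assumes v_measurable [measurable]: "\<And>t. (\<lambda>z. v z t) \<in> borel_measurable arr"
    and v_consistent: "AE z in Q. consistent (v z)"
    and v_step: "\<And>\<sigma> g t. inj \<sigma> \<Longrightarrow> g \<in> borel_measurable arr \<Longrightarrow>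
      (\<And>z z'. (\<And>i j. i \<noteq> \<sigma> 0 \<Longrightarrow> j \<noteq> \<sigma> 0 \<Longrightarrow> z (i, j) = z' (i, j)) \<Longrightarrow> g z = g z') \<Longrightarrow>
      (\<integral>\<^sup>+z. of_bool (pre (\<lambda>n. z (\<sigma> 0, \<sigma> n)) (length t) = t) * g z \<partial>Q) =
      (\<integral>\<^sup>+z. ennreal (v (act (\<sigma> \<circ> Suc) z) t) * g z \<partial>Q)"
    and w_measurable [measurable]: "w \<in> borel_measurable arr"
    and w01: "\<And>z. 0 \<le> w z \<and> w z \<le> 1"
    and w_sym: "\<And>z. w (act swap01 z) = w z"
    and w_step: "\<And>\<sigma> g. inj \<sigma> \<Longrightarrow> g \<in> borel_measurable arr \<Longrightarrow>
      (\<And>z z'. (\<And>k. k \<noteq> (\<sigma> 0, \<sigma> 1) \<Longrightarrow> k \<noteq> (\<sigma> 1, \<sigma> 0) \<Longrightarrow> z k = z' k) \<Longrightarrow> g z = g z') \<Longrightarrow>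
      (\<integral>\<^sup>+z. of_bool (z (\<sigma> 0, \<sigma> 1)) * g z \<partial>Q) = (\<integral>\<^sup>+z. ennreal (w (cut (act \<sigma> z))) * g z \<partial>Q)"
begin

section \<open>Factorisation over stars and edges\<close>

lemma of_bool_pre_measurable [measurable]:
  "(\<lambda>z. of_bool (pre (star i z) n = t) :: ennreal) \<in> borel_measurable arr"
proof -
  have "(\<lambda>z. pre (star i z) n) \<in> arr \<rightarrow>\<^sub>M count_space UNIV"
    by (rule measurable_pre) (simp add: star_def)
  from measurable_compose[OF this, of "\<lambda>s. of_bool (s = t) :: ennreal" borel] show ?thesis by simp
qed

text \<open>The stars are integrated out one at a time. The past and the other stars avoid the
  centre of the chosen star, so \<open>v_step\<close> applies; the factor that it produces is a
  function of the past and is absorbed into \<open>D\<close>, which is why the induction lets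
  \<open>D\<close> vary.\<close>

lemma vertex_product:
  assumes "finite I" "D \<in> borel_measurable arr"
  shows "(\<integral>\<^sup>+z. D (act past z) * (\<Prod>i\<in>I. of_bool (pre (star i z) (length (t i)) = t i)) \<partial>Q) =
    (\<integral>\<^sup>+z. D z * (\<Prod>i\<in>I. ennreal (v z (t i))) \<partial>Q)"
  using assms
proof (induction I arbitrary: D rule: finite_induct)
  case empty
  then show ?case using nn_integral_act[OF inj_past, of D] by simp
next
  case (insert i I)
  note [measurable] = \<open>D \<in> borel_measurable arr\<close>
  let ?g = "\<lambda>z. D (act past z) * (\<Prod>i\<in>I. of_bool (pre (star i z) (length (t i)) = t i))"
  have star_eq: "(\<lambda>n. z (vertex_map i 0, vertex_map i n)) = star i z" for z
    by (simp add: star_def fun_eq_iff)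
  have "(\<integral>\<^sup>+z. D (act past z) * (\<Prod>i\<in>insert i I. of_bool (pre (star i z) (length (t i)) = t i)) \<partial>Q) =
      (\<integral>\<^sup>+z. of_bool (pre (\<lambda>n. z (vertex_map i 0, vertex_map i n)) (length (t i)) = t i) * ?g z \<partial>Q)"
    unfolding star_eq using insert.hyps by (simp add: mult_ac)
  also have "\<dots> = (\<integral>\<^sup>+z. ennreal (v (act (vertex_map i \<circ> Suc) z) (t i)) * ?g z \<partial>Q)"
  proof (rule v_step[OF inj_vertex_map])
    show "?g \<in> borel_measurable arr" by measurable
    fix z z' :: "nat \<times> nat \<Rightarrow> bool"
    assume eq: "\<And>k l. k \<noteq> vertex_map i 0 \<Longrightarrow> l \<noteq> vertex_map i 0 \<Longrightarrow> z (k, l) = z' (k, l)"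
    have "act past z = act past z'" by (rule act_cong) (rule eq; simp)
    moreover have "star l z = star l z'" if "l \<in> I" for l
    proof
      fix n
      have "l \<noteq> i" using that insert.hyps by auto
      then show "star l z n = star l z' n" unfolding star_def by (intro eq) (cases n; simp)+
    qed
    ultimately show "?g z = ?g z'" by simp
  qed
  also have "\<dots> = (\<integral>\<^sup>+z. (D (act past z) * ennreal (v (act past z) (t i))) *
      (\<Prod>i\<in>I. of_bool (pre (star i z) (length (t i)) = t i)) \<partial>Q)"
    by (simp add: mult_ac)
  also have "\<dots> = (\<integral>\<^sup>+z. (D z * ennreal (v z (t i))) * (\<Prod>i\<in>I. ennreal (v z (t i))) \<partial>Q)"
    by (rule insert.IH[of "\<lambda>z. D z * ennreal (v z (t i))"]) measurable
  also have "\<dots> = (\<integral>\<^sup>+z. D z * (\<Prod>i\<in>insert i I. ennreal (v z (t i))) \<partial>Q)"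
    using insert.hyps by (simp add: mult_ac)
  finally show ?case .
qed

text \<open>The case of a missing edge follows by subtraction from the integral of \<open>g\<close>.
  The bound on \<open>g\<close> keeps the integrals finite, as cancellation in
  \<open>ennreal\<close> requires.\<close>

lemma edge_step:
  assumes \<sigma>: "inj \<sigma>" and g[measurable]: "g \<in> borel_measurable arr" and le1: "\<And>z. g z \<le> 1"
    and indep: "\<And>z z'. (\<And>k. k \<noteq> (\<sigma> 0, \<sigma> 1) \<Longrightarrow> k \<noteq> (\<sigma> 1, \<sigma> 0) \<Longrightarrow> z k = z' k) \<Longrightarrow> g z = g z'"
  shows "(\<integral>\<^sup>+z. of_bool (z (\<sigma> 0, \<sigma> 1) = b) * g z \<partial>Q) =
    (\<integral>\<^sup>+z. bernoulli_weight b (w (cut (act \<sigma> z))) * g z \<partial>Q)"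
proof (cases b)
  case True
  then show ?thesis using w_step[OF \<sigma> g indep] by (simp add: bernoulli_weight_def)
next
  case False
  let ?I = "\<integral>\<^sup>+z. of_bool (z (\<sigma> 0, \<sigma> 1)) * g z \<partial>Q"
  have I: "?I = (\<integral>\<^sup>+z. ennreal (w (cut (act \<sigma> z))) * g z \<partial>Q)"
    by (rule w_step[OF \<sigma> g indep])
  have "?I \<le> (\<integral>\<^sup>+z. 1 \<partial>Q)" using le1 by (intro nn_integral_mono) (simp add: of_bool_def)
  then have fin: "?I \<noteq> \<top>" by (auto simp: emeasure_space_1 top_unique)
  have "(\<integral>\<^sup>+z. of_bool (\<not> z (\<sigma> 0, \<sigma> 1)) * g z \<partial>Q) + ?I =
      (\<integral>\<^sup>+z. of_bool (\<not> z (\<sigma> 0, \<sigma> 1)) * g z + of_bool (z (\<sigma> 0, \<sigma> 1)) * g z \<partial>Q)"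
    by (rule nn_integral_add[symmetric]) measurable
  also have "\<dots> = (\<integral>\<^sup>+z. g z \<partial>Q)" by (intro nn_integral_cong) (simp add: of_bool_def)
  also have "\<dots> = (\<integral>\<^sup>+z. ennreal (1 - w (cut (act \<sigma> z))) * g z + ennreal (w (cut (act \<sigma> z))) * g z \<partial>Q)"
    using w01 by (intro nn_integral_cong) (simp add: distrib_right[symmetric] flip: ennreal_plus)
  also have "\<dots> = (\<integral>\<^sup>+z. ennreal (1 - w (cut (act \<sigma> z))) * g z \<partial>Q) + ?I"
    unfolding I by (rule nn_integral_add) measurable
  finally have "(\<integral>\<^sup>+z. of_bool (\<not> z (\<sigma> 0, \<sigma> 1)) * g z \<partial>Q) = (\<integral>\<^sup>+z. ennreal (1 - w (cut (act \<sigma> z))) * g z \<partial>Q)"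
    using fin by (rule ennreal_add_right_cancelD)
  then show ?thesis using False by (simp add: bernoulli_weight_def)
qed

text \<open>Removing one edge leaves a weight that reads only loops and entries touching the past.
  It moves into \<open>g\<close>, whose last hypothesis says precisely that edges between distinct
  future vertices do not matter; so the induction stays within this class of functions.\<close>

lemma edge_product:
  assumes "finite S" "S \<subseteq> {(i, j). i < j}" "g \<in> borel_measurable arr" "\<And>z. g z \<le> 1"
    and "\<And>z z'. (\<And>k. k \<notin> {(2 * i, 2 * j) | i j. i \<noteq> j} \<Longrightarrow> z k = z' k) \<Longrightarrow> g z = g z'"
  shows "(\<integral>\<^sup>+z. g z * (\<Prod>(i, j)\<in>S. of_bool (z (2 * i, 2 * j) = e (i, j))) \<partial>Q) =
    (\<integral>\<^sup>+z. g z * (\<Prod>(i, j)\<in>S. bernoulli_weight (e (i, j)) (w (cut (act (edge_map i j) z)))) \<partial>Q)"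
  using assms
proof (induction S arbitrary: g rule: finite_induct)
  case empty
  show ?case by (simp only: prod.empty)
next
  case (insert p S)
  obtain i j where p: "p = (i, j)" by (cases p)
  note [measurable] = insert.prems(2)
  have ij: "i < j" and S: "S \<subseteq> {(i, j). i < j}" using insert.prems(1) p by auto
  let ?f = "\<lambda>z. g z * (\<Prod>(i, j)\<in>S. of_bool (z (2 * i, 2 * j) = e (i, j)))"
  let ?b = "\<lambda>z. bernoulli_weight (e (i, j)) (w (cut (act (edge_map i j) z)))"
  have "(\<integral>\<^sup>+z. g z * (\<Prod>(i, j)\<in>insert p S. of_bool (z (2 * i, 2 * j) = e (i, j))) \<partial>Q) =
      (\<integral>\<^sup>+z. of_bool (z (edge_map i j 0, edge_map i j 1) = e (i, j)) * ?f z \<partial>Q)"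
    using insert.hyps p by (simp add: mult_ac)
  also have "\<dots> = (\<integral>\<^sup>+z. ?b z * ?f z \<partial>Q)"
  proof (rule edge_step)
    show "inj (edge_map i j)" using ij by (intro inj_edge_map) simp
    show "?f \<in> borel_measurable arr" unfolding case_prod_beta by measurable
    show "?f z \<le> 1" for z
      by (intro ennreal_mult_le_1 insert.prems(3) prod_le_1) auto
    fix z z' :: "nat \<times> nat \<Rightarrow> bool"
    assume eq: "\<And>k. k \<noteq> (edge_map i j 0, edge_map i j 1) \<Longrightarrow> k \<noteq> (edge_map i j 1, edge_map i j 0) \<Longrightarrow> z k = z' k"
    have "g z = g z'"
    proof (rule insert.prems(4))
      fix k assume "k \<notin> {(2 * i, 2 * j) | i j :: nat. i \<noteq> j}"
      then show "z k = z' k" using ij by (intro eq) auto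
    qed
    moreover have "z (2 * a, 2 * b) = z' (2 * a, 2 * b)" if "(a, b) \<in> S" for a b
      using that S ij insert.hyps(2) p by (intro eq) auto
    ultimately show "?f z = ?f z'" by (auto intro!: arg_cong2[where f="(*)"] prod.cong)
  qed
  also have "\<dots> = (\<integral>\<^sup>+z. (?b z * g z) * (\<Prod>(i, j)\<in>S. of_bool (z (2 * i, 2 * j) = e (i, j))) \<partial>Q)"
    by (simp add: mult_ac)
  also have "\<dots> = (\<integral>\<^sup>+z. (?b z * g z) * (\<Prod>(i, j)\<in>S. bernoulli_weight (e (i, j)) (w (cut (act (edge_map i j) z)))) \<partial>Q)"
  proof (rule insert.IH[OF S])
    show "(\<lambda>z. ?b z * g z) \<in> borel_measurable arr" by measurable
    show "?b z * g z \<le> 1" for z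
      using w01 by (intro ennreal_mult_le_1 insert.prems(3) bernoulli_weight_le_1) auto
    fix z z' :: "nat \<times> nat \<Rightarrow> bool"
    assume eq: "\<And>k. k \<notin> {(2 * i, 2 * j) | i j. i \<noteq> j} \<Longrightarrow> z k = z' k"
    have odd: "z (past m, l) = z' (past m, l)" "z (l, past m) = z' (l, past m)" for m l
      by (intro eq; auto)+
    have diag: "z (2 * m, 2 * m) = z' (2 * m, 2 * m)" for m by (intro eq) auto
    have "cut (act (edge_map i j) z) = cut (act (edge_map i j) z')"
    proof
      fix k :: "nat \<times> nat"
      obtain m n where k: "k = (m, n)" by (cases k)
      show "cut (act (edge_map i j) z) k = cut (act (edge_map i j) z') k"
        unfolding k by (cases m rule: nat_two_cases; cases n rule: nat_two_cases)
          (simp_all add: cut_def odd diag)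
    qed
    with insert.prems(4)[OF eq] show "?b z * g z = ?b z' * g z'" by simp
  qed
  also have "\<dots> = (\<integral>\<^sup>+z. g z * (\<Prod>(i, j)\<in>insert p S. bernoulli_weight (e (i, j)) (w (cut (act (edge_map i j) z)))) \<partial>Q)"
    using insert.hyps p by (simp add: mult_ac)
  finally show ?case .
qed

text \<open>Past and stars are packed into one array, so that their joint law can be compared by
  cylinders in \<open>arr\<close>: row 0 is the past, flattened by the pairing function, and row
  \<open>i\<close> is the star of the vertex \<open>2 * i\<close>. As row 0 is taken, the future
  graph starts with \<open>i = 1\<close>.\<close>

definition features :: "(nat \<times> nat \<Rightarrow> bool) \<Rightarrow> nat \<times> nat \<Rightarrow> bool" where
  "features z = (\<lambda>(i, n). if i = 0 then act past z (prod_decode n) else star i z n)"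

lemma measurable_features [measurable]: "features \<in> arr \<rightarrow>\<^sub>M arr"
proof (rule measurable_PiM_countI)
  fix k :: "nat \<times> nat"
  show "(\<lambda>z. features z k) \<in> arr \<rightarrow>\<^sub>M count_space UNIV"
    by (cases k; cases "prod_decode (snd k)") (simp add: features_def star_def)
qed

text \<open>The conditional probability of the pattern \<open>e\<close> given the features
  \<open>H\<close>: loops are determined by \<open>H\<close>, edges are independent coin
  tosses.\<close>

definition graph_weight :: "nat \<Rightarrow> (nat \<times> nat \<Rightarrow> bool) \<Rightarrow> (nat \<times> nat \<Rightarrow> bool) \<Rightarrow> ennreal" where
  "graph_weight n e H =
     (\<Prod>i\<in>{1..n}. of_bool (H (i, 0) = e (i, i))) *
     (\<Prod>(i, j)\<in>{(i, j). 1 \<le> i \<and> i < j \<and> j \<le> n}. bernoulli_weight (e (i, j))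
        (w (join (\<lambda>k. H (0, prod_encode k)) (\<lambda>m. H (i, m)) (\<lambda>m. H (j, m)))))"

lemma measurable_graph_weight [measurable]: "graph_weight n e \<in> borel_measurable arr"
proof -
  have [measurable]: "(\<lambda>H. join (\<lambda>k. H (0, prod_encode k)) (\<lambda>m. H (i, m)) (\<lambda>m. H (j, m))) \<in> arr \<rightarrow>\<^sub>M arr" for i j
    by (intro measurable_join measurable_PiM_countI) simp_all
  show ?thesis unfolding graph_weight_def case_prod_beta by measurable
qed

text \<open>Loops belong to the stars, so they stay as indicators in the function \<open>g\<close>
  of \<open>edge_product\<close>, and only genuine edges turn into weights. Symmetry of
  \<open>e\<close> lets the pairs with \<open>i < j\<close> stand for all off-diagonal ones.\<close>

lemma emeasure_future_cylinder:
  assumes e: "\<And>i j. i \<in> {1..n} \<Longrightarrow> j \<in> {1..n} \<Longrightarrow> e (i, j) = e (j, i)"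
  shows "emeasure Q {z. \<forall>(i, j)\<in>{1..n} \<times> {1..n}. z (2 * i, 2 * j) = e (i, j)} =
    (\<integral>\<^sup>+z. graph_weight n e (features z) \<partial>Q)"
proof -
  let ?S = "{(i, j). 1 \<le> i \<and> i < j \<and> j \<le> n}"
  let ?g = "\<lambda>z :: nat \<times> nat \<Rightarrow> bool. \<Prod>i\<in>{1..n}. (of_bool (z (2 * i, 2 * i) = e (i, i)) :: ennreal)"
  let ?E = "{z :: nat \<times> nat \<Rightarrow> bool. \<forall>(i, j)\<in>{1..n} \<times> {1..n}. z (2 * i, 2 * j) = e (i, j)}"
  have "{z \<in> space Q. \<forall>k\<in>{1..n} \<times> {1..n}. z (2 * fst k, 2 * snd k) = e k} \<in> sets Q" by measurable
  then have E: "?E \<in> sets Q" by (simp add: case_prod_beta)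
  have "emeasure Q ?E = (\<integral>\<^sup>+z. indicator ?E z \<partial>Q)" using E by simp
  also have "\<dots> = (\<integral>\<^sup>+z. ?g z * (\<Prod>(i, j)\<in>?S. of_bool (z (2 * i, 2 * j) = e (i, j))) \<partial>Q)"
  proof (rule nn_integral_cong_AE, rule AE_mp[OF sym], intro AE_I2 impI)
    fix z :: "nat \<times> nat \<Rightarrow> bool" assume z: "\<forall>i j. z (i, j) = z (j, i)"
    have "z \<in> ?E \<longleftrightarrow> (\<forall>i\<in>{1..n}. z (2 * i, 2 * i) = e (i, i)) \<and> (\<forall>(i, j)\<in>?S. z (2 * i, 2 * j) = e (i, j))"
    proof (intro iffI conjI)
      assume "(\<forall>i\<in>{1..n}. z (2 * i, 2 * i) = e (i, i)) \<and> (\<forall>(i, j)\<in>?S. z (2 * i, 2 * j) = e (i, j))"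
      then have d: "\<And>i. i \<in> {1..n} \<Longrightarrow> z (2 * i, 2 * i) = e (i, i)"
        and o: "\<And>i j. i \<in> {1..n} \<Longrightarrow> j \<in> {1..n} \<Longrightarrow> i < j \<Longrightarrow> z (2 * i, 2 * j) = e (i, j)" by auto
      have "z (2 * i, 2 * j) = e (i, j)" if ij: "i \<in> {1..n}" "j \<in> {1..n}" for i j
      proof (cases i j rule: linorder_cases)
        case less
        then show ?thesis using o ij by blast
      next
        case equal
        then show ?thesis using d ij by blast
      next
        case greater
        then have "z (2 * j, 2 * i) = e (j, i)" using o ij by blast
        then show ?thesis using z e[OF ij] by simp
      qed
      then show "z \<in> ?E" by blast
    qed auto
    then have "indicator ?E z = (of_bool (\<forall>i\<in>{1..n}. z (2 * i, 2 * i) = e (i, i)) *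
        of_bool (\<forall>(i, j)\<in>?S. z (2 * i, 2 * j) = e (i, j)) :: ennreal)"
      unfolding indicator_def by (simp only: of_bool_conj)
    also have "of_bool (\<forall>(i, j)\<in>?S. z (2 * i, 2 * j) = e (i, j)) =
        (\<Prod>x\<in>?S. of_bool (case x of (i, j) \<Rightarrow> z (2 * i, 2 * j) = e (i, j)) :: ennreal)"
      by (rule prod_of_bool[OF finite_edges, symmetric])
    also have "\<dots> = (\<Prod>(i, j)\<in>?S. of_bool (z (2 * i, 2 * j) = e (i, j)))"
      by (rule prod.cong) auto
    also have "of_bool (\<forall>i\<in>{1..n}. z (2 * i, 2 * i) = e (i, i)) = ?g z"
      by (rule prod_of_bool[symmetric]) simp
    finally show "indicator ?E z = ?g z * (\<Prod>(i, j)\<in>?S. of_bool (z (2 * i, 2 * j) = e (i, j)))" .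
  qed
  also have "\<dots> = (\<integral>\<^sup>+z. ?g z * (\<Prod>(i, j)\<in>?S. bernoulli_weight (e (i, j)) (w (cut (act (edge_map i j) z)))) \<partial>Q)"
  proof (rule edge_product[OF finite_edges])
    show "?g \<in> borel_measurable arr" by measurable
    show "?g z \<le> 1" for z by (rule prod_le_1) auto
    fix z z' :: "nat \<times> nat \<Rightarrow> bool"
    assume eq: "\<And>k. k \<notin> {(2 * i, 2 * j) | i j. i \<noteq> j} \<Longrightarrow> z k = z' k"
    have "z (2 * i, 2 * i) = z' (2 * i, 2 * i)" for i by (rule eq) auto
    then show "?g z = ?g z'" by simp
  qed auto
  also have "\<dots> = (\<integral>\<^sup>+z. graph_weight n e (features z) \<partial>Q)"
  proof (rule nn_integral_cong_AE, rule AE_mp[OF sym], intro AE_I2 impI)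
    fix z :: "nat \<times> nat \<Rightarrow> bool" assume z: "\<forall>i j. z (i, j) = z (j, i)"
    have past: "(\<lambda>k. features z (0, prod_encode k)) = act past z"
      by (simp add: features_def fun_eq_iff)
    have star: "(\<lambda>m. features z (i, m)) = star i z" if "1 \<le> i" for i
      using that by (simp add: features_def fun_eq_iff)
    have "?g z = (\<Prod>i\<in>{1..n}. of_bool (features z (i, 0) = e (i, i)))"
      by (intro prod.cong refl) (simp add: features_def star_def)
    moreover have "(\<Prod>(i, j)\<in>?S. bernoulli_weight (e (i, j)) (w (cut (act (edge_map i j) z)))) =
        (\<Prod>(i, j)\<in>?S. bernoulli_weight (e (i, j)) (w (join (\<lambda>k. features z (0, prod_encode k))
          (\<lambda>m. features z (i, m)) (\<lambda>m. features z (j, m)))))"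
    proof (rule prod.cong[OF refl], clarify)
      fix i j :: nat assume "1 \<le> i" "i < j"
      then show "bernoulli_weight (e (i, j)) (w (cut (act (edge_map i j) z))) =
          bernoulli_weight (e (i, j)) (w (join (\<lambda>k. features z (0, prod_encode k))
            (\<lambda>m. features z (i, m)) (\<lambda>m. features z (j, m))))"
        using star[of i] star[of j] by (simp add: past cut_act_edge_map[OF z])
    qed
    ultimately show "?g z * (\<Prod>(i, j)\<in>?S. bernoulli_weight (e (i, j)) (w (cut (act (edge_map i j) z)))) =
        graph_weight n e (features z)"
      unfolding graph_weight_def by (rule arg_cong2[where f="(*)"])
  qed
  finally show ?thesis .
qed

end

section \<open>Past and stars as functions of independent uniform variables\<close>

abbreviation labels :: "(nat \<Rightarrow> real) measure" where
  "labels \<equiv> PiM {1..} (\<lambda>_. unif01)"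

text \<open>The layout of \<open>features\<close>, with \<open>c\<close> as the past and the star of
  vertex \<open>i\<close> decoded by \<open>y\<close> from its own uniform label.\<close>

definition model_features ::
    "(nat \<times> nat \<Rightarrow> bool) \<Rightarrow> (real \<Rightarrow> nat \<Rightarrow> bool) \<Rightarrow> (nat \<Rightarrow> real) \<Rightarrow> nat \<times> nat \<Rightarrow> bool" where
  "model_features c y x = (\<lambda>(i, n). if i = 0 then c (prod_decode n) else y (x i) n)"

lemma emeasure_distr_of_bool:
  assumes f[measurable]: "f \<in> N \<rightarrow>\<^sub>M M" and S: "{x \<in> space M. R x} \<in> sets M"
  shows "emeasure (distr N M f) {x \<in> space M. R x} = (\<integral>\<^sup>+\<omega>. of_bool (R (f \<omega>)) \<partial>N)"
proof -
  have "emeasure (distr N M f) {x \<in> space M. R x} = (\<integral>\<^sup>+x. indicator {x \<in> space M. R x} x \<partial>distr N M f)"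
    using S by simp
  also have "\<dots> = (\<integral>\<^sup>+\<omega>. indicator {x \<in> space M. R x} (f \<omega>) \<partial>N)"
    using S by (intro nn_integral_distr) auto
  also have "\<dots> = (\<integral>\<^sup>+\<omega>. of_bool (R (f \<omega>)) \<partial>N)"
    using measurable_space[OF f] by (intro nn_integral_cong) (auto simp: indicator_def)
  finally show ?thesis .
qed

lemma prob_space_labels: "prob_space labels"
  by (intro prob_space_PiM prob_space_unif01)

lemma arr_eq_distr_unif01:
  assumes "prob_space Q" and sQ: "sets Q = sets arr"
  obtains A where "A \<in> unif01 \<rightarrow>\<^sub>M arr" "distr unif01 arr A = Q"
proof -
  interpret prob_space Q by fact
  let ?f = "\<lambda>(z :: nat \<times> nat \<Rightarrow> bool) n. z (prod_decode n)" and ?g = "\<lambda>(b :: nat \<Rightarrow> bool) k. b (prod_encode k)"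
  have f: "?f \<in> Q \<rightarrow>\<^sub>M bits" unfolding measurable_cong_sets[OF sQ refl] by (rule measurable_PiM_countI) simp
  have g: "?g \<in> bits \<rightarrow>\<^sub>M arr" by (rule measurable_PiM_countI) simp
  obtain d where d: "d \<in> unif01 \<rightarrow>\<^sub>M bits" "distr unif01 bits d = distr Q bits ?f"
    by (rule prob_measure_bits_eq_distr_unif01[OF prob_space_distr[OF f]]) auto
  have "distr unif01 arr (?g \<circ> d) = distr Q arr (?g \<circ> ?f)"
    using distr_distr[OF g d(1)] distr_distr[OF g f] d(2) by simp
  also have "?g \<circ> ?f = (\<lambda>z. z)" by (auto simp: fun_eq_iff)
  also have "distr Q arr (\<lambda>z. z) = Q" using sQ by (intro distr_id2) simp
  finally show thesis using measurable_comp[OF d(1) g] that by blast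
qed

context exchangeable_kernels
begin

text \<open>The rectangle covers the past and \<open>k\<close> stars. Each of its rows is a prefix
  of length \<open>k\<close>, which brings the event into the form handled by
  \<open>vertex_product\<close>.\<close>

lemma emeasure_features_cylinder:
  "(\<integral>\<^sup>+z. of_bool (\<forall>p\<in>{..k} \<times> {..<k}. features z p = e p) \<partial>Q) =
    (\<integral>\<^sup>+z. of_bool (pre (\<lambda>n. z (prod_decode n)) k = pre (\<lambda>n. e (0, n)) k) *
      (\<Prod>i\<in>{1..k}. ennreal (v z (pre (\<lambda>n. e (i, n)) k))) \<partial>Q)"
proof -
  let ?t = "\<lambda>i. pre (\<lambda>n. e (i, n)) k"
  let ?D = "\<lambda>c :: nat \<times> nat \<Rightarrow> bool. of_bool (pre (\<lambda>n. c (prod_decode n)) k = ?t 0) :: ennreal"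
  have "(\<lambda>c :: nat \<times> nat \<Rightarrow> bool. pre (\<lambda>n. c (prod_decode n)) k) \<in> arr \<rightarrow>\<^sub>M count_space UNIV"
    by (rule measurable_pre) simp
  from measurable_compose[OF this, of "\<lambda>s. of_bool (s = ?t 0) :: ennreal" borel]
  have D: "?D \<in> borel_measurable arr" by simp
  have "(\<forall>p\<in>{..k} \<times> {..<k}. features z p = e p) \<longleftrightarrow>
      pre (\<lambda>n. act past z (prod_decode n)) k = ?t 0 \<and> (\<forall>i\<in>{1..k}. pre (star i z) k = ?t i)" for z
  proof -
    have "(\<forall>p\<in>{..k} \<times> {..<k}. features z p = e p) \<longleftrightarrow>
        (\<forall>n<k. features z (0, n) = e (0, n)) \<and> (\<forall>i\<in>{1..k}. \<forall>n<k. features z (i, n) = e (i, n))"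
      (is "?L \<longleftrightarrow> ?R")
    proof
      assume R: ?R
      show ?L
      proof clarify
        fix i n assume "i \<le> k" "n < k"
        with R show "features z (i, n) = e (i, n)" by (cases "i = 0") auto
      qed
    qed auto
    then show ?thesis by (auto simp: pre_eq_iff features_def)
  qed
  then have "(\<integral>\<^sup>+z. of_bool (\<forall>p\<in>{..k} \<times> {..<k}. features z p = e p) \<partial>Q) =
      (\<integral>\<^sup>+z. ?D (act past z) * (\<Prod>i\<in>{1..k}. of_bool (pre (star i z) (length (?t i)) = ?t i)) \<partial>Q)"
    by (simp add: prod_of_bool of_bool_conj)
  also have "\<dots> = (\<integral>\<^sup>+z. ?D z * (\<Prod>i\<in>{1..k}. ennreal (v z (?t i))) \<partial>Q)"
    by (rule vertex_product[OF _ D]) simp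
  finally show ?thesis .
qed

text \<open>Given \<alpha>, the star rows of \<open>model_features\<close> are independent because
  the labels are, with prefix probabilities \<open>v (A \<alpha>)\<close>;
  \<open>vertex_product\<close> gives the same product for the true features. Agreement on cylinders
  yields agreement in law.\<close>

lemma features_law:
  obtains A y where "A \<in> unif01 \<rightarrow>\<^sub>M arr" "(\<lambda>(c, u). y c u) \<in> arr \<Otimes>\<^sub>M unif01 \<rightarrow>\<^sub>M bits"
    "\<And>\<Phi>. \<Phi> \<in> borel_measurable arr \<Longrightarrow> (\<integral>\<^sup>+z. \<Phi> (features z) \<partial>Q) =
      (\<integral>\<^sup>+\<alpha>. \<integral>\<^sup>+x. \<Phi> (model_features (A \<alpha>) (y (A \<alpha>)) x) \<partial>labels \<partial>unif01)"
proof -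
  interpret U: prob_space unif01 by (rule prob_space_unif01)
  interpret L: prob_space labels by (rule prob_space_labels)
  interpret LP: product_prob_space "\<lambda>_. unif01" "{1::nat..}" ..
  obtain A where A[measurable]: "A \<in> unif01 \<rightarrow>\<^sub>M arr" and law_A: "distr unif01 arr A = Q"
    using arr_eq_distr_unif01[OF prob_space_axioms sets_Q] by blast
  obtain y where y: "(\<lambda>(c, u). y c u) \<in> arr \<Otimes>\<^sub>M unif01 \<rightarrow>\<^sub>M bits"
    and law_y: "\<And>c t. consistent (v c) \<Longrightarrow> emeasure unif01 {u \<in> {0..1}. pre (y c u) (length t) = t} = ennreal (v c t)"
    using kernel_bits_eq_distr_unif01[where p=v and N=arr] v_measurable by blast
  have y_comp: "(\<lambda>\<omega>. y (c \<omega>) (u \<omega>)) \<in> N \<rightarrow>\<^sub>M bits"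
    if "c \<in> N \<rightarrow>\<^sub>M arr" "u \<in> N \<rightarrow>\<^sub>M unif01" for c u and N :: "'a measure"
    using measurable_compose[OF measurable_Pair[OF that] y] by simp
  have y_bit: "(\<lambda>u. y c u n) \<in> unif01 \<rightarrow>\<^sub>M count_space UNIV" for c n
    by (rule measurable_compose[OF y_comp[of "\<lambda>_. c"] measurable_component_singleton]) (auto simp: space_PiM)
  define H where "H = (\<lambda>(\<alpha>, x). model_features (A \<alpha>) (y (A \<alpha>)) x)"
  have H[measurable]: "H \<in> unif01 \<Otimes>\<^sub>M labels \<rightarrow>\<^sub>M arr"
  proof (rule measurable_PiM_countI)
    fix p :: "nat \<times> nat"
    obtain i n where p: "p = (i, n)" by (cases p)
    show "(\<lambda>\<omega>. H \<omega> p) \<in> unif01 \<Otimes>\<^sub>M labels \<rightarrow>\<^sub>M count_space UNIV"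
    proof (cases "i = 0")
      case True
      have "(\<lambda>\<omega>. A (fst \<omega>) (prod_decode n)) \<in> unif01 \<Otimes>\<^sub>M labels \<rightarrow>\<^sub>M count_space UNIV"
        by (rule measurable_compose[OF measurable_compose[OF measurable_fst A] measurable_component_singleton]) simp
      then show ?thesis using True by (simp add: H_def model_features_def p case_prod_beta)
    next
      case False
      have "(\<lambda>\<omega>. y (A (fst \<omega>)) (snd \<omega> i) n) \<in> unif01 \<Otimes>\<^sub>M labels \<rightarrow>\<^sub>M count_space UNIV"
        using False
        by (intro measurable_compose[OF y_comp measurable_component_singleton]
            measurable_compose[OF measurable_fst A]
            measurable_compose[OF measurable_snd measurable_component_singleton]) auto
      then show ?thesis using False by (simp add: H_def model_features_def p case_prod_beta)
    qed
  qed
  \<comment> \<open>\<open>v\<close> is consistent almost surely under \<open>Q\<close>, and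
    \<open>A\<close> carries the uniform law to \<open>Q\<close>; so the decoding is correct for
    almost every \<alpha>.\<close>
  have AE_cons: "AE \<alpha> in unif01. consistent (v (A \<alpha>))"
    using v_consistent unfolding law_A[symmetric] by (rule AE_distrD[OF A])
  have law: "distr Q arr features = distr (unif01 \<Otimes>\<^sub>M labels) arr H"
  proof (rule measure_eqI_cylinders)
    show "finite_measure (distr Q arr features)" by (intro finite_measure_distr) measurable
    fix J :: "(nat \<times> nat) set" assume "finite J"
    then have "finite (fst ` J \<union> snd ` J)" by auto
    then obtain k where k: "fst ` J \<union> snd ` J \<subseteq> {..<k}" using finite_nat_iff_bounded by blast
    have "J \<subseteq> {..k} \<times> {..<k}"
    proof
      fix p assume "p \<in> J"
      then have "fst p \<in> {..<k}" "snd p \<in> {..<k}" using k by blast+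
      then show "p \<in> {..k} \<times> {..<k}" by (cases p) auto
    qed
    moreover have "emeasure (distr Q arr features) {z \<in> space arr. \<forall>p\<in>{..k} \<times> {..<k}. z p = e p} =
        emeasure (distr (unif01 \<Otimes>\<^sub>M labels) arr H) {z \<in> space arr. \<forall>p\<in>{..k} \<times> {..<k}. z p = e p}" for e
    proof -
      let ?t = "\<lambda>i. pre (\<lambda>n. e (i, n)) k"
      let ?D = "\<lambda>c :: nat \<times> nat \<Rightarrow> bool. of_bool (pre (\<lambda>n. c (prod_decode n)) k = ?t 0) :: ennreal"
      have "(\<lambda>c :: nat \<times> nat \<Rightarrow> bool. pre (\<lambda>n. c (prod_decode n)) k) \<in> arr \<rightarrow>\<^sub>M count_space UNIV"
        by (rule measurable_pre) simp
      from measurable_compose[OF this, of "\<lambda>s. of_bool (s = ?t 0) :: ennreal" borel]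
      have D[measurable]: "?D \<in> borel_measurable arr" by simp
      have S: "{z \<in> space arr. \<forall>p\<in>{..k} \<times> {..<k}. z p = e p} \<in> sets arr" by measurable
      have "emeasure (distr (unif01 \<Otimes>\<^sub>M labels) arr H) {z \<in> space arr. \<forall>p\<in>{..k} \<times> {..<k}. z p = e p} =
          (\<integral>\<^sup>+\<omega>. of_bool (\<forall>p\<in>{..k} \<times> {..<k}. H \<omega> p = e p) \<partial>(unif01 \<Otimes>\<^sub>M labels))"
        by (rule emeasure_distr_of_bool[OF H S])
      also have "\<dots> = (\<integral>\<^sup>+\<alpha>. \<integral>\<^sup>+x. of_bool (\<forall>p\<in>{..k} \<times> {..<k}. H (\<alpha>, x) p = e p) \<partial>labels \<partial>unif01)"
      proof (rule L.nn_integral_fst[symmetric])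
        have "(\<lambda>z. of_bool (\<forall>p\<in>{..k} \<times> {..<k}. z p = e p) :: ennreal) \<in> borel_measurable arr"
          using borel_measurable_indicator[OF S, where 'b=ennreal] by (simp add: indicator_def[abs_def] space_PiM of_bool_def)
        from measurable_compose[OF H this]
        show "(\<lambda>\<omega>. of_bool (\<forall>p\<in>{..k} \<times> {..<k}. H \<omega> p = e p) :: ennreal) \<in> borel_measurable (unif01 \<Otimes>\<^sub>M labels)" .
      qed
      also have "\<dots> = (\<integral>\<^sup>+\<alpha>. ?D (A \<alpha>) * (\<Prod>i\<in>{1..k}. ennreal (v (A \<alpha>) (?t i))) \<partial>unif01)"
      proof (rule nn_integral_cong_AE, rule AE_mp[OF AE_cons], intro AE_I2 impI)
        fix \<alpha> assume cons: "consistent (v (A \<alpha>))"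
        let ?X = "\<lambda>i. {u \<in> {0..1}. pre (y (A \<alpha>) u) k = ?t i}"
        have X: "?X i \<in> sets unif01" for i
          using measurable_Collect_pre[where M=unif01 and f="y (A \<alpha>)" and n=k and t="?t i", OF y_bit] by simp
        have B: "{x \<in> space labels. \<forall>i\<in>{1..k}. x i \<in> ?X i} \<in> sets labels"
        proof (rule sets.sets_Collect_finite_All)
          fix i assume "i \<in> {1..k}"
          then have "(\<lambda>x. x i) \<in> labels \<rightarrow>\<^sub>M unif01"
            by (intro measurable_component_singleton) simp
          from measurable_sets[OF this X[of i]] show "{x \<in> space labels. x i \<in> ?X i} \<in> sets labels"
            by (simp only: vimage_def Int_def mem_Collect_eq conj_commute)
        qed simp
        have "(\<forall>p\<in>{..k} \<times> {..<k}. H (\<alpha>, x) p = e p) \<longleftrightarrow>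
            pre (\<lambda>n. A \<alpha> (prod_decode n)) k = ?t 0 \<and> (\<forall>i\<in>{1..k}. pre (y (A \<alpha>) (x i)) k = ?t i)" for x
        proof -
          have "(\<forall>p\<in>{..k} \<times> {..<k}. H (\<alpha>, x) p = e p) \<longleftrightarrow>
              (\<forall>n<k. H (\<alpha>, x) (0, n) = e (0, n)) \<and> (\<forall>i\<in>{1..k}. \<forall>n<k. H (\<alpha>, x) (i, n) = e (i, n))"
            (is "?L \<longleftrightarrow> ?R")
          proof
            assume R: ?R
            show ?L
            proof clarify
              fix i n assume "i \<le> k" "n < k"
              with R show "H (\<alpha>, x) (i, n) = e (i, n)" by (cases "i = 0") auto
            qed
          qed auto
          then show ?thesis by (auto simp: pre_eq_iff H_def model_features_def)
        qed
        then have "(\<integral>\<^sup>+x. of_bool (\<forall>p\<in>{..k} \<times> {..<k}. H (\<alpha>, x) p = e p) \<partial>labels) =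
            (\<integral>\<^sup>+x. ?D (A \<alpha>) * indicator {x \<in> space labels. \<forall>i\<in>{1..k}. x i \<in> ?X i} x \<partial>labels)"
          by (intro nn_integral_cong) (auto simp: indicator_def space_PiM PiE_iff)
        also have "\<dots> = ?D (A \<alpha>) * emeasure labels {x \<in> space labels. \<forall>i\<in>{1..k}. x i \<in> ?X i}"
          using B by (rule nn_integral_cmult_indicator)
        also have "emeasure labels {x \<in> space labels. \<forall>i\<in>{1..k}. x i \<in> ?X i} = (\<Prod>i\<in>{1..k}. emeasure unif01 (?X i))"
          by (rule LP.emeasure_PiM_Collect) (use X in auto)
        also have "\<dots> = (\<Prod>i\<in>{1..k}. ennreal (v (A \<alpha>) (?t i)))"
          using law_y[OF cons, of "?t _"] by simp
        finally show "(\<integral>\<^sup>+x. of_bool (\<forall>p\<in>{..k} \<times> {..<k}. H (\<alpha>, x) p = e p) \<partial>labels) =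
            ?D (A \<alpha>) * (\<Prod>i\<in>{1..k}. ennreal (v (A \<alpha>) (?t i)))" .
      qed
      also have "\<dots> = (\<integral>\<^sup>+z. ?D z * (\<Prod>i\<in>{1..k}. ennreal (v z (?t i))) \<partial>Q)"
        unfolding law_A[symmetric] by (rule nn_integral_distr[symmetric]) measurable
      also have "\<dots> = (\<integral>\<^sup>+z. of_bool (\<forall>p\<in>{..k} \<times> {..<k}. features z p = e p) \<partial>Q)"
        by (rule emeasure_features_cylinder[symmetric])
      also have "\<dots> = emeasure (distr Q arr features) {z \<in> space arr. \<forall>p\<in>{..k} \<times> {..<k}. z p = e p}"
        by (rule emeasure_distr_of_bool[symmetric, OF _ S]) measurable
      finally show ?thesis by simp
    qed
    ultimately show "\<exists>K. finite K \<and> J \<subseteq> K \<and> K \<subseteq> UNIV \<and>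
        (\<forall>e. emeasure (distr Q arr features) {x \<in> space (distr Q arr features). \<forall>k\<in>K. x k = e k} =
          emeasure (distr (unif01 \<Otimes>\<^sub>M labels) arr H) {x \<in> space (distr (unif01 \<Otimes>\<^sub>M labels) arr H). \<forall>k\<in>K. x k = e k})"
      by (intro exI[of _ "{..k} \<times> {..<k}"]) simp
  qed auto
  show thesis
  proof (rule that[OF A y])
    fix \<Phi> :: "_ \<Rightarrow> ennreal" assume \<Phi>[measurable]: "\<Phi> \<in> borel_measurable arr"
    have "(\<integral>\<^sup>+z. \<Phi> (features z) \<partial>Q) = (\<integral>\<^sup>+z. \<Phi> z \<partial>distr Q arr features)"
      by (rule nn_integral_distr[symmetric]) measurable
    also have "\<dots> = (\<integral>\<^sup>+\<omega>. \<Phi> (H \<omega>) \<partial>(unif01 \<Otimes>\<^sub>M labels))"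
      unfolding law by (rule nn_integral_distr) measurable
    also have "\<dots> = (\<integral>\<^sup>+\<alpha>. \<integral>\<^sup>+x. \<Phi> (H (\<alpha>, x)) \<partial>labels \<partial>unif01)"
      by (rule L.nn_integral_fst[symmetric]) measurable
    finally show "(\<integral>\<^sup>+z. \<Phi> (features z) \<partial>Q) =
        (\<integral>\<^sup>+\<alpha>. \<integral>\<^sup>+x. \<Phi> (model_features (A \<alpha>) (y (A \<alpha>)) x) \<partial>labels \<partial>unif01)"
      by (simp add: H_def)
  qed
qed

end

section \<open>Random graphons\<close>

text \<open>Measurability is tested on the generating product algebra, where the mass of a box is a
  finite sum of masses of square patterns, over an index set \<open>B\<close> that is the same for
  all \<open>a\<close>.\<close>

lemma measurable_graph_kernel:
  assumes prob: "\<And>a. a \<in> space M \<Longrightarrow> prob_space (K a)"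
    and sets: "\<And>a. a \<in> space M \<Longrightarrow> sets (K a) = sets (graph_space {1..})"
    and meas: "\<And>n e. 1 \<le> n \<Longrightarrow>
      (\<lambda>a. emeasure (K a) {X \<in> space (graph_space {1..}). \<forall>k\<in>{1..n} \<times> {1..n}. X k = e k}) \<in> borel_measurable M"
  shows "K \<in> M \<rightarrow>\<^sub>M subprob_algebra (graph_space {1..})"
proof (rule measurable_subprob_algebra_generated[OF _ Int_stable_prod_algebra prod_algebra_sets_into_space])
  let ?I = "{1..} \<times> {1..} :: (nat \<times> nat) set"
  show "sets (graph_space {1..}) = sigma_sets (\<Pi>\<^sub>E i\<in>?I. space (count_space UNIV)) (prod_algebra ?I (\<lambda>_. count_space UNIV))"
    unfolding graph_space_def by (rule sets_PiM)
  show "subprob_space (K a)" if "a \<in> space M" for a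
    using prob[OF that] by (rule prob_space_imp_subprob_space)
  show "sets (K a) = sets (graph_space {1..})" if "a \<in> space M" for a by (rule sets[OF that])
  have sp: "space (K a) = space (graph_space {1..})" if "a \<in> space M" for a
    by (rule sets_eq_imp_space_eq[OF sets[OF that]])
  show "(\<lambda>a. emeasure (K a) (\<Pi>\<^sub>E i\<in>?I. space (count_space UNIV))) \<in> borel_measurable M"
  proof (rule measurable_cong[THEN iffD1])
    fix a assume a: "a \<in> space M"
    have "(\<Pi>\<^sub>E i\<in>?I. space (count_space UNIV)) = space (K a)"
      unfolding sp[OF a] by (simp add: graph_space_def space_PiM)
    then show "1 = emeasure (K a) (\<Pi>\<^sub>E i\<in>?I. space (count_space UNIV))"
      using prob_space.emeasure_space_1[OF prob[OF a]] by simp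
  qed simp
  fix S assume "S \<in> prod_algebra ?I (\<lambda>_. count_space (UNIV :: bool set))"
  then obtain J A where S: "S = prod_emb ?I (\<lambda>_. count_space (UNIV :: bool set)) J (PiE J A)"
    and J: "finite J" "J \<subseteq> ?I"
    by (rule prod_algebraE)
  obtain n where n: "1 \<le> n" "J \<subseteq> {1..n} \<times> {1..n}" using finite_subset_square[OF J] by blast
  obtain B where B: "\<And>P. sets P = sets (PiM ?I (\<lambda>_. count_space UNIV)) \<Longrightarrow>
      emeasure P (prod_emb ?I (\<lambda>_. count_space UNIV) J (PiE J A)) =
      (\<Sum>e\<in>B. emeasure P {x \<in> space P. \<forall>k\<in>{1..n} \<times> {1..n}. x k = e k})"
    by (rule emeasure_prod_emb_cylinders[of "{1..n} \<times> {1..n}" J ?I A]) (use n in auto)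
  show "(\<lambda>a. emeasure (K a) S) \<in> borel_measurable M"
  proof (rule measurable_cong[THEN iffD1])
    fix a assume a: "a \<in> space M"
    show "(\<Sum>e\<in>B. emeasure (K a) {X \<in> space (graph_space {1..}). \<forall>k\<in>{1..n} \<times> {1..n}. X k = e k}) = emeasure (K a) S"
      unfolding S using B[of "K a"] sets[OF a] sp[OF a] by (simp add: graph_space_def)
  qed (use meas[OF n(1)] in \<open>auto intro!: borel_measurable_sum\<close>)
qed

section \<open>Cylinder probabilities given the vertex labels\<close>

lemma prod_ordered_pairs:
  fixes f :: "nat \<Rightarrow> nat \<Rightarrow> 'a :: comm_monoid_mult"
  shows "(\<Prod>(i, j)\<in>{(i, j). 1 \<le> i \<and> i \<le> j \<and> j \<le> n}. f i j) =
    (\<Prod>i\<in>{1..n}. f i i) * (\<Prod>(i, j)\<in>{(i, j). 1 \<le> i \<and> i < j \<and> j \<le> n}. f i j)"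
proof -
  have "{(i, j). 1 \<le> i \<and> i \<le> j \<and> j \<le> n} = (\<lambda>i. (i, i)) ` {1..n} \<union> {(i, j). 1 \<le> i \<and> i < j \<and> j \<le> n}"
    by auto
  then have "(\<Prod>(i, j)\<in>{(i, j). 1 \<le> i \<and> i \<le> j \<and> j \<le> n}. f i j) =
      (\<Prod>(i, j)\<in>(\<lambda>i. (i, i)) ` {1..n}. f i j) * (\<Prod>(i, j)\<in>{(i, j). 1 \<le> i \<and> i < j \<and> j \<le> n}. f i j)"
    using finite_edges[of n] by (simp only:) (rule prod.union_disjoint, auto)
  also have "(\<Prod>(i, j)\<in>(\<lambda>i. (i, i)) ` {1..n}. f i j) = (\<Prod>i\<in>{1..n}. f i i)"
    by (subst prod.reindex) (auto simp: inj_on_def)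
  finally show ?thesis .
qed

text \<open>A symmetric pattern amounts to prescribing the entries with i \<le> j, which are
  independent Bernoulli variables. An asymmetric one demands two different values of a single
  variable, so it has probability zero.\<close>

lemma edge_law_cylinder:
  assumes W: "\<forall>i j. 1 \<le> i \<longrightarrow> i \<le> j \<longrightarrow> W (x i) (x j) \<in> {0..1}"
  shows "prob_space (edge_law W x)" "sets (edge_law W x) = sets (graph_space {1..})"
    "emeasure (edge_law W x) {X \<in> space (graph_space {1..}). \<forall>k\<in>{1..n} \<times> {1..n}. X k = e k} =
      (if \<forall>i\<in>{1..n}. \<forall>j\<in>{1..n}. e (i, j) = e (j, i)
       then \<Prod>(i, j)\<in>{(i, j). 1 \<le> i \<and> i \<le> j \<and> j \<le> n}. bernoulli_weight (e (i, j)) (W (x i) (x j)) else 0)"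
proof -
  let ?T = "{(i, j). 1 \<le> i \<and> i \<le> j} :: (nat \<times> nat) set"
  let ?B = "\<lambda>(i, j). measure_pmf (bernoulli_pmf (W (x i) (x j)))"
  let ?S = "\<lambda>Y :: nat \<times> nat \<Rightarrow> bool. \<lambda>(i, j)\<in>{1..} \<times> {1..}. Y (min i j, max i j)"
  have B: "prob_space (?B p)" for p
    by (cases p) (simp add: measure_pmf.prob_space_axioms)
  interpret product_prob_space ?B ?T by (rule product_prob_spaceI) (rule B)
  have comp: "(\<lambda>Y. Y p) \<in> PiM ?T ?B \<rightarrow>\<^sub>M count_space UNIV" if "p \<in> ?T" for p
    using measurable_component_singleton[OF that, of ?B] by (cases p) (simp add: measurable_def)
  have S: "?S \<in> PiM ?T ?B \<rightarrow>\<^sub>M graph_space {1..}"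
  proof (rule measurable_graph_spaceI)
    fix k :: "nat \<times> nat" assume k: "k \<in> {1..} \<times> {1..}"
    then have "(\<lambda>Y. Y (min (fst k) (snd k), max (fst k) (snd k))) \<in> PiM ?T ?B \<rightarrow>\<^sub>M count_space UNIV"
      by (intro comp) auto
    then show "(\<lambda>Y. ?S Y k) \<in> PiM ?T ?B \<rightarrow>\<^sub>M count_space UNIV"
      using k by (simp add: case_prod_beta)
  qed simp
  show "prob_space (edge_law W x)" unfolding edge_law_def by (rule prob_space_distr[OF S])
  show "sets (edge_law W x) = sets (graph_space {1..})" unfolding edge_law_def by simp
  have "emeasure (edge_law W x) {X \<in> space (graph_space {1..}). \<forall>k\<in>{1..n} \<times> {1..n}. X k = e k} =
      emeasure (PiM ?T ?B) (?S -` {X \<in> space (graph_space {1..}). \<forall>k\<in>{1..n} \<times> {1..n}. X k = e k} \<inter> space (PiM ?T ?B))"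
    unfolding edge_law_def by (rule emeasure_distr[OF S sets_cylinder[where h="\<lambda>k. k"]]) auto
  also have "?S -` {X \<in> space (graph_space {1..}). \<forall>k\<in>{1..n} \<times> {1..n}. X k = e k} \<inter> space (PiM ?T ?B) =
      {Y \<in> space (PiM ?T ?B). \<forall>i\<in>{1..n}. \<forall>j\<in>{1..n}. Y (min i j, max i j) = e (i, j)}"
    by (auto simp: space_graph_space)
  also have "emeasure (PiM ?T ?B) \<dots> = (if \<forall>i\<in>{1..n}. \<forall>j\<in>{1..n}. e (i, j) = e (j, i)
       then \<Prod>(i, j)\<in>{(i, j). 1 \<le> i \<and> i \<le> j \<and> j \<le> n}. bernoulli_weight (e (i, j)) (W (x i) (x j)) else 0)"
  proof (cases "\<forall>i\<in>{1..n}. \<forall>j\<in>{1..n}. e (i, j) = e (j, i)")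
    case True
    let ?J = "{(i, j). 1 \<le> i \<and> i \<le> j \<and> j \<le> n}"
    have fJ: "finite ?J" by (rule finite_subset[of _ "{..n} \<times> {..n}"]) auto
    have "(\<forall>i\<in>{1..n}. \<forall>j\<in>{1..n}. Y (min i j, max i j) = e (i, j)) \<longleftrightarrow> (\<forall>p\<in>?J. Y p \<in> {e p})" for Y
    proof
      assume L: "\<forall>i\<in>{1..n}. \<forall>j\<in>{1..n}. Y (min i j, max i j) = e (i, j)"
      show "\<forall>p\<in>?J. Y p \<in> {e p}"
      proof clarify
        fix i j :: nat assume "1 \<le> i" "i \<le> j" "j \<le> n"
        then show "Y (i, j) = e (i, j)" using bspec[OF bspec[OF L, of i], of j] by simp
      qed
    next
      assume R: "\<forall>p\<in>?J. Y p \<in> {e p}"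
      show "\<forall>i\<in>{1..n}. \<forall>j\<in>{1..n}. Y (min i j, max i j) = e (i, j)"
      proof (intro ballI)
        fix i j assume ij: "i \<in> {1..n}" "j \<in> {1..n}"
        then have "Y (min i j, max i j) = e (min i j, max i j)"
          using bspec[OF R, of "(min i j, max i j)"] by simp
        then show "Y (min i j, max i j) = e (i, j)"
          using True ij by (cases "i \<le> j") (auto simp: min_def max_def)
      qed
    qed
    then have "emeasure (PiM ?T ?B) {Y \<in> space (PiM ?T ?B). \<forall>i\<in>{1..n}. \<forall>j\<in>{1..n}. Y (min i j, max i j) = e (i, j)} =
        emeasure (PiM ?T ?B) {Y \<in> space (PiM ?T ?B). \<forall>p\<in>?J. Y p \<in> {e p}}" by simp
    also have "\<dots> = (\<Prod>p\<in>?J. emeasure (?B p) {e p})"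
      by (rule emeasure_PiM_Collect[OF _ fJ]) auto
    also have "\<dots> = (\<Prod>(i, j)\<in>?J. bernoulli_weight (e (i, j)) (W (x i) (x j)))"
    proof (rule prod.cong[OF refl], clarify)
      fix i j :: nat assume "1 \<le> i" "i \<le> j"
      then show "emeasure (measure_pmf (bernoulli_pmf (W (x i) (x j)))) {e (i, j)} =
          bernoulli_weight (e (i, j)) (W (x i) (x j))"
        using W[rule_format, of i j] by (cases "e (i, j)") (simp_all add: emeasure_pmf_single bernoulli_weight_def)
    qed
    finally show ?thesis using True by simp
  next
    case False
    then obtain i j where "i \<in> {1..n}" "j \<in> {1..n}" "e (i, j) \<noteq> e (j, i)" by blast
    then have "\<not> (\<forall>i\<in>{1..n}. \<forall>j\<in>{1..n}. Y (min i j, max i j) = e (i, j))" for Y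
      by (metis min.commute max.commute)
    then have empty: "{Y \<in> space (PiM ?T ?B). \<forall>i\<in>{1..n}. \<forall>j\<in>{1..n}. Y (min i j, max i j) = e (i, j)} = {}" by simp
    show ?thesis unfolding empty if_not_P[OF False] by simp
  qed
  finally show "emeasure (edge_law W x) {X \<in> space (graph_space {1..}). \<forall>k\<in>{1..n} \<times> {1..n}. X k = e k} =
      (if \<forall>i\<in>{1..n}. \<forall>j\<in>{1..n}. e (i, j) = e (j, i)
       then \<Prod>(i, j)\<in>{(i, j). 1 \<le> i \<and> i \<le> j \<and> j \<le> n}. bernoulli_weight (e (i, j)) (W (x i) (x j)) else 0)" .
qed

section \<open>Uniform labels and mixtures\<close>

lemma measurable_label: "1 \<le> i \<Longrightarrow> (\<lambda>x. x i) \<in> labels \<rightarrow>\<^sub>M unif01"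
  by (rule measurable_component_singleton) simp

lemma borel_measurable_label: "1 \<le> i \<Longrightarrow> (\<lambda>x. x i) \<in> borel_measurable labels"
  by (rule measurable_compose[OF measurable_label borel_measurable_unif01])

text \<open>Fubini after separating coordinate \<open>i\<close> from the others: with
  \<open>x i\<close> held fixed, \<open>x j\<close> almost surely avoids it.\<close>

lemma AE_labels_distinct: "AE x in labels. \<forall>i\<ge>1. \<forall>j\<ge>1. i \<noteq> j \<longrightarrow> x i \<noteq> x j"
proof -
  have "AE x in labels. x i \<noteq> x j" if ij: "1 \<le> i" "1 \<le> j" "i \<noteq> j" for i j
  proof -
    let ?I = "{1..} - {i}"
    let ?L = "PiM ?I (\<lambda>_. unif01)"
    interpret U: prob_space unif01 by (rule prob_space_unif01)
    interpret L: prob_space ?L by (intro prob_space_PiM prob_space_unif01)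
    interpret LP: product_prob_space "\<lambda>_. unif01" ?I ..
    interpret UL: pair_sigma_finite unif01 ?L ..
    have ins: "insert i ?I = {1..}" using ij by auto
    have m: "(\<lambda>(u, X). X(i := u)) \<in> unif01 \<Otimes>\<^sub>M ?L \<rightarrow>\<^sub>M labels"
      using measurable_fun_upd[of "{1..}" ?I i snd "unif01 \<Otimes>\<^sub>M ?L" "\<lambda>_. unif01" fst] ins
      by (simp add: case_prod_beta insert_commute)
    have law: "distr (unif01 \<Otimes>\<^sub>M ?L) labels (\<lambda>(u, X). X(i := u)) = labels"
      using distr_pair_PiM_eq_PiM[of ?I "\<lambda>_. unif01" i] prob_space_unif01 unfolding ins by simp
    have [measurable]: "(\<lambda>X. X j) \<in> ?L \<rightarrow>\<^sub>M unif01" using ij by (intro measurable_component_singleton) auto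
    have [measurable]: "(\<lambda>X. X j) \<in> borel_measurable ?L"
      by (rule measurable_compose[OF _ borel_measurable_unif01]) measurable
    have "AE p in unif01 \<Otimes>\<^sub>M ?L. fst p \<noteq> snd p j"
    proof (rule UL.AE_pair_measure)
      show "{p \<in> space (unif01 \<Otimes>\<^sub>M ?L). fst p \<noteq> snd p j} \<in> sets (unif01 \<Otimes>\<^sub>M ?L)" by measurable
      have "AE X in ?L. u \<noteq> X j" for u
        using LP.AE_component[of j "\<lambda>a. a \<noteq> u"] AE_unif01_neq[of u] ij by auto
      then show "AE u in unif01. AE X in ?L. fst (u, X) \<noteq> snd (u, X) j" by simp
    qed
    then have "AE p in unif01 \<Otimes>\<^sub>M ?L. ((\<lambda>(u, X). X(i := u)) p) i \<noteq> ((\<lambda>(u, X). X(i := u)) p) j"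
      using ij by (simp add: case_prod_beta)
    moreover have "{x \<in> space labels. x i \<noteq> x j} \<in> sets labels"
    proof -
      have "(\<lambda>x. x i - x j) \<in> borel_measurable labels"
        by (intro borel_measurable_diff borel_measurable_label ij)
      from measurable_sets[OF this, of "- {0}"] show ?thesis
        by (simp add: vimage_def Int_def conj_commute)
    qed
    ultimately show ?thesis
      by (subst law[symmetric], subst AE_distr_iff[OF m]) simp_all
  qed
  then have *: "AE x in labels. 1 \<le> i \<longrightarrow> 1 \<le> j \<longrightarrow> i \<noteq> j \<longrightarrow> x i \<noteq> x j" for i j
    by auto
  have "AE x in labels. \<forall>j. 1 \<le> i \<longrightarrow> 1 \<le> j \<longrightarrow> i \<noteq> j \<longrightarrow> x i \<noteq> x j" for i
    unfolding AE_all_countable using * by blast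
  then have "AE x in labels. \<forall>i j. 1 \<le> i \<longrightarrow> 1 \<le> j \<longrightarrow> i \<noteq> j \<longrightarrow> x i \<noteq> x j"
    by (subst AE_all_countable) blast
  then show ?thesis by (rule AE_mp) auto
qed

text \<open>Retraction of the real line onto the unit interval. Composed with it, decoding maps that
  live on \<open>unif01\<close> give a graphon that is Borel on the whole space.\<close>

definition clamp :: "real \<Rightarrow> real" where
  "clamp u = max 0 (min 1 u)"

lemma clamp_eq: "u \<in> {0..1} \<Longrightarrow> clamp u = u"
  by (auto simp: clamp_def)

lemma measurable_clamp: "clamp \<in> borel \<rightarrow>\<^sub>M unif01"
proof -
  have "clamp \<in> borel \<rightarrow>\<^sub>M restrict_space borel {0..1}"
    by (rule measurable_restrict_space2) (auto simp: clamp_def[abs_def])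
  moreover have "sets (restrict_space borel {0..1 :: real}) = sets unif01"
    unfolding unif01_def by (rule sets_restrict_space_cong) simp
  ultimately show ?thesis using measurable_cong_sets[OF refl] by blast
qed

text \<open>Evaluating the two nested mixtures requires the edge law to be jointly measurable in
  \<alpha> and the labels. This is checked on square patterns, where
  \<open>edge_law_cylinder\<close> gives an explicit product.\<close>

lemma mixed_graph_cylinder:
  assumes W: "\<forall>\<alpha>\<in>{0..1}. \<forall>u\<in>{0..1}. \<forall>v\<in>{0..1}. W \<alpha> u v \<in> {0..1}"
    and meas: "(\<lambda>(\<alpha>, u, v). W \<alpha> u v) \<in> borel_measurable borel"
  shows "sets (mixed_W_random_graph W) = sets (graph_space {1..})"
    "emeasure (mixed_W_random_graph W) {X \<in> space (graph_space {1..}). \<forall>k\<in>{1..n} \<times> {1..n}. X k = e k} =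
      (\<integral>\<^sup>+\<alpha>. \<integral>\<^sup>+x. (if \<forall>i\<in>{1..n}. \<forall>j\<in>{1..n}. e (i, j) = e (j, i)
       then \<Prod>(i, j)\<in>{(i, j). 1 \<le> i \<and> i \<le> j \<and> j \<le> n}. bernoulli_weight (e (i, j)) (W \<alpha> (x i) (x j)) else 0)
      \<partial>labels \<partial>unif01)"
proof -
  interpret U: prob_space unif01 by (rule prob_space_unif01)
  interpret L: prob_space labels by (rule prob_space_labels)
  have x01: "x i \<in> {0..1}" if "x \<in> space labels" "1 \<le> i" for x i
    using that by (auto simp: space_PiM PiE_iff)
  have W01: "\<forall>i j. 1 \<le> i \<longrightarrow> i \<le> j \<longrightarrow> W \<alpha> (x i) (x j) \<in> {0..1}" if "\<alpha> \<in> {0..1}" "x \<in> space labels" for \<alpha> x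
  proof (intro allI impI)
    fix i j :: nat assume "1 \<le> i" "i \<le> j"
    then show "W \<alpha> (x i) (x j) \<in> {0..1}" by (intro W[rule_format] that x01) auto
  qed
  have W_meas: "(\<lambda>\<omega>. W (fst \<omega>) (snd \<omega> i) (snd \<omega> j)) \<in> borel_measurable (unif01 \<Otimes>\<^sub>M labels)"
    if "1 \<le> i" "1 \<le> j" for i j
  proof -
    note [measurable] = borel_measurable_label[OF that(1)] borel_measurable_label[OF that(2)]
    have "(\<lambda>\<omega>. (fst \<omega>, snd \<omega> i, snd \<omega> j)) \<in> unif01 \<Otimes>\<^sub>M labels \<rightarrow>\<^sub>M borel \<Otimes>\<^sub>M borel \<Otimes>\<^sub>M borel"
      by (intro measurable_Pair measurable_compose[OF measurable_fst borel_measurable_unif01]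
          measurable_compose[OF measurable_snd borel_measurable_label] that)
    then have "(\<lambda>\<omega>. (fst \<omega>, snd \<omega> i, snd \<omega> j)) \<in> unif01 \<Otimes>\<^sub>M labels \<rightarrow>\<^sub>M borel"
      by (simp add: borel_prod)
    from measurable_compose[OF this meas] show ?thesis by simp
  qed
  have kernel: "(\<lambda>(\<alpha>, x). edge_law (W \<alpha>) x) \<in> unif01 \<Otimes>\<^sub>M labels \<rightarrow>\<^sub>M subprob_algebra (graph_space {1..})"
  proof (rule measurable_graph_kernel)
    fix \<omega> assume "\<omega> \<in> space (unif01 \<Otimes>\<^sub>M labels)"
    then obtain \<alpha> x where \<omega>: "\<omega> = (\<alpha>, x)" "\<alpha> \<in> {0..1}" "x \<in> space labels"
      by (auto simp: space_pair_measure)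
    show "prob_space (case \<omega> of (\<alpha>, x) \<Rightarrow> edge_law (W \<alpha>) x)"
      "sets (case \<omega> of (\<alpha>, x) \<Rightarrow> edge_law (W \<alpha>) x) = sets (graph_space {1..})"
      using edge_law_cylinder(1,2)[of "W \<alpha>" x] W01[OF \<omega>(2,3)] by (simp_all add: \<omega>(1))
  next
    fix n :: nat and e :: "nat \<times> nat \<Rightarrow> bool"
    show "(\<lambda>\<omega>. emeasure (case \<omega> of (\<alpha>, x) \<Rightarrow> edge_law (W \<alpha>) x) {X \<in> space (graph_space {1..}). \<forall>k\<in>{1..n} \<times> {1..n}. X k = e k})
        \<in> borel_measurable (unif01 \<Otimes>\<^sub>M labels)"
    proof (rule measurable_cong[THEN iffD2])
      fix \<omega> assume "\<omega> \<in> space (unif01 \<Otimes>\<^sub>M labels)"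
      then obtain \<alpha> x where \<omega>: "\<omega> = (\<alpha>, x)" "\<alpha> \<in> {0..1}" "x \<in> space labels"
        by (auto simp: space_pair_measure)
      show "emeasure (case \<omega> of (\<alpha>, x) \<Rightarrow> edge_law (W \<alpha>) x) {X \<in> space (graph_space {1..}). \<forall>k\<in>{1..n} \<times> {1..n}. X k = e k} =
          (if \<forall>i\<in>{1..n}. \<forall>j\<in>{1..n}. e (i, j) = e (j, i)
           then \<Prod>p\<in>{(i, j). 1 \<le> i \<and> i \<le> j \<and> j \<le> n}. bernoulli_weight (e p) (W (fst \<omega>) (snd \<omega> (fst p)) (snd \<omega> (snd p))) else 0)"
        unfolding \<omega>(1) case_prod_conv
        by (subst edge_law_cylinder(3)[OF W01[OF \<omega>(2,3)]]) (simp_all add: case_prod_beta)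
    next
      have prod: "(\<lambda>\<omega>. \<Prod>p\<in>{(i, j). 1 \<le> i \<and> i \<le> j \<and> j \<le> n}. bernoulli_weight (e p) (W (fst \<omega>) (snd \<omega> (fst p)) (snd \<omega> (snd p))))
          \<in> borel_measurable (unif01 \<Otimes>\<^sub>M labels)"
        by (intro borel_measurable_prod_ennreal measurable_bernoulli_weight W_meas) auto
      show "(\<lambda>\<omega>. if \<forall>i\<in>{1..n}. \<forall>j\<in>{1..n}. e (i, j) = e (j, i)
           then \<Prod>p\<in>{(i, j). 1 \<le> i \<and> i \<le> j \<and> j \<le> n}. bernoulli_weight (e p) (W (fst \<omega>) (snd \<omega> (fst p)) (snd \<omega> (snd p))) else 0)
          \<in> borel_measurable (unif01 \<Otimes>\<^sub>M labels)"
      proof (cases "\<forall>i\<in>{1..n}. \<forall>j\<in>{1..n}. e (i, j) = e (j, i)")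
        case True
        show ?thesis unfolding if_P[OF True] by (rule prod)
      next
        case False
        show ?thesis unfolding if_not_P[OF False] by (rule measurable_const) simp
      qed
    qed
  qed
  have labels: "labels \<in> space (subprob_algebra labels)"
    unfolding space_subprob_algebra using prob_space_imp_subprob_space[OF prob_space_labels] by blast
  have inner: "(\<lambda>\<alpha>. W_random_graph (W \<alpha>)) \<in> unif01 \<rightarrow>\<^sub>M subprob_algebra (graph_space {1..})"
    unfolding W_random_graph_def
    by (rule measurable_bind[OF measurable_const[OF labels] kernel[unfolded case_prod_beta]])
  show "sets (mixed_W_random_graph W) = sets (graph_space {1..})"
    unfolding mixed_W_random_graph_def
    by (rule sets_bind[OF _ U.not_empty]) (use sets_kernel[OF inner] in auto)
  let ?C = "{X \<in> space (graph_space {1..}). \<forall>k\<in>{1..n} \<times> {1..n}. X k = e k}"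
  have C: "?C \<in> sets (graph_space {1..})" by (rule sets_cylinder[where h="\<lambda>k. k"]) auto
  have "emeasure (mixed_W_random_graph W) ?C = (\<integral>\<^sup>+\<alpha>. emeasure (W_random_graph (W \<alpha>)) ?C \<partial>unif01)"
    unfolding mixed_W_random_graph_def by (rule emeasure_bind[OF U.not_empty inner C])
  also have "\<dots> = (\<integral>\<^sup>+\<alpha>. \<integral>\<^sup>+x. emeasure (edge_law (W \<alpha>) x) ?C \<partial>labels \<partial>unif01)"
  proof (rule nn_integral_cong)
    fix \<alpha> assume \<alpha>: "\<alpha> \<in> space unif01"
    have "edge_law (W \<alpha>) \<in> labels \<rightarrow>\<^sub>M subprob_algebra (graph_space {1..})"
      using measurable_compose[OF measurable_Pair1'[OF \<alpha>] kernel] by simp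
    then show "emeasure (W_random_graph (W \<alpha>)) ?C = (\<integral>\<^sup>+x. emeasure (edge_law (W \<alpha>) x) ?C \<partial>labels)"
      unfolding W_random_graph_def by (rule emeasure_bind[OF L.not_empty _ C])
  qed
  also have "\<dots> = (\<integral>\<^sup>+\<alpha>. \<integral>\<^sup>+x. (if \<forall>i\<in>{1..n}. \<forall>j\<in>{1..n}. e (i, j) = e (j, i)
       then \<Prod>(i, j)\<in>{(i, j). 1 \<le> i \<and> i \<le> j \<and> j \<le> n}. bernoulli_weight (e (i, j)) (W \<alpha> (x i) (x j)) else 0)
      \<partial>labels \<partial>unif01)"
  proof (intro nn_integral_cong)
    fix \<alpha> x assume "\<alpha> \<in> space unif01" "x \<in> space labels"
    then have "\<forall>i j. 1 \<le> i \<longrightarrow> i \<le> j \<longrightarrow> W \<alpha> (x i) (x j) \<in> {0..1}" by (intro W01) simp_all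
    then show "emeasure (edge_law (W \<alpha>) x) ?C =
        (if \<forall>i\<in>{1..n}. \<forall>j\<in>{1..n}. e (i, j) = e (j, i)
         then \<Prod>(i, j)\<in>{(i, j). 1 \<le> i \<and> i \<le> j \<and> j \<le> n}. bernoulli_weight (e (i, j)) (W \<alpha> (x i) (x j)) else 0)"
      by (rule edge_law_cylinder(3))
  qed
  finally show "emeasure (mixed_W_random_graph W) ?C =
      (\<integral>\<^sup>+\<alpha>. \<integral>\<^sup>+x. (if \<forall>i\<in>{1..n}. \<forall>j\<in>{1..n}. e (i, j) = e (j, i)
       then \<Prod>(i, j)\<in>{(i, j). 1 \<le> i \<and> i \<le> j \<and> j \<le> n}. bernoulli_weight (e (i, j)) (W \<alpha> (x i) (x j)) else 0)
      \<partial>labels \<partial>unif01)" .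
qed

text \<open>
  Loops carry information on a single vertex, so they are read off the star of the vertex; the
  diagonal, being a null set, does not interfere with the edges.
\<close>

lemma (in exchangeable_kernels) random_graphon_representation:
  obtains W where "random_graphon W" "(\<lambda>(\<alpha>, u, v). W \<alpha> u v) \<in> borel_measurable borel"
    "\<And>n e. (\<And>i j. i \<in> {1..n} \<Longrightarrow> j \<in> {1..n} \<Longrightarrow> e (i, j) = e (j, i)) \<Longrightarrow>
      emeasure Q {z. \<forall>(i, j)\<in>{1..n} \<times> {1..n}. z (2 * i, 2 * j) = e (i, j)} =
      (\<integral>\<^sup>+\<alpha>. \<integral>\<^sup>+x. (\<Prod>(i, j)\<in>{(i, j). 1 \<le> i \<and> i \<le> j \<and> j \<le> n}.
        bernoulli_weight (e (i, j)) (W \<alpha> (x i) (x j))) \<partial>labels \<partial>unif01)"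
proof -
  obtain A y where A: "A \<in> unif01 \<rightarrow>\<^sub>M arr" and y: "(\<lambda>(c, u). y c u) \<in> arr \<Otimes>\<^sub>M unif01 \<rightarrow>\<^sub>M bits"
    and law: "\<And>\<Phi>. \<Phi> \<in> borel_measurable arr \<Longrightarrow> (\<integral>\<^sup>+z. \<Phi> (features z) \<partial>Q) =
      (\<integral>\<^sup>+\<alpha>. \<integral>\<^sup>+x. \<Phi> (model_features (A \<alpha>) (y (A \<alpha>)) x) \<partial>labels \<partial>unif01)"
    using features_law by blast
  \<comment> \<open>On the diagonal the value is the loop bit, 0 or 1, so the coin toss for a loop
    is deterministic given the label. Off the diagonal, exchanging the two stars in
    \<open>join\<close> acts as \<open>swap01\<close>, under which \<open>w\<close> is
    invariant.\<close>
  define W where "W \<alpha> u v = (if u = v then of_bool (y (A (clamp \<alpha>)) (clamp u) 0)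
    else w (join (A (clamp \<alpha>)) (y (A (clamp \<alpha>)) (clamp u)) (y (A (clamp \<alpha>)) (clamp v))))" for \<alpha> u v
  have W01: "W \<alpha> u v \<in> {0..1}" and W_sym: "W \<alpha> u v = W \<alpha> v u" for \<alpha> u v
    using w01 w_sym[of "join (A (clamp \<alpha>)) (y (A (clamp \<alpha>)) (clamp u)) (y (A (clamp \<alpha>)) (clamp v))"]
    by (auto simp: W_def act_swap01_join)
  have W_meas: "(\<lambda>(\<alpha>, u, v). W \<alpha> u v) \<in> borel_measurable borel"
  proof -
    let ?B = "borel \<Otimes>\<^sub>M borel \<Otimes>\<^sub>M borel :: (real \<times> real \<times> real) measure"
    have A': "(\<lambda>p. A (clamp (fst p))) \<in> ?B \<rightarrow>\<^sub>M arr"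
      by (rule measurable_compose[OF measurable_compose[OF measurable_fst measurable_clamp] A])
    have y': "(\<lambda>p. y (A (clamp (fst p))) (clamp (f p))) \<in> ?B \<rightarrow>\<^sub>M bits" if f: "f \<in> borel_measurable ?B" for f
      using measurable_compose[OF measurable_Pair[OF A' measurable_compose[OF f measurable_clamp]] y] by simp
    have f: "(\<lambda>p. fst (snd p)) \<in> borel_measurable ?B" "(\<lambda>p. snd (snd p)) \<in> borel_measurable ?B"
      by measurable
    have [measurable]: "Measurable.pred ?B (\<lambda>p. y (A (clamp (fst p))) (clamp (fst (snd p))) 0)"
      by (rule measurable_compose[OF y'[OF f(1)] measurable_component_singleton]) simp
    have [measurable]: "(\<lambda>p. w (join (A (clamp (fst p))) (y (A (clamp (fst p))) (clamp (fst (snd p))))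
        (y (A (clamp (fst p))) (clamp (snd (snd p)))))) \<in> borel_measurable ?B"
      by (rule measurable_compose[OF measurable_join[OF A' y'[OF f(1)] y'[OF f(2)]] w_measurable])
    have "(\<lambda>p. W (fst p) (fst (snd p)) (snd (snd p))) \<in> borel_measurable ?B"
      unfolding W_def of_bool_def by measurable
    then show ?thesis by (simp add: case_prod_beta borel_prod)
  qed
  have "graphon (W \<alpha>)" for \<alpha>
  proof -
    have "(\<lambda>p :: real \<times> real. (\<alpha>, p)) \<in> borel \<rightarrow>\<^sub>M borel \<Otimes>\<^sub>M borel" by measurable
    then have "(\<lambda>p :: real \<times> real. (\<alpha>, p)) \<in> borel \<rightarrow>\<^sub>M borel" by (simp add: borel_prod)
    from measurable_compose[OF this W_meas] have "(\<lambda>(u, v). W \<alpha> u v) \<in> borel_measurable borel"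
      by (simp add: case_prod_beta)
    then show ?thesis
      unfolding graphon_def using W01 W_sym by (auto intro: measurable_restrict_space1)
  qed
  then have rg: "random_graphon W"
    unfolding random_graphon_def using measurable_restrict_space1[OF W_meas] by blast
  show thesis
  proof (rule that[OF rg W_meas])
    fix n and e :: "nat \<times> nat \<Rightarrow> bool"
    assume e: "\<And>i j. i \<in> {1..n} \<Longrightarrow> j \<in> {1..n} \<Longrightarrow> e (i, j) = e (j, i)"
    have "emeasure Q {z. \<forall>(i, j)\<in>{1..n} \<times> {1..n}. z (2 * i, 2 * j) = e (i, j)} =
        (\<integral>\<^sup>+z. graph_weight n e (features z) \<partial>Q)"
      by (rule emeasure_future_cylinder) (rule e)
    also have "\<dots> = (\<integral>\<^sup>+\<alpha>. \<integral>\<^sup>+x. graph_weight n e (model_features (A \<alpha>) (y (A \<alpha>)) x) \<partial>labels \<partial>unif01)"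
      by (rule law[OF measurable_graph_weight])
    also have "\<dots> = (\<integral>\<^sup>+\<alpha>. \<integral>\<^sup>+x. (\<Prod>(i, j)\<in>{(i, j). 1 \<le> i \<and> i \<le> j \<and> j \<le> n}.
        bernoulli_weight (e (i, j)) (W \<alpha> (x i) (x j))) \<partial>labels \<partial>unif01)"
    \<comment> \<open>An edge weight agrees with the off-diagonal branch of \<open>W\<close>, which
      is in force once the two labels differ, hence almost surely.\<close>
    proof (rule nn_integral_cong, rule nn_integral_cong_AE, rule AE_mp[OF AE_labels_distinct], intro AE_I2 impI)
      fix \<alpha> x assume \<alpha>: "\<alpha> \<in> space unif01" and x: "x \<in> space labels"
        and distinct: "\<forall>i\<ge>1. \<forall>j\<ge>1. i \<noteq> j \<longrightarrow> x i \<noteq> x j"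
      have cl: "clamp \<alpha> = \<alpha>" "1 \<le> i \<Longrightarrow> clamp (x i) = x i" for i
        using \<alpha> x by (auto intro!: clamp_eq simp: space_PiM PiE_iff)
      let ?H = "model_features (A \<alpha>) (y (A \<alpha>)) x"
      have past: "(\<lambda>k. ?H (0, prod_encode k)) = A \<alpha>" by (simp add: model_features_def fun_eq_iff)
      have star: "(\<lambda>m. ?H (i, m)) = y (A \<alpha>) (x i)" if "1 \<le> i" for i
        using that by (simp add: model_features_def fun_eq_iff)
      have "(\<Prod>i\<in>{1..n}. of_bool (?H (i, 0) = e (i, i))) =
          (\<Prod>i\<in>{1..n}. bernoulli_weight (e (i, i)) (W \<alpha> (x i) (x i)))"
        by (intro prod.cong refl) (auto simp: model_features_def W_def cl bernoulli_weight_def of_bool_def)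
      moreover have "(\<Prod>(i, j)\<in>{(i, j). 1 \<le> i \<and> i < j \<and> j \<le> n}. bernoulli_weight (e (i, j))
            (w (join (\<lambda>k. ?H (0, prod_encode k)) (\<lambda>m. ?H (i, m)) (\<lambda>m. ?H (j, m))))) =
          (\<Prod>(i, j)\<in>{(i, j). 1 \<le> i \<and> i < j \<and> j \<le> n}. bernoulli_weight (e (i, j)) (W \<alpha> (x i) (x j)))"
      proof (rule prod.cong[OF refl], clarify)
        fix i j :: nat assume ij: "1 \<le> i" "i < j"
        then have "x i \<noteq> x j" using distinct by simp
        then show "bernoulli_weight (e (i, j)) (w (join (\<lambda>k. ?H (0, prod_encode k)) (\<lambda>m. ?H (i, m)) (\<lambda>m. ?H (j, m)))) =
            bernoulli_weight (e (i, j)) (W \<alpha> (x i) (x j))"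
          using ij star[of i] star[of j] by (simp add: past W_def cl)
      qed
      ultimately show "graph_weight n e ?H = (\<Prod>(i, j)\<in>{(i, j). 1 \<le> i \<and> i \<le> j \<and> j \<le> n}.
          bernoulli_weight (e (i, j)) (W \<alpha> (x i) (x j)))"
        unfolding graph_weight_def prod_ordered_pairs[where f="\<lambda>i j. bernoulli_weight (e (i, j)) (W \<alpha> (x i) (x j))"]
        by (rule arg_cong2[where f="(*)"])
    qed
    finally show "emeasure Q {z. \<forall>(i, j)\<in>{1..n} \<times> {1..n}. z (2 * i, 2 * j) = e (i, j)} =
      (\<integral>\<^sup>+\<alpha>. \<integral>\<^sup>+x. (\<Prod>(i, j)\<in>{(i, j). 1 \<le> i \<and> i \<le> j \<and> j \<le> n}.
        bernoulli_weight (e (i, j)) (W \<alpha> (x i) (x j))) \<partial>labels \<partial>unif01)" .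
  qed
qed

text \<open>The labels are shifted to start at 0, so that past and future are the odd and even ones.
  By invariance under injections, the graph on the labels 2, 4, 6 and so on has the law of the whole
  graph; its pattern probabilities are then compared with those of the mixture.\<close>

lemma exchangeable_graph_is_mixed_W_random:
  assumes P: "random_graph {1..} P"
    and inv: "\<And>\<phi>. inj_on \<phi> {1..} \<Longrightarrow> (\<And>i. 1 \<le> i \<Longrightarrow> 1 \<le> \<phi> i) \<Longrightarrow>
      distr P (graph_space {1..}) (\<lambda>X. \<lambda>(i, j)\<in>{1..} \<times> {1..}. X (\<phi> i, \<phi> j)) = P"
  obtains W where "random_graphon W" "P = mixed_W_random_graph W"
proof -
  note sP = random_graphD(2)[OF P] and spP = random_graphD(3)[OF P]
  interpret P: prob_space P by (rule random_graphD(1)[OF P])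
  let ?s = "\<lambda>X :: nat \<times> nat \<Rightarrow> bool. \<lambda>(i, j). X (Suc i, Suc j)"
  have s: "?s \<in> graph_space {1..} \<rightarrow>\<^sub>M arr"
    by (rule measurable_PiM_countI) (auto simp: case_prod_beta intro!: graph_space_component)
  have sP': "?s \<in> P \<rightarrow>\<^sub>M arr" by (rule measurable_graph_measure[OF sP s])
  have rel: "(\<lambda>X. \<lambda>(i, j)\<in>{1..} \<times> {1..}. X (\<phi> i, \<phi> j)) \<in> P \<rightarrow>\<^sub>M graph_space {1..}"
    if "\<And>i. 1 \<le> i \<Longrightarrow> 1 \<le> \<phi> i" for \<phi>
    using that by (intro measurable_graph_measure[OF sP measurable_relabel_graph]) auto
  define Q where "Q = distr P arr ?s"
  interpret Q: exchangeable_array Q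
  proof (intro exchangeable_array.intro exchangeable_array_axioms.intro)
    show "prob_space Q" unfolding Q_def by (rule P.prob_space_distr[OF sP'])
    show "sets Q = sets arr" by (simp add: Q_def)
    fix \<sigma> :: "nat \<Rightarrow> nat" assume \<sigma>: "inj \<sigma>"
    \<comment> \<open>\<open>\<sigma>\<close> conjugated by the shift between labels from 0 and
      labels from 1.\<close>
    define \<phi> where "\<phi> i = Suc (\<sigma> (i - 1))" for i
    let ?r = "\<lambda>X :: nat \<times> nat \<Rightarrow> bool. \<lambda>(i, j)\<in>{1..} \<times> {1..}. X (\<phi> i, \<phi> j)"
    have \<phi>: "inj_on \<phi> {1..}" "\<And>i. 1 \<le> i \<Longrightarrow> 1 \<le> \<phi> i"
      by (auto simp: \<phi>_def inj_on_def dest!: injD[OF \<sigma>])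
    have "distr Q arr (act \<sigma>) = distr P arr (act \<sigma> \<circ> ?s)"
      unfolding Q_def by (rule distr_distr[OF measurable_act sP'])
    also have "act \<sigma> \<circ> ?s = ?s \<circ> ?r" by (auto simp: fun_eq_iff \<phi>_def act_def)
    also have "distr P arr (?s \<circ> ?r) = distr (distr P (graph_space {1..}) ?r) arr ?s"
      by (rule distr_distr[OF s rel[OF \<phi>(2)], symmetric])
    also have "distr P (graph_space {1..}) ?r = P" by (rule inv) (use \<phi> in auto)
    finally have "distr Q arr (act \<sigma>) = distr P arr ?s" .
    then show "distr Q arr (act \<sigma>) = Q" by (simp only: Q_def)
  next
    have "AE X in P. \<forall>i j. ?s X (i, j) = ?s X (j, i)"
      using random_graphD(4)[OF P] by (rule AE_mp) auto
    moreover have "{z \<in> space arr. \<forall>i j. z (i, j) = z (j, i)} \<in> sets arr" by measurable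
    ultimately show "AE z in Q. \<forall>i j. z (i, j) = z (j, i)"
      unfolding Q_def by (subst AE_distr_iff[OF sP']) simp_all
  qed
  obtain v where v: "\<And>t. (\<lambda>z. v z t) \<in> borel_measurable arr" "AE z in Q. consistent (v z)"
    "\<And>\<sigma> g t. inj \<sigma> \<Longrightarrow> g \<in> borel_measurable arr \<Longrightarrow>
      (\<And>z z'. (\<And>i j. i \<noteq> \<sigma> 0 \<Longrightarrow> j \<noteq> \<sigma> 0 \<Longrightarrow> z (i, j) = z' (i, j)) \<Longrightarrow> g z = g z') \<Longrightarrow>
      (\<integral>\<^sup>+z. of_bool (pre (\<lambda>n. z (\<sigma> 0, \<sigma> n)) (length t) = t) * g z \<partial>Q) =
      (\<integral>\<^sup>+z. ennreal (v (act (\<sigma> \<circ> Suc) z) t) * g z \<partial>Q)"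
    using Q.vertex_kernel by blast
  obtain w where w: "w \<in> borel_measurable arr" "\<And>z. 0 \<le> w z \<and> w z \<le> 1" "\<And>z. w (act swap01 z) = w z"
    "\<And>\<sigma> g. inj \<sigma> \<Longrightarrow> g \<in> borel_measurable arr \<Longrightarrow>
      (\<And>z z'. (\<And>k. k \<noteq> (\<sigma> 0, \<sigma> 1) \<Longrightarrow> k \<noteq> (\<sigma> 1, \<sigma> 0) \<Longrightarrow> z k = z' k) \<Longrightarrow> g z = g z') \<Longrightarrow>
      (\<integral>\<^sup>+z. of_bool (z (\<sigma> 0, \<sigma> 1)) * g z \<partial>Q) = (\<integral>\<^sup>+z. ennreal (w (cut (act \<sigma> z))) * g z \<partial>Q)"
    using Q.edge_kernel by blast
  interpret K: exchangeable_kernels Q v w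
    by unfold_locales (fact v w)+
  obtain W where W: "random_graphon W" and W_meas: "(\<lambda>(\<alpha>, u, v). W \<alpha> u v) \<in> borel_measurable borel"
    and cyl: "\<And>n e. (\<And>i j. i \<in> {1..n} \<Longrightarrow> j \<in> {1..n} \<Longrightarrow> e (i, j) = e (j, i)) \<Longrightarrow>
      emeasure Q {z. \<forall>(i, j)\<in>{1..n} \<times> {1..n}. z (2 * i, 2 * j) = e (i, j)} =
      (\<integral>\<^sup>+\<alpha>. \<integral>\<^sup>+x. (\<Prod>(i, j)\<in>{(i, j). 1 \<le> i \<and> i \<le> j \<and> j \<le> n}.
        bernoulli_weight (e (i, j)) (W \<alpha> (x i) (x j))) \<partial>labels \<partial>unif01)"
    using K.random_graphon_representation by blast
  have W01: "\<forall>\<alpha>\<in>{0..1}. \<forall>u\<in>{0..1}. \<forall>v\<in>{0..1}. W \<alpha> u v \<in> {0..1}"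
    using W unfolding random_graphon_def graphon_def by blast
  note mixed = mixed_graph_cylinder[of W, OF W01 W_meas]
  have "P = mixed_W_random_graph W"
  proof (rule graph_measure_eqI[OF sP P.finite_measure_axioms mixed(1)])
    fix n :: nat and e :: "nat \<times> nat \<Rightarrow> bool" assume "1 \<le> n"
    let ?K = "{1..n} \<times> {1..n}"
    let ?C = "{X \<in> space (graph_space {1..}). \<forall>k\<in>?K. X k = e k}"
    have C: "?C \<in> sets (graph_space {1..})" by (rule sets_cylinder[where h="\<lambda>k. k"]) auto
    have spP': "space P = space (graph_space {1..})" by (rule sets_eq_imp_space_eq[OF sP])
    have spM: "space (mixed_W_random_graph W) = space (graph_space {1..})"
      by (rule sets_eq_imp_space_eq[OF mixed(1)])
    show "emeasure P {X \<in> space P. \<forall>k\<in>?K. X k = e k} =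
        emeasure (mixed_W_random_graph W) {X \<in> space (mixed_W_random_graph W). \<forall>k\<in>?K. X k = e k}"
    proof (cases "\<forall>i\<in>{1..n}. \<forall>j\<in>{1..n}. e (i, j) = e (j, i)")
      case True
      \<comment> \<open>\<open>\<phi>\<close> sends the label \<open>i\<close> to the future vertex
        \<open>2 * i\<close>, with \<open>Suc\<close> accounting for the shift
        \<open>?s\<close>.\<close>
      define \<phi> where "\<phi> i = Suc (2 * i)" for i
      let ?r = "\<lambda>X :: nat \<times> nat \<Rightarrow> bool. \<lambda>(i, j)\<in>{1..} \<times> {1..}. X (\<phi> i, \<phi> j)"
      have \<phi>: "inj_on \<phi> {1..}" "\<And>i. 1 \<le> i \<Longrightarrow> 1 \<le> \<phi> i" by (auto simp: \<phi>_def inj_on_def)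
      let ?E = "{z :: nat \<times> nat \<Rightarrow> bool. \<forall>(i, j)\<in>?K. z (2 * i, 2 * j) = e (i, j)}"
      have "{z \<in> space arr. \<forall>k\<in>?K. z (2 * fst k, 2 * snd k) = e k} \<in> sets arr" by measurable
      then have E: "?E \<in> sets arr" by (simp add: case_prod_beta space_PiM)
      have "distr P (graph_space {1..}) ?r = P" by (rule inv) (use \<phi> in auto)
      then have "emeasure P ?C = emeasure (distr P (graph_space {1..}) ?r) ?C" by simp
      also have "\<dots> = emeasure P (?r -` ?C \<inter> space P)" by (rule emeasure_distr[OF rel[OF \<phi>(2)] C])
      also have "?r -` ?C \<inter> space P = ?s -` ?E \<inter> space P"
        by (auto simp: space_graph_space \<phi>_def)
      also have "emeasure P \<dots> = emeasure Q ?E"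
        unfolding Q_def by (rule emeasure_distr[OF sP' E, symmetric])
      also have "\<dots> = (\<integral>\<^sup>+\<alpha>. \<integral>\<^sup>+x. (\<Prod>(i, j)\<in>{(i, j). 1 \<le> i \<and> i \<le> j \<and> j \<le> n}.
        bernoulli_weight (e (i, j)) (W \<alpha> (x i) (x j))) \<partial>labels \<partial>unif01)"
        using True by (intro cyl) blast
      also have "\<dots> = emeasure (mixed_W_random_graph W) ?C"
        unfolding mixed(2) if_P[OF True] ..
      finally show ?thesis unfolding spP' spM .
    next
      case False
      then obtain i j where ij: "i \<in> {1..n}" "j \<in> {1..n}" "e (i, j) \<noteq> e (j, i)" by blast
      \<comment> \<open>Asymmetric patterns have probability zero on both sides: here by almost sure
        symmetry, in the mixture by the construction of the edge law.\<close>
      have "AE X in P. X \<notin> ?C"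
        using random_graphD(4)[OF P]
      proof (rule AE_mp, intro AE_I2 impI notI)
        fix X assume sym: "\<forall>i\<in>{1..}. \<forall>j\<in>{1..}. X (i, j) = X (j, i)" and X: "X \<in> ?C"
        have "i \<in> {1..}" "j \<in> {1..}" using ij by auto
        with sym have "X (i, j) = X (j, i)" by blast
        moreover have "X k = e k" if "k \<in> ?K" for k using X that by blast
        ultimately show False using ij by (metis SigmaI)
      qed
      then have "emeasure P ?C = 0"
        using emeasure_eq_AE[where M=P and A="?C" and B="{}"] C sP by simp
      also have "0 = emeasure (mixed_W_random_graph W) ?C"
        unfolding mixed(2) if_not_P[OF False] by simp
      finally show ?thesis unfolding spP' spM .
    qed
  qed
  then show thesis by (rule that[OF W])
qed

theorem corollary4p3:
  fixes G :: "nat \<Rightarrow> (nat \<times> nat \<Rightarrow> bool) measure"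
  assumes "projective_sequence G"
    and "\<And>n. n \<ge> 1 \<Longrightarrow> permutation_invariant {1..n} (G n)"
  shows "(\<exists>!P. is_projective_limit G P) \<and>
    (\<forall>P. is_projective_limit G P \<longrightarrow>
       permutation_invariant {1..} P \<and>
       (\<exists>W. random_graphon W \<and> P = mixed_W_random_graph W))"
proof (intro conjI allI impI)
  show "\<exists>!P. is_projective_limit G P"
    using projective_limit_exists[OF assms(1)] projective_limit_unique by blast
  fix P assume P: "is_projective_limit G P"
  have inv: "distr P (graph_space {1..}) (\<lambda>X. \<lambda>(i, j)\<in>{1..} \<times> {1..}. X (\<phi> i, \<phi> j)) = P"
    if "inj_on \<phi> {1..}" "\<And>i. 1 \<le> i \<Longrightarrow> 1 \<le> \<phi> i" for \<phi>
    by (rule projective_limit_injection_invariant[OF assms(1) _ P that(1)]) (use assms(2) that(2) in auto)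
  show "permutation_invariant {1..} P"
    unfolding permutation_invariant_def relabel_graph_def
  proof (intro allI impI)
    fix \<phi> :: "nat \<Rightarrow> nat" assume \<phi>: "\<phi> permutes {1..}"
    have "1 \<le> \<phi> i" if "1 \<le> i" for i using permutes_in_image[OF \<phi>, of i] that by simp
    then show "distr P (graph_space {1..}) (\<lambda>X. \<lambda>(i, j)\<in>{1..} \<times> {1..}. X (\<phi> i, \<phi> j)) = P"
      by (rule inv[OF permutes_inj_on[OF \<phi>]])
  qed
  have "random_graph {1..} P" using P by (simp add: is_projective_limit_def)
  then show "\<exists>W. random_graphon W \<and> P = mixed_W_random_graph W"
    using exchangeable_graph_is_mixed_W_random[OF _ inv] by metis
qed

end
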